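(* The average-case time complexity of the word problem in any finitely generated free solvable group is linear.
   Context: A finitely generated free solvable group is a group of the form $F/F^{(d)}$, where $F$ is a free group of finite rank and $F^{(d)}$ is the $d$th term of its derived series. Algorithms run on multitape Turing machines. A group $G$ is given with a fixed finite generating set $X$; inputs are arbitrary (not necessarily freely reduced) words in the alphabet $X\cup X^{-1}$, and $W_n$ denotes the set of all such words of length $n$. The word problem: given a word $w$, decide whether $w=1$ in $G$. For an algorithm, $T(w)$ is its running time on input $w$. The average-case time complexity of the word problem in $G$ is linear if there is an algorithm solving the word problem in $G$ for which $\frac{1}{|W_n|}\sum_{w\in W_n}T(w)=O(n)$. *)

theory Defs
  imports "HOL-Algebra.Solvable_Groups" "HOL-Library.Landau_Symbols"
begin

section \<open>Words and free groups\<close>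

text \<open>
  Inverse letters are formal: a generating set \<open>X\<close> always contributes \<open>2 |X|\<close> letters, even if
  two of them denote the same group element.
\<close>

datatype 'a letter = Gen 'a | InvGen 'a

fun inv_letter :: "'a letter \<Rightarrow> 'a letter" where
  "inv_letter (Gen x) = InvGen x"
| "inv_letter (InvGen x) = Gen x"

definition letters :: "'a set \<Rightarrow> 'a letter set" where
  "letters X = Gen ` X \<union> InvGen ` X"

inductive_set free_cong :: "'a set \<Rightarrow> ('a letter list \<times> 'a letter list) set"
  for S :: "'a set" where
  refl: "w \<in> lists (letters S) \<Longrightarrow> (w, w) \<in> free_cong S"
| cancel: "u \<in> lists (letters S) \<Longrightarrow> l \<in> letters S \<Longrightarrow> v \<in> lists (letters S) \<Longrightarrow>
    (u @ [l, inv_letter l] @ v, u @ v) \<in> free_cong S"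
| sym: "(u, v) \<in> free_cong S \<Longrightarrow> (v, u) \<in> free_cong S"
| trans: "(u, v) \<in> free_cong S \<Longrightarrow> (v, w) \<in> free_cong S \<Longrightarrow> (u, w) \<in> free_cong S"

definition free_group :: "'a set \<Rightarrow> 'a letter list set monoid" where
  "free_group S =
    \<lparr>carrier = lists (letters S) // free_cong S,
     mult = (\<lambda>A B. \<Union>a\<in>A. \<Union>b\<in>B. free_cong S `` {a @ b}),
     one = free_cong S `` {[]}\<rparr>"

definition derived_term :: "('g, 'm) monoid_scheme \<Rightarrow> nat \<Rightarrow> 'g set" where
  "derived_term G d = (derived G ^^ d) (carrier G)"

definition fg_free_solvable_group :: "('g, 'm) monoid_scheme \<Rightarrow> bool" where
  "fg_free_solvable_group G \<longleftrightarrow> group G \<and>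
    (\<exists>r d. G \<cong> free_group {..<r::nat} Mod derived_term (free_group {..<r}) d)"

lemma inv_letter_inv_letter [simp]: "inv_letter (inv_letter l) = l"
  by (cases l) auto

lemma inv_letter_in_letters [simp]: "inv_letter l \<in> letters S \<longleftrightarrow> l \<in> letters S"
  by (cases l) (auto simp: letters_def)

lemma free_cong_in_lists:
  "(u, v) \<in> free_cong S \<Longrightarrow> u \<in> lists (letters S) \<and> v \<in> lists (letters S)"
  by (induction rule: free_cong.induct) auto

lemma equiv_free_cong: "equiv (lists (letters S)) (free_cong S)"
proof (rule equivI)
  show "free_cong S \<subseteq> lists (letters S) \<times> lists (letters S)"
    by (auto dest: free_cong_in_lists simp del: in_lists_conv_set)
  show "refl_on (lists (letters S)) (free_cong S)"
    by (rule refl_onI) (rule free_cong.refl)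
  show "sym (free_cong S)" by (rule symI) (rule free_cong.sym)
  show "trans (free_cong S)" by (rule transI) (rule free_cong.trans)
qed

lemma free_cong_append_left:
  "(u, v) \<in> free_cong S \<Longrightarrow> w \<in> lists (letters S) \<Longrightarrow> (w @ u, w @ v) \<in> free_cong S"
proof (induction rule: free_cong.induct)
  case (cancel u l v)
  then show ?case using free_cong.cancel[of "w @ u" S l v] by simp
next
  case (sym u v)
  then show ?case by (simp add: free_cong.sym)
next
  case (trans u v x)
  from trans.IH(1)[OF trans.prems] trans.IH(2)[OF trans.prems] show ?case
    by (rule free_cong.trans)
qed (simp add: free_cong.refl)

lemma free_cong_append_right:
  "(u, v) \<in> free_cong S \<Longrightarrow> w \<in> lists (letters S) \<Longrightarrow> (u @ w, v @ w) \<in> free_cong S"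
proof (induction rule: free_cong.induct)
  case (cancel u l v)
  then show ?case using free_cong.cancel[of u S l "v @ w"] by simp
next
  case (sym u v)
  then show ?case by (simp add: free_cong.sym)
next
  case (trans u v x)
  from trans.IH(1)[OF trans.prems] trans.IH(2)[OF trans.prems] show ?case
    by (rule free_cong.trans)
qed (simp add: free_cong.refl)

lemma free_cong_append:
  assumes "(a, a') \<in> free_cong S" "(b, b') \<in> free_cong S"
  shows "(a @ b, a' @ b') \<in> free_cong S"
proof (rule free_cong.trans)
  show "(a @ b, a' @ b) \<in> free_cong S"
    using assms free_cong_in_lists by (blast intro: free_cong_append_right)
  show "(a' @ b, a' @ b') \<in> free_cong S"
    using assms free_cong_in_lists by (blast intro: free_cong_append_left)
qed

lemma free_group_mult:
  assumes "a \<in> lists (letters S)" "b \<in> lists (letters S)"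
  shows "free_cong S `` {a} \<otimes>\<^bsub>free_group S\<^esub> free_cong S `` {b} = free_cong S `` {a @ b}"
proof -
  let ?A = "free_cong S `` {a}" and ?B = "free_cong S `` {b}"
  have "(\<Union>a'\<in>?A. \<Union>b'\<in>?B. free_cong S `` {a' @ b'}) =
      (\<Union>a'\<in>?A. \<Union>b'\<in>?B. free_cong S `` {a @ b})"
  proof (intro SUP_cong HOL.refl)
    fix a' b' assume "a' \<in> ?A" "b' \<in> ?B"
    then have "(a @ b, a' @ b') \<in> free_cong S" by (simp add: free_cong_append)
    then show "free_cong S `` {a' @ b'} = free_cong S `` {a @ b}"
      by (rule equiv_class_eq[OF equiv_free_cong, symmetric])
  qed
  also have "\<dots> = free_cong S `` {a @ b}"
  proof -
    have "a \<in> ?A" "b \<in> ?B"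
      using assms by (simp_all add: free_cong.refl)
    then have "?A \<noteq> {}" "?B \<noteq> {}" by blast+
    then show ?thesis by simp
  qed
  finally show ?thesis by (simp add: free_group_def)
qed

lemma free_cong_inverse:
  "w \<in> lists (letters S) \<Longrightarrow> (map inv_letter (rev w) @ w, []) \<in> free_cong S"
proof (induction w)
  case Nil
  then show ?case by (simp add: free_cong.refl)
next
  case (Cons l w)
  then have "map inv_letter (rev w) \<in> lists (letters S)" by auto
  with Cons.prems have
    "(map inv_letter (rev (l # w)) @ l # w, map inv_letter (rev w) @ w) \<in> free_cong S"
    using free_cong.cancel[of "map inv_letter (rev w)" S "inv_letter l" w] by simp
  moreover have "(map inv_letter (rev w) @ w, []) \<in> free_cong S"
    using Cons by simp
  ultimately show ?case by (rule free_cong.trans)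
qed

lemma group_free_group: "group (free_group S)"
proof (rule groupI)
  fix x y assume "x \<in> carrier (free_group S)" "y \<in> carrier (free_group S)"
  then obtain a b where "a \<in> lists (letters S)" "x = free_cong S `` {a}"
    "b \<in> lists (letters S)" "y = free_cong S `` {b}"
    by (auto simp: free_group_def elim!: quotientE)
  then have "x \<otimes>\<^bsub>free_group S\<^esub> y = free_cong S `` {a @ b}" "a @ b \<in> lists (letters S)"
    using free_group_mult by auto
  then show "x \<otimes>\<^bsub>free_group S\<^esub> y \<in> carrier (free_group S)"
    by (simp add: free_group_def quotientI)
next
  show "\<one>\<^bsub>free_group S\<^esub> \<in> carrier (free_group S)"
    by (simp add: free_group_def quotientI)
next
  fix x y z
  assume "x \<in> carrier (free_group S)" "y \<in> carrier (free_group S)" "z \<in> carrier (free_group S)"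
  then obtain a b c where "a \<in> lists (letters S)" "x = free_cong S `` {a}"
    "b \<in> lists (letters S)" "y = free_cong S `` {b}"
    "c \<in> lists (letters S)" "z = free_cong S `` {c}"
    by (auto simp: free_group_def elim!: quotientE)
  then show "x \<otimes>\<^bsub>free_group S\<^esub> y \<otimes>\<^bsub>free_group S\<^esub> z
      = x \<otimes>\<^bsub>free_group S\<^esub> (y \<otimes>\<^bsub>free_group S\<^esub> z)"
    using free_group_mult[of "a @ b" S c] free_group_mult[of a S "b @ c"]
    by (simp add: free_group_mult)
next
  have one: "\<one>\<^bsub>free_group S\<^esub> = free_cong S `` {[]}" by (simp add: free_group_def)
  fix x assume "x \<in> carrier (free_group S)"
  then obtain a where a: "a \<in> lists (letters S)" "x = free_cong S `` {a}"
    by (auto simp: free_group_def elim!: quotientE)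
  then show "\<one>\<^bsub>free_group S\<^esub> \<otimes>\<^bsub>free_group S\<^esub> x = x"
    using free_group_mult[of "[]" S a] one by simp
  let ?b = "map inv_letter (rev a)"
  have b: "?b \<in> lists (letters S)" using a by auto
  have "free_cong S `` {?b} \<otimes>\<^bsub>free_group S\<^esub> x = \<one>\<^bsub>free_group S\<^esub>"
    using free_group_mult[OF b a(1)] a(2) one
      equiv_class_eq[OF equiv_free_cong free_cong_inverse[OF a(1)]] by simp
  moreover have "free_cong S `` {?b} \<in> carrier (free_group S)"
    using b by (simp add: free_group_def quotientI)
  ultimately show "\<exists>y\<in>carrier (free_group S). y \<otimes>\<^bsub>free_group S\<^esub> x = \<one>\<^bsub>free_group S\<^esub>"
    by blast
qed

lemma derived_term_normal:
  assumes "group G"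
  shows "derived_term G d \<lhd> G"
  using assms group.derived_is_normal group.normal_self
  by (induction d) (auto simp: derived_term_def)

lemma fg_free_solvable_group_free_solvable:
  "fg_free_solvable_group (free_group {..<r::nat} Mod derived_term (free_group {..<r}) d)"
  using derived_term_normal[OF group_free_group] normal.factorgroup_is_group iso_refl
  unfolding fg_free_solvable_group_def by blast

section \<open>Deterministic multitape Turing machines\<close>

text \<open>
  The tape alphabet consists of a blank, the input letters themselves (so no encoding of the
  input is needed), and work symbols. Tapes are infinite in both directions.
\<close>

datatype 'l symbol = Blank | Input 'l | Work nat

datatype dir = MoveLeft | Stay | MoveRight

fun dir_offset :: "dir \<Rightarrow> int" where
  "dir_offset MoveLeft = -1"
| "dir_offset Stay = 0"
| "dir_offset MoveRight = 1"

record 'l tm =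
  tapes :: nat
  states :: "nat set"
  symbols :: "'l symbol set"
  start :: nat
  accept :: nat
  reject :: nat
  trans_fun :: "nat \<Rightarrow> 'l symbol list \<Rightarrow> nat \<times> ('l symbol \<times> dir) list"

text \<open>
  Only the values of \<open>trans_fun\<close> at non-halting states and at lists of \<open>tapes M\<close> many scanned
  symbols matter, so a machine is a finite object.
\<close>

definition tm_wf :: "'l set \<Rightarrow> 'l tm \<Rightarrow> bool" where
  "tm_wf A M \<longleftrightarrow>
    tapes M \<ge> 1 \<and> finite (states M) \<and> finite (symbols M) \<and>
    Blank \<in> symbols M \<and> Input ` A \<subseteq> symbols M \<and>
    start M \<in> states M \<and> accept M \<in> states M \<and> reject M \<in> states M \<and> accept M \<noteq> reject M \<and>
    (\<forall>q \<in> states M - {accept M, reject M}. \<forall>ss \<in> lists (symbols M). length ss = tapes M \<longrightarrow>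
      (case trans_fun M q ss of (q', acts) \<Rightarrow>
        q' \<in> states M \<and> length acts = tapes M \<and> fst ` set acts \<subseteq> symbols M))"

text \<open>A tape is given by its head position and its contents.\<close>

type_synonym 'l tape = "int \<times> (int \<Rightarrow> 'l symbol)"
type_synonym 'l config = "nat \<times> 'l tape list"

fun act :: "'l tape \<Rightarrow> 'l symbol \<times> dir \<Rightarrow> 'l tape" where
  "act (h, t) (s, m) = (h + dir_offset m, t(h := s))"

definition halted :: "'l tm \<Rightarrow> 'l config \<Rightarrow> bool" where
  "halted M c \<longleftrightarrow> fst c \<in> {accept M, reject M}"

definition tm_step :: "'l tm \<Rightarrow> 'l config \<Rightarrow> 'l config" where
  "tm_step M c =
    (if halted M c then c
     else let (q', acts) = trans_fun M (fst c) (map (\<lambda>(h, t). t h) (snd c))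
          in (q', map2 act (snd c) acts))"

definition input_tape :: "'l list \<Rightarrow> 'l tape" where
  "input_tape w = (0, \<lambda>i. if 0 \<le> i \<and> i < int (length w) then Input (w ! nat i) else Blank)"

definition init_config :: "'l tm \<Rightarrow> 'l list \<Rightarrow> 'l config" where
  "init_config M w = (start M, input_tape w # replicate (tapes M - 1) (input_tape []))"

definition config_after :: "'l tm \<Rightarrow> 'l list \<Rightarrow> nat \<Rightarrow> 'l config" where
  "config_after M w t = (tm_step M ^^ t) (init_config M w)"

definition halts_on :: "'l tm \<Rightarrow> 'l list \<Rightarrow> bool" where
  "halts_on M w \<longleftrightarrow> (\<exists>t. halted M (config_after M w t))"

text \<open>Meaningful only if \<open>halts_on M w\<close>.\<close>

definition running_time :: "'l tm \<Rightarrow> 'l list \<Rightarrow> nat" where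
  "running_time M w = (LEAST t. halted M (config_after M w t))"

definition accepts :: "'l tm \<Rightarrow> 'l list \<Rightarrow> bool" where
  "accepts M w \<longleftrightarrow> (\<exists>t. fst (config_after M w t) = accept M)"

definition decides :: "'l tm \<Rightarrow> 'l set \<Rightarrow> 'l list set \<Rightarrow> bool" where
  "decides M A L \<longleftrightarrow> tm_wf A M \<and>
    (\<forall>w \<in> lists A. halts_on M w \<and> (accepts M w \<longleftrightarrow> w \<in> L))"

section \<open>The word problem and its average-case complexity\<close>

fun letter_value :: "('g, 'm) monoid_scheme \<Rightarrow> 'g letter \<Rightarrow> 'g" where
  "letter_value G (Gen x) = x"
| "letter_value G (InvGen x) = inv\<^bsub>G\<^esub> x"

definition word_value :: "('g, 'm) monoid_scheme \<Rightarrow> 'g letter list \<Rightarrow> 'g" where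
  "word_value G w = foldr (\<lambda>l g. letter_value G l \<otimes>\<^bsub>G\<^esub> g) w \<one>\<^bsub>G\<^esub>"

definition word_problem :: "('g, 'm) monoid_scheme \<Rightarrow> 'g set \<Rightarrow> 'g letter list set" where
  "word_problem G X = {w \<in> lists (letters X). word_value G w = \<one>\<^bsub>G\<^esub>}"

definition words_of_length :: "'g set \<Rightarrow> nat \<Rightarrow> 'g letter list set" where
  "words_of_length X n = {w \<in> lists (letters X). length w = n}"

definition average_time :: "'g letter tm \<Rightarrow> 'g set \<Rightarrow> nat \<Rightarrow> real" where
  "average_time M X n =
    (\<Sum>w \<in> words_of_length X n. real (running_time M w)) / real (card (words_of_length X n))"

definition linear_average_case_word_problem :: "('g, 'm) monoid_scheme \<Rightarrow> 'g set \<Rightarrow> bool" where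
  "linear_average_case_word_problem G X \<longleftrightarrow>
    (\<exists>M. decides M (letters X) (word_problem G X) \<and> average_time M X \<in> O(\<lambda>n. real n))"

end

theory Submission
  imports Defs "HOL-Library.Groups_Big_Fun" "HOL-Library.Countable"
begin

text \<open>
  Write \<open>G = F/F\<^sup>(\<^sup>d\<^sup>)\<close> with \<open>F\<close> free of rank \<open>r\<close>. If \<open>G\<close> is free abelian, counters for the exponent
  sums decide the word problem in linear time on every input. If \<open>d \<ge> 2\<close> and \<open>r \<ge> 2\<close>, then \<open>G\<close> maps onto
  the lamplighter group, whose elements can be tracked on a tape (the cells are the lamps, the head is
  the lamplighter), so in linear time one rejects every word that is nontrivial there. The
  lamplighter group has exponential growth, so by a Nash type inequality (after Coulhon, Saloff-Coste
  and Varopoulos) a random word is trivial in it with probability smaller than any power of \<open>1/n\<close>.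

  On the remaining words any polynomial time algorithm is good enough. A word lies in \<open>[N,N]\<close>, for \<open>N\<close>
  normal in \<open>F\<close>, iff its path in the Cayley graph of \<open>F/N\<close> crosses every edge with net multiplicity
  zero; by recursion on \<open>d\<close> this gives an algorithm that only moves boundedly many heads over the
  input. Such an algorithm has polynomially many configurations, and a terminating deterministic
  run never repeats one.
\<close>

section \<open>Return probabilities of symmetric random walks on groups\<close>

text \<open>The degree of the polynomial algorithm grows with \<open>d\<close>, whereas in a free
  abelian group of rank \<open>r\<close> a random word is trivial with probability of order n^(-r/2)
  only. Hence the fast test cannot stop at the abelianization. The lamplighter group is still
  metabelian and generated by two elements, but words of length O(k) reach 2^k of its elements, and
  this forces decay like exp (- c n^(1/3)).

  The generators \<open>X\<close> of \<open>G\<close> are arbitrary, so the induced walk on the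
  lamplighter group has arbitrary symmetric steps, possibly trivial or repeated. The estimate
  therefore rests on one general fact: averaging translates of a density lowers its squared l2 norm
  exactly by their variance. If the norm hardly drops, the density is almost invariant under all
  short words. But many almost equal translates overlap with a density of total mass one, so the
  norm was already small. Either way the norm is controlled, without any knowledge of the steps
  beyond the elements that they reach.\<close>

abbreviation fsupp :: "('a \<Rightarrow> real) \<Rightarrow> bool" where
  "fsupp f \<equiv> finite {x. f x \<noteq> 0}"

abbreviation ssq :: "('a \<Rightarrow> real) \<Rightarrow> real" where
  "ssq f \<equiv> Sum_any (\<lambda>x. (f x)\<^sup>2)"

section \<open>Finitely supported functions on a group\<close>

lemma bij_translate: "bij (\<lambda>x::'a::group_add. a + x)"
  by (rule bij_betw_byWitness[where f' = "\<lambda>x. - a + x"]) (auto simp: add.assoc[symmetric])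

lemma bij_reflect: "bij (\<lambda>x::'a::group_add. - x + y)"
proof (rule bij_betw_byWitness[where f' = "\<lambda>x. y - x"])
  show "\<forall>a\<in>UNIV. y - (- a + y) = a" by (simp add: diff_conv_add_uminus minus_add)
  show "\<forall>a'\<in>UNIV. - (y - a') + y = a'" by simp
qed auto

lemma fsupp_bij: "fsupp f \<Longrightarrow> bij l \<Longrightarrow> fsupp (\<lambda>x. f (l x))"
  using finite_vimageI[of "{x. f x \<noteq> 0}" l] by (simp add: vimage_def bij_is_inj)

lemma fsupp_translate: "fsupp f \<Longrightarrow> fsupp (\<lambda>x::'a::group_add. f (a + x))"
  using fsupp_bij bij_translate by blast

lemma Sum_any_bij: "bij l \<Longrightarrow> Sum_any (\<lambda>x. f (l x)) = Sum_any f"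
  by (rule Sum_any.reindex_cong[symmetric]) (auto simp: o_def)

lemma Sum_any_translate: "Sum_any (\<lambda>x::'a::group_add. f (a + x)) = Sum_any f"
  by (rule Sum_any_bij) (rule bij_translate)

lemma fsupp_diff: "fsupp f \<Longrightarrow> fsupp g \<Longrightarrow> fsupp (\<lambda>x. f x - g x)"
  by (rule finite_subset[of _ "{x. f x \<noteq> 0} \<union> {x. g x \<noteq> 0}"]) auto

lemma fsupp_add: "fsupp f \<Longrightarrow> fsupp g \<Longrightarrow> fsupp (\<lambda>x. f x + g x)"
  by (rule finite_subset[of _ "{x. f x \<noteq> 0} \<union> {x. g x \<noteq> 0}"]) auto

lemma fsupp_mult: "fsupp f \<Longrightarrow> fsupp (\<lambda>x. f x * g x)"
  by (rule finite_subset[of _ "{x. f x \<noteq> 0}"]) auto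

lemma fsupp_scale: "fsupp f \<Longrightarrow> fsupp (\<lambda>x. c * f x)"
  by (rule finite_subset[of _ "{x. f x \<noteq> 0}"]) auto

lemma fsupp_power2: "fsupp f \<Longrightarrow> fsupp (\<lambda>x. (f x)\<^sup>2)"
  by simp

lemma fsupp_sum: "finite L \<Longrightarrow> (\<And>l. l \<in> L \<Longrightarrow> fsupp (f l)) \<Longrightarrow> fsupp (\<lambda>x. \<Sum>l\<in>L. f l x)"
proof (induction L rule: finite_induct)
  case (insert l L)
  then show ?case using fsupp_add[of "f l" "\<lambda>x. \<Sum>l\<in>L. f l x"] by simp
qed simp

lemma Sum_any_mono:
  assumes "fsupp f" "fsupp g" "\<And>x. f x \<le> g x"
  shows "Sum_any f \<le> Sum_any g"
proof -
  let ?A = "{x. f x \<noteq> 0} \<union> {x. g x \<noteq> 0}"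
  have "Sum_any f = sum f ?A" "Sum_any g = sum g ?A"
    using assms by (auto intro!: Sum_any.expand_superset)
  then show ?thesis using assms(3) by (simp add: sum_mono)
qed

lemma Sum_any_nonneg: "(\<And>x. (0::real) \<le> f x) \<Longrightarrow> 0 \<le> Sum_any f"
  by (simp add: Sum_any.expand_set sum_nonneg)

lemma Sum_any_scale: "fsupp f \<Longrightarrow> Sum_any (\<lambda>x. c * f x) = c * Sum_any f"
  by (simp add: Sum_any_right_distrib)

lemma Sum_any_diff:
  assumes "fsupp f" "fsupp g" shows "Sum_any (\<lambda>x. f x - g x) = Sum_any f - Sum_any g"
proof -
  have "Sum_any (\<lambda>x. f x + (-1) * g x) = Sum_any f + Sum_any (\<lambda>x. (-1) * g x)"
    using assms by (intro Sum_any.distrib fsupp_scale)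
  then show ?thesis using Sum_any_scale[OF assms(2), of "-1"] by simp
qed

lemma Sum_any_sum:
  "finite L \<Longrightarrow> (\<And>l. l \<in> L \<Longrightarrow> fsupp (f l)) \<Longrightarrow>
    Sum_any (\<lambda>x. \<Sum>l\<in>L. f l x) = (\<Sum>l\<in>L. Sum_any (f l))"
proof (induction L rule: finite_induct)
  case (insert l L)
  then show ?case
    using Sum_any.distrib[of "f l" "\<lambda>x. \<Sum>l\<in>L. f l x"] by (simp add: fsupp_sum)
qed simp

section \<open>Random walks and the energy of translations\<close>

lemma sum_square_differences:
  fixes a :: "'l \<Rightarrow> real"
  shows "(\<Sum>l\<in>L. \<Sum>k\<in>L. (a l - a k)\<^sup>2) = 2 * card L * (\<Sum>l\<in>L. (a l)\<^sup>2) - 2 * (\<Sum>l\<in>L. a l)\<^sup>2"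
proof -
  have "(\<Sum>l\<in>L. \<Sum>k\<in>L. (a l - a k)\<^sup>2)
      = (\<Sum>l\<in>L. \<Sum>k\<in>L. (a l)\<^sup>2 + (a k)\<^sup>2 - 2 * (a l * a k))"
    by (simp add: power2_diff algebra_simps)
  also have "\<dots> = 2 * card L * (\<Sum>l\<in>L. (a l)\<^sup>2) - 2 * (\<Sum>l\<in>L. \<Sum>k\<in>L. a l * a k)"
    by (simp add: sum.distrib sum_subtractf sum_distrib_left[symmetric])
  finally show ?thesis by (simp add: power2_eq_square sum_product)
qed

text \<open>The distribution of \<open>sum_list (map h w)\<close> for a uniform word
  \<open>w\<close> of length \<open>n\<close>; \<open>group_add\<close> is not assumed commutative,
  and the new letter is put in front.\<close>

primrec walk :: "'l set \<Rightarrow> ('l \<Rightarrow> 'a::group_add) \<Rightarrow> nat \<Rightarrow> 'a \<Rightarrow> real" where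
  "walk L h 0 = (\<lambda>x. if x = 0 then 1 else 0)"
| "walk L h (Suc n) = (\<lambda>x. (\<Sum>l\<in>L. walk L h n (- h l + x)) / card L)"

abbreviation loops :: "'l set \<Rightarrow> ('l \<Rightarrow> 'a::group_add) \<Rightarrow> nat \<Rightarrow> 'l list set" where
  "loops L h n \<equiv> {w \<in> lists L. length w = n \<and> sum_list (map h w) = 0}"

locale symmetric_walk =
  fixes L :: "'l set" and h :: "'l \<Rightarrow> 'a::group_add" and bar :: "'l \<Rightarrow> 'l"
  assumes fin: "finite L" and nonempty: "L \<noteq> {}"
    and bar_closed: "l \<in> L \<Longrightarrow> bar l \<in> L" and h_bar: "l \<in> L \<Longrightarrow> h (bar l) = - h l"
begin

abbreviation "p \<equiv> walk L h"
abbreviation "u n \<equiv> ssq (p n)"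
abbreviation "N \<equiv> real (card L)"

lemma N_pos: "N > 0" "N \<ge> 1"
  using fin nonempty by (simp_all add: card_gt_0_iff Suc_leI)

lemma p_fsupp: "fsupp (p n)"
proof (induction n)
  case (Suc n)
  have "fsupp (\<lambda>x. inverse N * (\<Sum>l\<in>L. p n (- h l + x)))"
    by (intro fsupp_scale fsupp_sum fin fsupp_translate Suc)
  then show ?case by (simp add: divide_inverse mult.commute)
qed simp

lemma p_nonneg: "p n x \<ge> 0"
  by (induction n arbitrary: x) (auto intro!: divide_nonneg_nonneg sum_nonneg)

lemma p_total: "Sum_any (p n) = 1"
proof (induction n)
  case (Suc n)
  have "Sum_any (p (Suc n)) = Sum_any (\<lambda>x. inverse N * (\<Sum>l\<in>L. p n (- h l + x)))"
    by (simp add: divide_inverse mult.commute)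
  also have "\<dots> = inverse N * (\<Sum>l\<in>L. Sum_any (\<lambda>x. p n (- h l + x)))"
    by (simp add: Sum_any_scale Sum_any_sum fin fsupp_sum fsupp_translate p_fsupp)
  finally show ?case using N_pos by (simp add: Sum_any_translate Suc)
qed simp

text \<open>The Chapman-Kolmogorov identity.\<close>

lemma p_add: "p (m + k) y = Sum_any (\<lambda>x. p m x * p k (- x + y))"
proof (induction m arbitrary: y)
  case 0
  have "Sum_any (\<lambda>x. p 0 x * p k (- x + y)) = Sum_any (\<lambda>x. if x = 0 then p k (- x + y) else 0)"
    by (rule Sum_any.cong) simp
  then show ?case by simp
next
  case (Suc m)
  have shift: "Sum_any (\<lambda>x. p m (- h l + x) * p k (- x + y)) = p (m + k) (- h l + y)" for l
  proof -
    have "Sum_any (\<lambda>x. p m x * p k (- x + (- h l + y))) =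
        Sum_any (\<lambda>x. p m (- h l + x) * p k (- (- h l + x) + (- h l + y)))"
      by (rule Sum_any_translate[symmetric])
    also have "\<dots> = Sum_any (\<lambda>x. p m (- h l + x) * p k (- x + y))"
      by (simp add: minus_add add.assoc[symmetric] del: add_uminus_conv_diff)
        (simp add: add.assoc)
    finally show ?thesis by (simp add: Suc)
  qed
  have "Sum_any (\<lambda>x. p (Suc m) x * p k (- x + y)) =
     Sum_any (\<lambda>x. inverse N * (\<Sum>l\<in>L. p m (- h l + x) * p k (- x + y)))"
    by (rule Sum_any.cong) (simp add: divide_inverse sum_distrib_left sum_distrib_right mult_ac)
  also have "\<dots> = inverse N * (\<Sum>l\<in>L. Sum_any (\<lambda>x. p m (- h l + x) * p k (- x + y)))"
    by (simp add: Sum_any_scale Sum_any_sum fin fsupp_sum fsupp_translate p_fsupp fsupp_mult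
        del: mult_eq_0_iff)
  also have "\<dots> = p (Suc m + k) y" by (simp only: shift) (simp add: divide_inverse mult.commute)
  finally show ?case by (rule HOL.sym)
qed

text \<open>\<open>p (Suc n)\<close> is the mean of the translates of \<open>p n\<close> by the
  letters, each of squared norm \<open>u n\<close>. The loss of norm is thus their variance, written
  with pairwise differences.\<close>

lemma energy_identity:
  "(\<Sum>l\<in>L. \<Sum>k\<in>L. ssq (\<lambda>x. p n (- h l + x) - p n (- h k + x))) = 2 * N\<^sup>2 * (u n - u (Suc n))"
proof -
  have f: "fsupp (\<lambda>x. p n (- h l + x) - p n (- h k + x))" for l k
    by (intro fsupp_diff fsupp_translate p_fsupp)
  have g: "fsupp (\<lambda>x. (p n (- h l + x))\<^sup>2)" for l
    by (intro fsupp_power2 fsupp_translate p_fsupp)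
  have "(\<Sum>l\<in>L. \<Sum>k\<in>L. ssq (\<lambda>x. p n (- h l + x) - p n (- h k + x))) =
     (\<Sum>l\<in>L. Sum_any (\<lambda>x. \<Sum>k\<in>L. (p n (- h l + x) - p n (- h k + x))\<^sup>2))"
    by (intro sum.cong HOL.refl Sum_any_sum[symmetric] fin fsupp_power2 f)
  also have "\<dots> = Sum_any (\<lambda>x. \<Sum>l\<in>L. \<Sum>k\<in>L. (p n (- h l + x) - p n (- h k + x))\<^sup>2)"
    by (intro Sum_any_sum[symmetric] fin fsupp_sum fsupp_power2 f)
  also have "\<dots> = Sum_any (\<lambda>x. 2 * N * (\<Sum>l\<in>L. (p n (- h l + x))\<^sup>2) - 2 * N\<^sup>2 * (p (Suc n) x)\<^sup>2)"
    using N_pos by (simp add: sum_square_differences power_divide)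
  also have "\<dots> = 2 * N * Sum_any (\<lambda>x. \<Sum>l\<in>L. (p n (- h l + x))\<^sup>2) - 2 * N\<^sup>2 * u (Suc n)"
    using g by (subst Sum_any_diff)
      (simp_all only: Sum_any_scale fsupp_scale fsupp_sum fin p_fsupp fsupp_power2)
  also have "Sum_any (\<lambda>x. \<Sum>l\<in>L. (p n (- h l + x))\<^sup>2) = (\<Sum>l\<in>L. u n)"
    using g by (simp add: Sum_any_sum fin Sum_any_translate[of "\<lambda>x. (p n x)\<^sup>2"])
  finally show ?thesis by (simp add: power2_eq_square algebra_simps)
qed

definition energy :: "nat \<Rightarrow> 'a \<Rightarrow> real" where
  "energy n a = ssq (\<lambda>x. p n x - p n (- a + x))"

lemma energy_nonneg: "energy n a \<ge> 0"
  unfolding energy_def by (rule Sum_any_nonneg) simp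

text \<open>The energy identity compares two translated copies, and shifting one of them back to
  \<open>p n\<close> yields a product of two letters. This is why only words of even length occur
  below.\<close>

lemma energy_two_steps:
  assumes "l \<in> L" "k \<in> L" shows "energy n (h l + h k) \<le> 2 * N\<^sup>2 * (u n - u (Suc n))"
proof -
  let ?f = "\<lambda>l k. ssq (\<lambda>x. p n (- h l + x) - p n (- h k + x))"
  have nn: "?f l k \<ge> 0" for l k by (rule Sum_any_nonneg) simp
  have "?f (bar l) k \<le> (\<Sum>k\<in>L. ?f (bar l) k)"
    using assms nn by (intro member_le_sum) (auto simp: fin)
  also have "\<dots> \<le> (\<Sum>l\<in>L. \<Sum>k\<in>L. ?f l k)"
    using assms nn bar_closed fin by (intro member_le_sum[of "bar l" L]) (auto intro!: sum_nonneg)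
  finally have 1: "?f (bar l) k \<le> 2 * N\<^sup>2 * (u n - u (Suc n))" by (simp add: energy_identity)
  have "energy n (h l + h k) =
      Sum_any (\<lambda>x. (p n (h l + x) - p n (- (h l + h k) + (h l + x)))\<^sup>2)"
    unfolding energy_def by (rule Sum_any_translate[symmetric])
  also have "\<dots> = ?f (bar l) k"
    using assms(1) by (simp add: h_bar minus_add add.assoc[symmetric] del: add_uminus_conv_diff)
      (simp add: add.assoc)
  finally show ?thesis using 1 by simp
qed

lemma u_antimono: "u (Suc n) \<le> u n"
proof -
  obtain l where "l \<in> L" using nonempty by blast
  then have "0 \<le> 2 * N\<^sup>2 * (u n - u (Suc n))"
    using energy_two_steps energy_nonneg order_trans by blast
  then show ?thesis using N_pos by (simp add: zero_le_mult_iff)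
qed

text \<open>The triangle inequality for the square root of the energy, in a weighted form without
  roots; the weight \<open>r\<close> is tuned to the induction in
  \<open>energy_word\<close>.\<close>

lemma energy_add:
  assumes "r \<ge> (1::nat)"
  shows "energy n (a + b) \<le> (1 + 1 / r) * energy n a + (1 + r) * energy n b"
proof -
  let ?f = "\<lambda>x. p n x - p n (- a + x)" and ?g = "\<lambda>x. p n x - p n (- b + x)"
  have fs: "fsupp ?f" "fsupp ?g" by (intro fsupp_diff fsupp_translate p_fsupp)+
  have fs': "fsupp (\<lambda>x. ?g (- a + x))" by (intro fsupp_diff fsupp_translate p_fsupp)
  have ineq: "(s + t)\<^sup>2 \<le> (1 + 1 / r) * s\<^sup>2 + (1 + r) * t\<^sup>2" for s t :: real
  proof -
    have "0 \<le> (s - r * t)\<^sup>2 / r" by simp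
    also have "\<dots> = s\<^sup>2 / r - 2 * s * t + r * t\<^sup>2"
      using assms by (simp add: power2_eq_square field_simps)
    finally show ?thesis by (simp add: power2_eq_square algebra_simps)
  qed
  have "energy n (a + b) = ssq (\<lambda>x. ?f x + ?g (- a + x))"
  proof -
    have "- (a + b) + x = - b + (- a + x)" for x by (metis minus_add add.assoc)
    then show ?thesis by (simp only: energy_def) simp
  qed
  also have "\<dots> \<le> Sum_any (\<lambda>x. (1 + 1 / r) * (?f x)\<^sup>2 + (1 + r) * (?g (- a + x))\<^sup>2)"
    by (intro Sum_any_mono fsupp_power2 fsupp_add fsupp_scale fs fs' ineq)
  also have "\<dots> = (1 + 1 / r) * ssq ?f + (1 + r) * ssq (\<lambda>x. ?g (- a + x))"
    using fs fs' by (subst Sum_any.distrib)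
      (simp_all only: Sum_any_scale fsupp_scale fsupp_power2)
  also have "ssq (\<lambda>x. ?g (- a + x)) = ssq ?g" by (rule Sum_any_translate)
  finally show ?thesis unfolding energy_def by simp
qed

lemma energy_word:
  assumes "length w = 2 * Suc r" "w \<in> lists L"
  shows "energy n (sum_list (map h w)) \<le> (Suc r)\<^sup>2 * (2 * N\<^sup>2 * (u n - u (Suc n)))"
  using assms
proof (induction r arbitrary: w)
  case 0
  then obtain l k where "w = [l, k]" by (auto simp: length_Suc_conv numeral_2_eq_2)
  then show ?case using 0 energy_two_steps[of l k n] by simp
next
  case (Suc r)
  then obtain l k v where w: "w = l # k # v" by (auto simp: length_Suc_conv)
  define \<delta> where "\<delta> = 2 * N\<^sup>2 * (u n - u (Suc n))"
  let ?a = "h l + h k" and ?b = "sum_list (map h v)"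
  have a: "energy n ?a \<le> \<delta>" using Suc.prems w energy_two_steps by (simp add: \<delta>_def)
  have b: "energy n ?b \<le> (Suc r)\<^sup>2 * \<delta>" using Suc w by (simp add: \<delta>_def)
  \<comment> \<open>The induction splits off two letters in front, so the small factor must fall on
    the second summand. Inversion preserves the energy and reverses the order of the
    summands.\<close>
  have swap: "energy n (a + b) \<le> (1 + real (Suc r)) * energy n a + (1 + 1 / Suc r) * energy n b" for a b
  proof -
    have neg: "energy n (- c) = energy n c" for c
    proof -
      have "energy n (- c) = Sum_any (\<lambda>x. (p n (- c + x) - p n (c + (- c + x)))\<^sup>2)"
        using Sum_any_translate[of "\<lambda>x. (p n x - p n (c + x))\<^sup>2" "- c"] by (simp add: energy_def)
      also have "\<dots> = Sum_any (\<lambda>x. (p n x - p n (- c + x))\<^sup>2)"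
        by (simp add: power2_commute add.assoc[symmetric])
      finally show ?thesis by (simp add: energy_def)
    qed
    have "energy n (a + b) = energy n (- b + - a)" by (metis neg minus_add)
    also have "\<dots> \<le> (1 + 1 / Suc r) * energy n (- b) + (1 + real (Suc r)) * energy n (- a)"
      by (rule energy_add) simp
    finally show ?thesis by (simp only: neg)
  qed
  have "energy n (?a + ?b) \<le> (1 + real (Suc r)) * energy n ?a + (1 + 1 / Suc r) * energy n ?b"
    by (rule swap)
  also have "\<dots> \<le> (1 + real (Suc r)) * \<delta> + (1 + 1 / Suc r) * ((Suc r)\<^sup>2 * \<delta>)"
    using a b by (intro add_mono mult_left_mono) auto
  also have "\<dots> = (Suc (Suc r))\<^sup>2 * \<delta>"
    by (simp add: field_simps power2_eq_square)
  finally show ?case by (simp add: w \<delta>_def add.assoc)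
qed

text \<open>Among the translates of \<open>p n\<close> by \<open>B\<close>, all close to \<open>p n\<close>, the total overlap with \<open>p n\<close> is at
  most 1, so \<open>p n\<close> has small norm when \<open>B\<close> is large.\<close>

lemma u_bound_ball:
  fixes e :: real
  assumes B: "finite B" "\<And>g. g \<in> B \<Longrightarrow> energy n g \<le> 2 * e"
  shows "card B * u n \<le> 1 + card B * e"
proof -
  let ?c = "\<lambda>g. Sum_any (\<lambda>x. p n x * p n (- g + x))"
  have fs: "fsupp (\<lambda>x. p n x * p n (- g + x))" for g by (intro fsupp_mult p_fsupp)
  \<comment> \<open>Translation preserves the norm, so the energy measures the defect of the
    overlap.\<close>
  have c: "energy n g = 2 * u n - 2 * ?c g" for g
  proof -
    have "energy n g = Sum_any (\<lambda>x. ((p n x)\<^sup>2 + (p n (- g + x))\<^sup>2) - 2 * (p n x * p n (- g + x)))"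
      by (simp add: energy_def power2_diff mult_ac)
    also have "\<dots> = Sum_any (\<lambda>x. (p n x)\<^sup>2 + (p n (- g + x))\<^sup>2) - 2 * ?c g"
      by (subst Sum_any_diff)
        (simp_all only: Sum_any_scale fsupp_scale fsupp_add fsupp_power2 fsupp_translate p_fsupp fs)
    also have "Sum_any (\<lambda>x. (p n x)\<^sup>2 + (p n (- g + x))\<^sup>2) = u n + u n"
      using Sum_any_translate[of "\<lambda>x. (p n x)\<^sup>2" "- g"]
      by (subst Sum_any.distrib) (simp_all only: fsupp_power2 fsupp_translate p_fsupp)
    finally show ?thesis by simp
  qed
  \<comment> \<open>Different \<open>g\<close> evaluate \<open>p n\<close> at different
    points.\<close>
  have le1: "(\<Sum>g\<in>B. p n (- g + x)) \<le> 1" for x :: 'a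
  proof -
    have "(\<Sum>g\<in>B. p n (- g + x)) = (\<Sum>y\<in>(\<lambda>g. - g + x) ` B. p n y)"
      by (rule sum.reindex[symmetric, unfolded o_def]) (simp add: inj_on_def)
    also have "\<dots> \<le> (\<Sum>y\<in>(\<lambda>g. - g + x) ` B \<union> {y. p n y \<noteq> 0}. p n y)"
      using B p_fsupp p_nonneg by (intro sum_mono2) auto
    also have "\<dots> = Sum_any (p n)"
      using B p_fsupp by (intro Sum_any.expand_superset[symmetric]) auto
    finally show ?thesis by (simp add: p_total)
  qed
  have "(\<Sum>g\<in>B. ?c g) = Sum_any (\<lambda>x. \<Sum>g\<in>B. p n x * p n (- g + x))"
    using B fs by (intro Sum_any_sum[symmetric]) auto
  also have "\<dots> \<le> Sum_any (p n)"
  proof (rule Sum_any_mono)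
    show "(\<Sum>g\<in>B. p n x * p n (- g + x)) \<le> p n x" for x
      using mult_left_mono[OF le1[of x] p_nonneg[of n x]] by (simp add: sum_distrib_left)
  qed (intro fsupp_sum B fs p_fsupp)+
  finally have 1: "(\<Sum>g\<in>B. ?c g) \<le> 1" by (simp add: p_total)
  have "real (card B) * u n = (\<Sum>g\<in>B. energy n g / 2) + (\<Sum>g\<in>B. ?c g)"
    by (simp add: c sum.distrib[symmetric] diff_divide_distrib)
  also have "\<dots> \<le> (\<Sum>g\<in>B. e) + 1"
  proof (intro add_mono sum_mono 1)
    show "energy n g / 2 \<le> e" if "g \<in> B" for g using B(2)[OF that] by simp
  qed
  finally show ?thesis by simp
qed

text \<open>Hypothesis 1 bounds the excess of \<open>U\<close> over \<open>1 / V\<close> by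
  \<open>q\<close> times the drop \<open>U - U'\<close>, so the excess shrinks by the factor
  \<open>1 - 1 / q\<close>.\<close>

lemma contraction_step:
  fixes V q U U' E :: real
  assumes V: "V > 0" and q: "q \<ge> 1"
    and 1: "V * U \<le> 1 + V * (q * (U - U'))" and 2: "U \<le> 1 / V + E"
  shows "U' \<le> 1 / V + (1 - 1 / q) * E"
proof -
  have "U \<le> 1 / V + q * (U - U')" using 1 V by (simp add: field_simps)
  then have "(U - 1 / V) / q \<le> U - U'" using q by (simp add: pos_divide_le_eq mult.commute)
  then have "U' - 1 / V \<le> (1 - 1 / q) * (U - 1 / V)" by (simp add: left_diff_distrib)
  also have "\<dots> \<le> (1 - 1 / q) * E" using 2 q by (intro mult_left_mono) auto
  finally show ?thesis by simp
qed

text \<open>The Nash type argument: \<open>u_bound_ball\<close>, with \<open>e\<close> supplied by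
  \<open>energy_word\<close>, bounds the excess of \<open>u n\<close> over \<open>1 / card B\<close>
  by a multiple of the next drop, and \<open>contraction_step\<close> iterates this.\<close>

lemma u_bound:
  assumes B: "finite B" "B \<noteq> {}"
    and words: "\<And>g. g \<in> B \<Longrightarrow> \<exists>w\<in>lists L. length w = 2 * Suc r \<and> sum_list (map h w) = g"
  shows "u n \<le> 1 / card B + (1 - 1 / ((Suc r)\<^sup>2 * N\<^sup>2)) ^ n"
proof (induction n)
  case 0
  have "u 0 = Sum_any (p 0)" by (rule Sum_any.cong) simp
  then show ?case by (simp add: p_total del: walk.simps)
next
  case (Suc n)
  let ?q = "(Suc r)\<^sup>2 * N\<^sup>2" and ?V = "real (card B)"
  have V: "?V > 0" using B by (simp add: card_gt_0_iff)
  have q: "?q \<ge> 1" using N_pos mult_mono[of 1 "(Suc r)\<^sup>2" 1 "N\<^sup>2"] by (simp add: one_le_power)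
  have "?V * u n \<le> 1 + ?V * (?q * (u n - u (Suc n)))"
  proof (rule u_bound_ball[OF B(1)])
    fix g assume "g \<in> B"
    then obtain w where "w \<in> lists L" "length w = 2 * Suc r" "sum_list (map h w) = g"
      using words by blast
    then show "energy n g \<le> 2 * (?q * (u n - u (Suc n)))"
      using energy_word[of w r n] by (simp only: of_nat_power mult_ac)
  qed
  from contraction_step[OF V q this Suc] show ?case by simp
qed

text \<open>The walk is split in the middle and 2 a b \<le> a^2 + b^2 is applied to the halves. For
  odd \<open>n\<close> the second half is one step longer, which \<open>u_antimono\<close>
  absorbs.\<close>

lemma return_le_u: "p n 0 \<le> u (n div 2)"
proof -
  define m where "m = n div 2"
  define k where "k = n - m"
  have n: "n = m + k" by (simp add: m_def k_def)
  have k: "k = m \<or> k = Suc m" by (auto simp: m_def k_def)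
  have bn: "bij (uminus :: 'a \<Rightarrow> 'a)" using bij_reflect[of 0] by simp
  have "p n 0 = Sum_any (\<lambda>x. p m x * p k (- x))" unfolding n p_add by simp
  also have "\<dots> \<le> Sum_any (\<lambda>x. (1/2) * (p m x)\<^sup>2 + (1/2) * (p k (- x))\<^sup>2)"
  proof (rule Sum_any_mono)
    show "p m x * p k (- x) \<le> (1/2) * (p m x)\<^sup>2 + (1/2) * (p k (- x))\<^sup>2" for x
      using sum_squares_bound[of "p m x" "p k (- x)"] by simp
  qed (intro fsupp_mult fsupp_add fsupp_scale fsupp_power2 p_fsupp fsupp_bij[OF p_fsupp bn])+
  also have "\<dots> = (1/2) * u m + (1/2) * ssq (\<lambda>x. p k (- x))"
    by (subst Sum_any.distrib)
      (simp_all only: Sum_any_scale fsupp_scale fsupp_power2 p_fsupp fsupp_bij[OF p_fsupp bn])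
  also have "ssq (\<lambda>x. p k (- x)) = u k" by (rule Sum_any_bij[OF bn])
  also have "u k \<le> u m" using k u_antimono by auto
  finally show ?thesis by (simp add: m_def)
qed

lemma p_count: "N ^ n * p n x = card {w \<in> lists L. length w = (n::nat) \<and> sum_list (map h w) = x}"
proof (induction n arbitrary: x)
  case 0
  have "{w \<in> lists L. length w = 0 \<and> sum_list (map h w) = x} = (if x = 0 then {[]} else {})" by auto
  then show ?case by simp
next
  case (Suc n)
  let ?S = "\<lambda>n x. {w \<in> lists L. length w = (n::nat) \<and> sum_list (map h w) = x}"
  have fin_S: "finite (?S n x)" for n x
    using finite_lists_length_eq[OF fin, of n] by (rule finite_subset[rotated]) auto
  have "?S (Suc n) x = (\<Union>l\<in>L. (#) l ` ?S n (- h l + x))"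
  proof (intro equalityI subsetI)
    fix w assume "w \<in> ?S (Suc n) x"
    then obtain l v where "w = l # v" "l \<in> L" "v \<in> lists L" "length v = n"
      "h l + sum_list (map h v) = x"
      by (cases w) auto
    then show "w \<in> (\<Union>l\<in>L. (#) l ` ?S n (- h l + x))"
      by (intro UN_I[of l] image_eqI[of _ _ v]) (auto simp: add.assoc[symmetric])
  qed (auto simp: add.assoc[symmetric])
  also have "card \<dots> = (\<Sum>l\<in>L. card ((#) l ` ?S n (- h l + x)))"
    using fin_S by (intro card_UN_disjoint fin) auto
  also have "\<dots> = (\<Sum>l\<in>L. card (?S n (- h l + x)))"
    by (intro sum.cong HOL.refl card_image) simp
  finally show ?case
    using N_pos by (simp add: Suc[symmetric] sum_distrib_left[symmetric])
qed

theorem return_count: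
  assumes "finite B" "B \<noteq> {}"
    and "\<And>g. g \<in> B \<Longrightarrow> \<exists>w\<in>lists L. length w = 2 * Suc r \<and> sum_list (map h w) = g"
  shows "card (loops L h n)
    \<le> N ^ n * (1 / card B + (1 - 1 / ((Suc r)\<^sup>2 * N\<^sup>2)) ^ (n div 2))"
  using return_le_u[of n] u_bound[OF assms, of "n div 2"] N_pos
  by (simp add: p_count[symmetric])

end

section \<open>Words in free groups\<close>

abbreviation words :: "'a set \<Rightarrow> 'a letter list set" where
  "words S \<equiv> lists (letters S)"

abbreviation cls :: "'a set \<Rightarrow> 'a letter list \<Rightarrow> 'a letter list set" where
  "cls S w \<equiv> free_cong S `` {w}"

definition inv_word :: "'a letter list \<Rightarrow> 'a letter list" where
  "inv_word w = map inv_letter (rev w)"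

lemma inv_word_simps [simp]:
  "inv_word [] = []" "inv_word (l # w) = inv_word w @ [inv_letter l]"
  "inv_word (u @ v) = inv_word v @ inv_word u" "inv_word (inv_word w) = w"
  by (simp_all add: inv_word_def rev_map o_def)

lemma inv_word_in_words [simp]: "w \<in> words S \<Longrightarrow> inv_word w \<in> words S"
  by (auto simp: inv_word_def)

lemma cls_in_carrier [simp]: "w \<in> words S \<Longrightarrow> cls S w \<in> carrier (free_group S)"
  by (simp add: free_group_def quotientI)

lemma carrier_free_group_E:
  assumes "g \<in> carrier (free_group S)" obtains w where "w \<in> words S" "g = cls S w"
  using assms by (auto simp: free_group_def elim!: quotientE)

lemma cls_append: "a \<in> words S \<Longrightarrow> b \<in> words S \<Longrightarrow>
    cls S (a @ b) = cls S a \<otimes>\<^bsub>free_group S\<^esub> cls S b"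
  using free_group_mult by blast

lemma cls_Nil: "cls S [] = \<one>\<^bsub>free_group S\<^esub>"
  by (simp add: free_group_def)

lemma cls_eq_iff: "a \<in> words S \<Longrightarrow> b \<in> words S \<Longrightarrow> cls S a = cls S b \<longleftrightarrow> (a, b) \<in> free_cong S"
  using eq_equiv_class_iff[OF equiv_free_cong] by blast

lemma cls_inv_word:
  assumes "w \<in> words S" shows "cls S (inv_word w) = inv\<^bsub>free_group S\<^esub> cls S w"
proof -
  interpret group "free_group S" by (rule group_free_group)
  have "cls S (inv_word w @ w) = cls S []"
    using equiv_class_eq[OF equiv_free_cong free_cong_inverse[OF assms]] by (simp add: inv_word_def)
  then have "cls S (inv_word w) \<otimes>\<^bsub>free_group S\<^esub> cls S w = \<one>\<^bsub>free_group S\<^esub>"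
    using assms by (simp only: cls_append inv_word_in_words cls_Nil)
  then show ?thesis using assms by (intro inv_equality[symmetric]) auto
qed

lemma words_append [simp]: "u @ v \<in> words S \<longleftrightarrow> u \<in> words S \<and> v \<in> words S"
  by auto

lemma words_Cons [simp]: "l # v \<in> words S \<longleftrightarrow> l \<in> letters S \<and> v \<in> words S"
  by auto

section \<open>Flows on Cayley graphs\<close>

text \<open>The boolean tells whether the edge is traversed along its orientation.\<close>

definition net :: "('e \<times> bool) list \<Rightarrow> 'e \<Rightarrow> int" where
  "net xs e = (\<Sum>(f, s)\<leftarrow>xs. if f = e then (if s then 1 else - 1) else 0)"

lemma net_simps [simp]:
  "net [] e = 0" "net (xs @ ys) e = net xs e + net ys e"
  "net ((f, s) # xs) e = (if f = e then (if s then 1 else - 1) else 0) + net xs e"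
  by (simp_all add: net_def)

definition flip :: "('e \<times> bool) list \<Rightarrow> ('e \<times> bool) list" where
  "flip = map (\<lambda>(e, s). (e, \<not> s))"

lemma net_flip [simp]: "net (flip xs) e = - net xs e"
  by (induction xs) (auto simp: flip_def)

lemma net_sign:
  "net xs e \<noteq> 0 \<Longrightarrow> (e, s) \<notin> set xs \<Longrightarrow> (if s then net xs e < 0 else net xs e > 0)"
proof -
  have "(e, s) \<notin> set xs \<Longrightarrow> (if s then net xs e \<le> 0 else net xs e \<ge> 0)"
    by (induction xs) (auto split: if_splits)
  then show "net xs e \<noteq> 0 \<Longrightarrow> (e, s) \<notin> set xs \<Longrightarrow> (if s then net xs e < 0 else net xs e > 0)"
    by (auto split: if_splits)
qed

text \<open>The first entry of a list with zero net has an opposite partner, and removing both keeps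
  the net zero. The entries \<open>A\<close> between them stay in place, so that the rule also
  serves noncommutative products.\<close>

lemma net_zero_induct [consumes 1, case_names Nil cancel]:
  assumes "\<And>e. net xs e = 0" and "P []"
    and step: "\<And>e s A B. (\<And>e. net (A @ B) e = 0) \<Longrightarrow> P (A @ B) \<Longrightarrow> P ((e, s) # A @ (e, \<not> s) # B)"
  shows "P xs"
  using assms(1)
proof (induction xs rule: length_induct)
  case (1 xs)
  show ?case
  proof (cases xs)
    case Nil then show ?thesis using assms(2) by simp
  next
    case (Cons y ys)
    obtain e s where y: "y = (e, s)" by (cases y)
    have "net ys e = (if s then - 1 else 1)"
      using 1(2)[of e] by (auto simp: Cons y split: if_splits)
    then have "(e, \<not> s) \<in> set ys"
      using net_sign[of ys e "\<not> s"] by (auto split: if_splits)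
    then obtain A B where ys: "ys = A @ (e, \<not> s) # B" by (meson split_list)
    have "net (A @ B) f = 0" for f
      using 1(2)[of f] by (auto simp: Cons y ys split: if_splits)
    then show ?thesis using step[of A B e s] 1(1) by (simp add: Cons y ys)
  qed
qed

fun gen :: "'a letter \<Rightarrow> 'a" where
  "gen (Gen x) = x"
| "gen (InvGen x) = x"

fun positive :: "'a letter \<Rightarrow> bool" where
  "positive (Gen x) = True"
| "positive (InvGen x) = False"

definition sgn_letter :: "'a letter \<Rightarrow> int" where
  "sgn_letter l = (if positive l then 1 else - 1)"

text \<open>The length of the prefix that ends at the origin of the edge crossed by letter
  \<open>l\<close>; an inverse letter reaches this origin only after its step.\<close>

definition edge_pos :: "'a letter list \<Rightarrow> nat \<Rightarrow> nat" where
  "edge_pos w l = (if positive (w ! l) then l else Suc l)"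

type_synonym 'a edge = "'a letter list set set \<times> 'a"

section \<open>Paths in the Cayley graph of \<open>F\<close> modulo \<open>N\<close>\<close>

locale free_normal =
  fixes S :: "'a set" and N
  assumes normal: "N \<lhd> free_group S"
begin

abbreviation "F \<equiv> free_group S"
abbreviation mult_F (infixl "\<cdot>" 70) where "x \<cdot> y \<equiv> x \<otimes>\<^bsub>F\<^esub> y"
abbreviation "idF \<equiv> \<one>\<^bsub>F\<^esub>"
abbreviation inv_F ("inv\<^sub>F _" [81] 80) where "inv\<^sub>F x \<equiv> inv\<^bsub>F\<^esub> x"
abbreviation "c \<equiv> cls S"
abbreviation "vert g \<equiv> N #>\<^bsub>F\<^esub> g"
abbreviation "N' \<equiv> derived F N"

sublocale F: group F by (rule group_free_group)
sublocale N: normal N F by (rule normal)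

lemma N'_normal: "N' \<lhd> F"
  by (rule F.derived_is_normal) (rule normal)

lemma N'_subset: "N' \<subseteq> N"
  using F.derived_incl[OF subset_refl N.subgroup_axioms] .

lemma vert_eq_iff:
  assumes "g \<in> carrier F" "h \<in> carrier F"
  shows "vert g = vert h \<longleftrightarrow> h \<cdot> inv\<^sub>F g \<in> N"
proof
  assume "vert g = vert h"
  then have "h \<in> vert g" using F.rcos_self[OF assms(2) N.subgroup_axioms] by simp
  then obtain n where "n \<in> N" "h = n \<cdot> g" by (auto simp: r_coset_def)
  then show "h \<cdot> inv\<^sub>F g \<in> N"
    using assms N.subset by (auto simp: F.m_assoc)
next
  let ?n = "h \<cdot> inv\<^sub>F g"
  assume n: "?n \<in> N"
  have "vert (?n \<cdot> g) = vert ?n #>\<^bsub>F\<^esub> g"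
    using assms by (intro F.coset_mult_assoc[symmetric] N.subset) auto
  also have "vert ?n = N" using n by (rule N.rcos_const[OF F.group_axioms])
  also have "?n \<cdot> g = h" using assms by (simp add: F.m_assoc)
  finally show "vert g = vert h" by simp
qed

lemma vert_mult_cong:
  assumes "g \<in> carrier F" "h \<in> carrier F" "k \<in> carrier F" "vert g = vert h"
  shows "vert (g \<cdot> k) = vert (h \<cdot> k)"
  using assms by (metis F.coset_mult_assoc N.subset)

text \<open>Traversing an edge backwards records the origin of the edge, which is the vertex reached.\<close>

fun steps :: "'a letter list set \<Rightarrow> 'a letter list \<Rightarrow> ('a edge \<times> bool) list" where
  "steps g [] = []"
| "steps g (Gen x # u) = ((vert g, x), True) # steps (g \<cdot> c [Gen x]) u"
| "steps g (InvGen x # u) =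
    ((vert (g \<cdot> c [InvGen x]), x), False) # steps (g \<cdot> c [InvGen x]) u"

lemma c_Cons: "l # u \<in> words S \<Longrightarrow> c (l # u) = c [l] \<cdot> c u"
  using cls_append[of "[l]" S u] by simp

lemma c_cancel: "l \<in> letters S \<Longrightarrow> c [l] \<cdot> c [inv_letter l] = idF"
  using cls_inv_word[of "[l]" S] by (simp del: cls_in_carrier add: F.r_inv[OF cls_in_carrier])

lemma steps_append:
  assumes "g \<in> carrier F" "u \<in> words S" "v \<in> words S"
  shows "steps g (u @ v) = steps g u @ steps (g \<cdot> c u) v"
  using assms
proof (induction g u rule: steps.induct)
  case (1 g) then show ?case by (simp add: cls_Nil)
next
  case (2 g x u)
  then show ?case using c_Cons[of "Gen x" u] by (simp add: F.m_assoc)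
next
  case (3 g x u)
  then show ?case using c_Cons[of "InvGen x" u] by (simp add: F.m_assoc)
qed

lemma steps_vert_cong:
  assumes "vert g = vert h" "g \<in> carrier F" "h \<in> carrier F" "u \<in> words S"
  shows "steps g u = steps h u"
  using assms
proof (induction g u arbitrary: h rule: steps.induct)
  case (2 g x u)
  then show ?case by (simp add: vert_mult_cong[of g h])
next
  case (3 g x u)
  then show ?case by (simp add: vert_mult_cong[of g h])
qed simp

text \<open>A cancelling pair of letters traverses one edge once in each direction.\<close>

lemma net_steps_free_cong:
  assumes "(u, v) \<in> free_cong S" "g \<in> carrier F"
  shows "net (steps g u) e = net (steps g v) e"
  using assms
proof (induction rule: free_cong.induct)
  case (cancel u l v)
  let ?h = "g \<cdot> c u"
  have h: "?h \<in> carrier F" using cancel by simp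
  have l: "[l] \<in> words S" "[inv_letter l] \<in> words S" using cancel by simp_all
  have 0: "?h \<cdot> c [l] \<cdot> c [inv_letter l] = ?h"
    using h l cancel(2) by (simp add: F.m_assoc c_cancel)
  have "steps g (u @ [l, inv_letter l] @ v) = steps g u @ steps ?h ([l] @ [inv_letter l] @ v)"
    using cancel by (simp add: steps_append)
  also have "steps ?h ([l] @ [inv_letter l] @ v)
      = steps ?h [l] @ steps (?h \<cdot> c [l]) [inv_letter l] @ steps ?h v"
    using h l cancel 0 by (simp only: steps_append words_append F.m_closed cls_in_carrier simp_thms)
  moreover have "net (steps ?h [l]) e + net (steps (?h \<cdot> c [l]) [inv_letter l]) e = 0"
    using 0 by (cases l) auto
  ultimately show ?case using cancel by (simp add: steps_append)
qed auto

lemma net_steps_inv_word: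
  assumes "g \<in> carrier F" "u \<in> words S"
  shows "net (steps (g \<cdot> c u) (inv_word u)) e = - net (steps g u) e"
proof -
  have "(inv_word (inv_word u) @ inv_word u, []) \<in> free_cong S"
    unfolding inv_word_def[of "inv_word u"] by (rule free_cong_inverse) (simp add: assms)
  then have "net (steps g (u @ inv_word u)) e = net (steps g []) e"
    using assms by (intro net_steps_free_cong) simp_all
  then show ?thesis using assms by (simp add: steps_append)
qed

lemma vert_N: "g \<in> N \<Longrightarrow> vert g = vert idF"
  by (subst vert_eq_iff) auto

text \<open>Words with class in \<open>N\<close> give closed paths at the base vertex, so the net
  flow is additive on them. It is a homomorphism from \<open>N\<close> to an abelian group and kills
  commutators.\<close>

lemma net_steps_derived:
  assumes "x \<in> N'" "u \<in> words S" "x = c u"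
  shows "net (steps idF u) e = 0"
proof -
  have 1: "net (steps idF (u @ v)) e = net (steps idF u) e + net (steps idF v) e"
    if "u \<in> words S" "v \<in> words S" "c u \<in> N" for u v e
    using that steps_vert_cong[OF vert_N[OF that(3)]] by (simp add: steps_append)
  have 2: "net (steps idF (inv_word u)) e = - net (steps idF u) e"
    if "u \<in> words S" "c u \<in> N" for u e
    using that net_steps_inv_word[of "idF" u e] steps_vert_cong[OF vert_N[OF that(2)]] by simp
  have comm: "\<exists>u\<in>words S. x = c u \<and> c u \<in> N \<and> (\<forall>e. net (steps idF u) e = 0)"
    if x: "x \<in> derived_set F N" for x
  proof -
    obtain g h where gh: "g \<in> N" "h \<in> N"
      and x: "x = g \<cdot> h \<cdot> inv\<^sub>F g \<cdot> inv\<^sub>F h"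
      using x by blast
    have "g \<in> carrier F" "h \<in> carrier F" using gh by simp_all
    then obtain a b where ab: "a \<in> words S" "g = c a" "b \<in> words S" "h = c b"
      by (elim carrier_free_group_E)
    have "x = c (((a @ b) @ inv_word a) @ inv_word b)"
      using ab by (simp only: x cls_append words_append inv_word_in_words cls_inv_word simp_thms)
    moreover have "c (((a @ b) @ inv_word a) @ inv_word b) \<in> N" "c ((a @ b) @ inv_word a) \<in> N"
      "c (a @ b) \<in> N"
      using gh ab
      by (simp_all only: cls_append words_append inv_word_in_words cls_inv_word simp_thms
          N.m_closed N.m_inv_closed)
    moreover have "net (steps idF (((a @ b) @ inv_word a) @ inv_word b)) e = 0" for e
      using gh ab calculation(2-) by (simp only: 1 2 words_append inv_word_in_words simp_thms)
    ultimately show ?thesis using ab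
      by (intro bexI[of _ "((a @ b) @ inv_word a) @ inv_word b"]) simp_all
  qed
  \<comment> \<open>The induction yields some word for \<open>x\<close> with zero flow; the flow
    depends only on the class, so the given \<open>u\<close> has zero flow as well.\<close>
  have "\<exists>u\<in>words S. x = c u \<and> c u \<in> N \<and> (\<forall>e. net (steps idF u) e = 0)"
    using assms(1) unfolding derived_def
  proof (induction rule: generate.induct)
    case one
    then show ?case by (intro bexI[of _ "[]"]) (auto simp: cls_Nil)
  next
    case (incl x)
    then show ?case by (rule comm)
  next
    case (inv x)
    then obtain u where u: "u \<in> words S" "x = c u" "c u \<in> N" "\<forall>e. net (steps idF u) e = 0"
      using comm by blast
    then show ?case
      by (intro bexI[of _ "inv_word u"]) (auto simp: 2 cls_inv_word simp del: in_lists_conv_set)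
  next
    case (eng x y)
    then obtain u v where "u \<in> words S" "x = c u" "c u \<in> N" "\<forall>e. net (steps idF u) e = 0"
      "v \<in> words S" "y = c v" "c v \<in> N" "\<forall>e. net (steps idF v) e = 0" by blast
    then show ?case
      by (intro bexI[of _ "u @ v"]) (auto simp: 1 cls_append simp del: in_lists_conv_set)
  qed
  then obtain v where v: "v \<in> words S" "x = c v" "\<forall>e. net (steps idF v) e = 0" by blast
  then have "(u, v) \<in> free_cong S" using assms cls_eq_iff[of u S v] by simp
  then show ?thesis using net_steps_free_cong[of u v "idF" e] v by (simp only: F.one_closed)
qed

section \<open>Rewriting in Schreier generators\<close>

definition rep :: "'a letter list set set \<Rightarrow> 'a letter list set" where
  "rep v = (SOME g. g \<in> carrier F \<and> vert g = v)"

lemma rep: "g \<in> carrier F \<Longrightarrow> rep (vert g) \<in> carrier F \<and> vert (rep (vert g)) = vert g"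
  unfolding rep_def by (rule someI_ex) blast

definition head :: "'a edge \<Rightarrow> 'a letter list set set" where
  "head e = vert (rep (fst e) \<cdot> c [Gen (snd e)])"

lemma head_vert:
  assumes "g \<in> carrier F" "x \<in> S" shows "head (vert g, x) = vert (g \<cdot> c [Gen x])"
  unfolding head_def fst_conv snd_conv using assms rep[OF assms(1)]
  by (intro vert_mult_cong) (simp_all add: letters_def)

text \<open>The Schreier generator of \<open>N\<close> that belongs to the edge, for the transversal
  \<open>rep\<close>.\<close>

definition edge_elem :: "'a edge \<Rightarrow> 'a letter list set" where
  "edge_elem e = rep (fst e) \<cdot> c [Gen (snd e)] \<cdot> inv\<^sub>F rep (head e)"

definition step_elem :: "'a edge \<times> bool \<Rightarrow> 'a letter list set" where
  "step_elem s = (if snd s then edge_elem (fst s) else inv\<^sub>F edge_elem (fst s))"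

lemma letters_cases: "l \<in> letters S \<Longrightarrow> (\<exists>x\<in>S. l = Gen x \<or> l = InvGen x)"
  by (auto simp: letters_def)

definition step_prod :: "('a edge \<times> bool) list \<Rightarrow> 'a letter list set" where
  "step_prod xs = foldr (\<lambda>s g. step_elem s \<cdot> g) xs idF"

lemma step_elem_steps:
  assumes "g \<in> carrier F" "l \<in> letters S"
  shows "\<exists>e s. steps g (l # u) = (e, s) # steps (g \<cdot> c [l]) u
    \<and> step_elem (e, s) = rep (vert g) \<cdot> c [l] \<cdot> inv\<^sub>F rep (vert (g \<cdot> c [l]))
    \<and> (if s then fst e = vert g \<and> head e = vert (g \<cdot> c [l])
       else head e = vert g \<and> fst e = vert (g \<cdot> c [l]))"
proof -
  obtain x where x: "x \<in> S" "l = Gen x \<or> l = InvGen x" using letters_cases[OF assms(2)] by blast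
  have l: "c [l] \<in> carrier F" using assms(2) by simp
  have xl: "Gen x \<in> letters S" "InvGen x \<in> letters S" using x by (auto simp: letters_def)
  show ?thesis
  proof (cases "l = Gen x")
    case True
    then show ?thesis using head_vert[OF assms(1) x(1)]
      by (intro exI[of _ "(vert g, x)"] exI[of _ True]) (simp add: step_elem_def edge_elem_def)
  next
    case False
    then have l': "l = InvGen x" using x by simp
    have 0: "g \<cdot> c [InvGen x] \<cdot> c [Gen x] = g"
      using assms xl c_cancel[of "InvGen x"] by (simp add: F.m_assoc)
    have i: "inv\<^sub>F c [Gen x] = c [InvGen x]"
      using cls_inv_word[of "[Gen x]" S] xl by simp
    have hd: "head (vert (g \<cdot> c [InvGen x]), x) = vert g"
      using head_vert[of "g \<cdot> c [InvGen x]" x] assms xl x 0 by simp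
    have r: "rep (vert g) \<in> carrier F" "rep (vert (g \<cdot> c [InvGen x])) \<in> carrier F"
      using rep assms xl by simp_all
    let ?e = "(vert (g \<cdot> c [InvGen x]), x)"
    have "edge_elem ?e = rep (fst ?e) \<cdot> c [Gen x] \<cdot> inv\<^sub>F rep (vert g)"
      by (simp only: edge_elem_def hd snd_conv)
    then have "step_elem (?e, False) = rep (vert g) \<cdot> c [InvGen x] \<cdot> inv\<^sub>F rep (fst ?e)"
      using r xl i by (simp add: step_elem_def F.inv_mult_group F.m_assoc)
    then show ?thesis using l' hd
      by (intro exI[of _ ?e] exI[of _ False]) simp
  qed
qed

text \<open>Reidemeister-Schreier rewriting: consecutive factors meet in the inverse of a
  representative followed by the same representative.\<close>

lemma telescope:
  assumes "g \<in> carrier F" "u \<in> words S"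
  shows "rep (vert g) \<cdot> c u \<cdot> inv\<^sub>F rep (vert (g \<cdot> c u)) = step_prod (steps g u)"
  using assms
proof (induction u arbitrary: g)
  case Nil
  then show ?case using rep by (simp add: step_prod_def cls_Nil)
next
  case (Cons l u)
  then have l: "l \<in> letters S" and u: "u \<in> words S" and cl: "c [l] \<in> carrier F"
    and cu: "c u \<in> carrier F" by simp_all
  obtain e s where es: "steps g (l # u) = (e, s) # steps (g \<cdot> c [l]) u"
    "step_elem (e, s) = rep (vert g) \<cdot> c [l] \<cdot> inv\<^sub>F rep (vert (g \<cdot> c [l]))"
    using step_elem_steps[OF Cons.prems(1) l] by blast
  have g: "g \<cdot> c [l] \<in> carrier F" using Cons.prems cl by simp
  have gu: "g \<cdot> c [l] \<cdot> c u \<in> carrier F" using g cu by simp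
  have r: "rep (vert g) \<in> carrier F" "rep (vert (g \<cdot> c [l])) \<in> carrier F"
    "rep (vert (g \<cdot> c [l] \<cdot> c u)) \<in> carrier F"
    using rep Cons.prems(1) g gu by blast+
  have cancel: "inv\<^sub>F a \<cdot> (a \<cdot> b) = b" if "a \<in> carrier F" "b \<in> carrier F" for a b
    using that by (simp add: F.m_assoc[symmetric])
  have "step_prod (steps g (l # u)) = step_elem (e, s) \<cdot> step_prod (steps (g \<cdot> c [l]) u)"
    by (simp add: es step_prod_def)
  also have "\<dots> = rep (vert g) \<cdot> (c [l] \<cdot> c u) \<cdot>
      inv\<^sub>F rep (vert (g \<cdot> c [l] \<cdot> c u))"
    using r cl cu by (simp add: es(2) Cons.IH[OF g u, symmetric] F.m_assoc cancel del: rep)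
  also have "c [l] \<cdot> c u = c (l # u)" using c_Cons[OF Cons.prems(2)] by simp
  also have "g \<cdot> c [l] \<cdot> c u = g \<cdot> c (l # u)"
    using c_Cons[OF Cons.prems(2)] Cons.prems(1) cl cu by (simp add: F.m_assoc)
  finally show ?case by simp
qed

lemma steps_edges:
  assumes "g \<in> carrier F" "u \<in> words S" "s \<in> set (steps g u)"
  shows "\<exists>h\<in>carrier F. \<exists>x\<in>S. fst s = (vert h, x)"
  using assms
proof (induction g u rule: steps.induct)
  case (2 g x u)
  then show ?case by (auto simp: letters_def)
next
  case (3 g x u)
  then show ?case by (auto simp: letters_def)
qed simp

lemma edge_elem_in_N:
  assumes "h \<in> carrier F" "x \<in> S" shows "edge_elem (vert h, x) \<in> N"
proof -
  let ?k = "rep (vert h) \<cdot> c [Gen x]"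
  have k: "?k \<in> carrier F" using rep[OF assms(1)] assms(2) by (simp add: letters_def)
  have "?k \<cdot> inv\<^sub>F rep (vert ?k) \<in> N"
    using rep[OF k] k vert_eq_iff[of "rep (vert ?k)" ?k] by blast
  then show ?thesis by (simp add: edge_elem_def head_def)
qed

lemma step_elem_in_N: "edge_elem (fst s) \<in> N \<Longrightarrow> step_elem s \<in> N"
  by (simp add: step_elem_def)

lemma step_prod_in_N: "\<forall>s\<in>set xs. edge_elem (fst s) \<in> N \<Longrightarrow> step_prod xs \<in> N"
  by (induction xs) (simp_all add: step_prod_def step_elem_in_N)

lemma step_prod_simps:
  "step_prod [] = idF" "step_prod (s # xs) = step_elem s \<cdot> step_prod xs"
  by (simp_all add: step_prod_def)

lemma step_prod_append:
  "\<forall>s\<in>set (xs @ ys). edge_elem (fst s) \<in> N \<Longrightarrow>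
    step_prod (xs @ ys) = step_prod xs \<cdot> step_prod ys"
  by (induction xs) (simp_all add: step_prod_simps step_elem_in_N step_prod_in_N F.m_assoc)

text \<open>The factors commute modulo \<open>N'\<close>. In the inductive step, x a x^-1 b = [x, a]
  (a b).\<close>

lemma step_prod_derived:
  assumes "\<And>e. net xs e = 0" "\<forall>s\<in>set xs. edge_elem (fst s) \<in> N"
  shows "step_prod xs \<in> N'"
proof -
  interpret N': normal N' F by (rule N'_normal)
  from assms show ?thesis
  proof (induction rule: net_zero_induct)
    case Nil
    then show ?case by (simp add: step_prod_simps)
  next
    case (cancel e s A B)
    let ?x = "step_elem (e, s)" and ?a = "step_prod A" and ?b = "step_prod B"
    have N: "?x \<in> N" "?a \<in> N" "?b \<in> N"
      using cancel.prems by (auto intro!: step_elem_in_N step_prod_in_N)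
    have G: "?x \<in> carrier F" "?a \<in> carrier F" "?b \<in> carrier F" using N by simp_all
    have "edge_elem e \<in> carrier F" using cancel.prems by simp
    then have inv: "step_elem (e, \<not> s) = inv\<^sub>F ?x"
      by (simp add: step_elem_def)
    have ab: "?a \<cdot> ?b \<in> N'"
      using cancel by (simp add: step_prod_append)
    have com: "?x \<cdot> ?a \<cdot> inv\<^sub>F ?x \<cdot> inv\<^sub>F ?a \<in> N'"
      unfolding derived_def using N by (intro generate.incl) blast
    have "step_prod (A @ (e, \<not> s) # B) = ?a \<cdot> (inv\<^sub>F ?x \<cdot> ?b)"
      using cancel.prems by (subst step_prod_append) (auto simp: step_prod_simps inv)
    then have "step_prod ((e, s) # A @ (e, \<not> s) # B)
        = ?x \<cdot> (?a \<cdot> (inv\<^sub>F ?x \<cdot> ?b))"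
      by (simp add: step_prod_simps)
    also have "\<dots> = (?x \<cdot> ?a \<cdot> inv\<^sub>F ?x \<cdot> inv\<^sub>F ?a) \<cdot> (?a \<cdot> ?b)"
    proof -
      have "inv\<^sub>F ?a \<cdot> (?a \<cdot> ?b) = ?b" using G by (simp add: F.m_assoc[symmetric])
      then show ?thesis using G by (simp add: F.m_assoc)
    qed
    finally show ?case using com ab by simp
  qed
qed

text \<open>The boundary of the 1-chain of \<open>xs\<close>, paired with a function on vertices. It
  depends only on the net flow, and on a path it telescopes; so it recovers the end of a path from
  its flow.\<close>

definition boundary :: "('a letter list set set \<Rightarrow> int) \<Rightarrow>
    ('a edge \<times> bool) list \<Rightarrow> int" where
  "boundary f xs = (\<Sum>(e, s)\<leftarrow>xs. if s then f (head e) - f (fst e) else f (fst e) - f (head e))"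

lemma boundary_net_zero: "(\<And>e. net xs e = 0) \<Longrightarrow> boundary f xs = 0"
  by (induction rule: net_zero_induct) (auto simp: boundary_def)

lemma boundary_steps:
  assumes "g \<in> carrier F" "u \<in> words S"
  shows "boundary f (steps g u) = f (vert (g \<cdot> c u)) - f (vert g)"
  using assms
proof (induction u arbitrary: g)
  case Nil
  then show ?case by (simp add: boundary_def cls_Nil)
next
  case (Cons l u)
  have cl: "c [l] \<in> carrier F" "c u \<in> carrier F" using Cons.prems by simp_all
  obtain e b where es: "steps g (l # u) = (e, b) # steps (g \<cdot> c [l]) u"
    "if b then fst e = vert g \<and> head e = vert (g \<cdot> c [l])
       else head e = vert g \<and> fst e = vert (g \<cdot> c [l])"
    using step_elem_steps[of g l u] Cons.prems unfolding words_Cons by blast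
  have "boundary f (steps g (l # u)) = f (vert (g \<cdot> c [l])) - f (vert g)
      + boundary f (steps (g \<cdot> c [l]) u)"
    using es by (simp add: boundary_def split: if_splits)
  also have "\<dots> = f (vert (g \<cdot> c [l] \<cdot> c u)) - f (vert g)"
    using Cons.IH[of "g \<cdot> c [l]"] Cons.prems cl by simp
  finally show ?case using c_Cons[OF Cons.prems(2)] Cons.prems(1) cl by (simp add: F.m_assoc)
qed

lemma boundary_append: "boundary f (xs @ ys) = boundary f xs + boundary f ys"
  by (simp add: boundary_def)

lemma boundary_flip: "boundary f (flip xs) = - boundary f xs"
  by (induction xs) (auto simp: boundary_def flip_def)

lemma boundary_net_cong:
  assumes "\<And>e. net xs e = net ys e" shows "boundary f xs = boundary f ys"
  using boundary_net_zero[of "xs @ flip ys" f] assms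
  by (simp add: boundary_append boundary_flip)

lemma derived_of_net_zero:
  assumes "u \<in> words S" "\<And>e. net (steps idF u) e = 0"
  shows "c u \<in> N'"
proof -
  interpret N': normal N' F by (rule N'_normal)
  \<comment> \<open>With the indicator of the base vertex, zero boundary says that the path is
    closed.\<close>
  let ?f = "\<lambda>v. if v = vert idF then 1 else 0"
  have cu: "c u \<in> carrier F" using assms by simp
  have "boundary ?f (steps idF u) = 0" using assms(2) by (rule boundary_net_zero)
  then have v: "vert (c u) = vert idF"
    using boundary_steps[of "idF" u ?f] assms(1) cu by (simp split: if_splits)
  let ?r = "rep (vert idF)"
  have r: "?r \<in> carrier F" using rep F.one_closed by blast
  have "step_prod (steps idF u) \<in> N'"
  proof (rule step_prod_derived[OF assms(2)], rule ballI)
    fix s assume "s \<in> set (steps idF u)"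
    then obtain h x where "h \<in> carrier F" "x \<in> S" "fst s = (vert h, x)"
      using steps_edges[OF F.one_closed assms(1)] by blast
    then show "edge_elem (fst s) \<in> N" using edge_elem_in_N by simp
  qed
  \<comment> \<open>For a closed path the rewriting gives \<open>c u\<close> conjugated by the
    representative of the base vertex; normality of \<open>N'\<close> undoes the
    conjugation.\<close>
  then have "?r \<cdot> c u \<cdot> inv\<^sub>F ?r \<in> N'"
    using telescope[OF F.one_closed assms(1)] cu v by simp
  then have "inv\<^sub>F ?r \<cdot> (?r \<cdot> c u \<cdot> inv\<^sub>F ?r) \<cdot> ?r \<in> N'"
    by (rule N'.inv_op_closed1[OF r])
  moreover have "inv\<^sub>F ?r \<cdot> (?r \<cdot> c u \<cdot> inv\<^sub>F ?r) \<cdot> ?r = c u"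
    using r cu by (metis F.inv_closed F.inv_solve_left F.inv_solve_right F.m_assoc F.m_closed)
  ultimately show ?thesis by simp
qed

theorem derived_coset_iff_net:
  assumes a: "a \<in> words S" and b: "b \<in> words S"
  shows "N' #>\<^bsub>F\<^esub> c a = N' #>\<^bsub>F\<^esub> c b \<longleftrightarrow>
    (\<forall>e. net (steps idF a) e = net (steps idF b) e)"
proof -
  let ?u = "b @ inv_word a"
  have u: "?u \<in> words S" using assms by simp
  have cu: "c ?u = c b \<cdot> inv\<^sub>F c a"
    using assms by (simp only: cls_append inv_word_in_words cls_inv_word)
  have iff: "N' #>\<^bsub>F\<^esub> c a = N' #>\<^bsub>F\<^esub> c b \<longleftrightarrow> c ?u \<in> N'"
    unfolding cu using assms by (intro free_normal.vert_eq_iff[OF free_normal.intro[OF N'_normal]]) simp_all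
  \<comment> \<open>The path of \<open>inv_word a\<close> is appended at the end of the path of
    \<open>b\<close>. It retraces the path of \<open>a\<close> only if both end in the same vertex,
    which each side of the equivalence provides.\<close>
  have net_u: "net (steps idF ?u) e = net (steps idF b) e - net (steps idF a) e"
    if "vert (c a) = vert (c b)" for e
  proof -
    have "steps idF ?u = steps idF b @ steps (c a) (inv_word a)"
      using assms that by (simp add: steps_append steps_vert_cong[of "c b" "c a"])
    then show ?thesis using net_steps_inv_word[OF F.one_closed a] a by simp
  qed
  show ?thesis
  proof (rule iffI)
    assume "N' #>\<^bsub>F\<^esub> c a = N' #>\<^bsub>F\<^esub> c b"
    then have cu': "c ?u \<in> N'" using iff by simp
    then have "vert (c a) = vert (c b)"
      using N'_subset vert_eq_iff[of "c a" "c b"] assms cu by auto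
    then show "\<forall>e. net (steps idF a) e = net (steps idF b) e"
      using net_u net_steps_derived[OF cu' u HOL.refl] by simp
  next
    assume eq: "\<forall>e. net (steps idF a) e = net (steps idF b) e"
    \<comment> \<open>Both paths start at the base vertex, so equal flows have equal boundaries and
      the ends agree.\<close>
    let ?f = "\<lambda>v. if v = vert (c a) then 1 else 0"
    have "boundary ?f (steps idF a) = boundary ?f (steps idF b)"
      using eq by (intro boundary_net_cong) blast
    then have "vert (c a) = vert (c b)"
      using boundary_steps[OF F.one_closed a, of ?f] boundary_steps[OF F.one_closed b, of ?f] assms
      by (simp split: if_splits)
    then have "net (steps idF ?u) e = 0" for e using net_u eq by simp
    then show "N' #>\<^bsub>F\<^esub> c a = N' #>\<^bsub>F\<^esub> c b"
      using derived_of_net_zero[OF u] iff by blast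
  qed
qed

section \<open>Vertices as prefixes of a fixed word\<close>

lemma steps_nth:
  assumes "w \<in> words S"
  shows "steps idF w =
    map (\<lambda>l. ((vert (c (take (edge_pos w l) w)), gen (w ! l)), positive (w ! l))) [0..<length w]"
  using assms
proof (induction w rule: rev_induct)
  case (snoc l w)
  let ?f = "\<lambda>w l. ((vert (c (take (edge_pos w l) w)), gen (w ! l)), positive (w ! l))"
  have w: "w \<in> words S" "[l] \<in> words S" using snoc.prems by simp_all
  have eq: "?f (w @ [l]) k = ?f w k" if "k < length w" for k
    using that by (simp add: edge_pos_def nth_append)
  have last: "steps (c w) [l] = [?f (w @ [l]) (length w)]"
    using w by (cases l) (simp_all add: edge_pos_def cls_append)
  have "steps idF (w @ [l]) = steps idF w @ steps (c w) [l]"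
    using w by (simp add: steps_append)
  also have "\<dots> = map (?f (w @ [l])) [0..<length w] @ [?f (w @ [l]) (length w)]"
    using eq by (simp only: last snoc.IH[OF w(1)]) simp
  finally show ?case by simp
qed simp

lemma net_steps_take:
  assumes "w \<in> words S" "m \<le> length w"
  shows "net (steps idF (take m w)) e =
    (\<Sum>l<m. if (vert (c (take (edge_pos w l) w)), gen (w ! l)) = e then sgn_letter (w ! l) else 0)"
proof -
  have t: "take m w \<in> words S" using assms by (auto dest: in_set_takeD)
  have eq: "take (edge_pos (take m w) l) (take m w) = take (edge_pos w l) w" if "l < m" for l
    using that by (auto simp: edge_pos_def min_def)
  have "net (steps idF (take m w)) e = (\<Sum>l\<leftarrow>[0..<m].
      if (vert (c (take (edge_pos w l) w)), gen (w ! l)) = e then sgn_letter (w ! l) else 0)"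
    unfolding net_def steps_nth[OF t] map_map using assms eq
    by (intro arg_cong[of _ _ sum_list] map_cong) (auto simp: sgn_letter_def)
  then show ?thesis by (simp add: sum_list_distinct_conv_sum_set atLeast0LessThan)
qed

end

text \<open>A vertex on the path of \<open>w\<close> is represented by a prefix length, that is, by
  the position of a head on the input.\<close>

definition same_prefix :: "'a set \<Rightarrow> nat \<Rightarrow> 'a letter list \<Rightarrow> nat \<Rightarrow> nat \<Rightarrow> bool" where
  "same_prefix S d w i j \<longleftrightarrow>
    derived_term (free_group S) d #>\<^bsub>free_group S\<^esub> cls S (take i w) =
    derived_term (free_group S) d #>\<^bsub>free_group S\<^esub> cls S (take j w)"

text \<open>The net flow of the first \<open>m\<close> letters through the edge crossed by letter
  \<open>k\<close>. It refers to vertices only through \<open>same_prefix\<close> at level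
  \<open>d\<close>, which makes the recursion possible.\<close>

definition flow :: "'a set \<Rightarrow> nat \<Rightarrow> 'a letter list \<Rightarrow> nat \<Rightarrow> nat \<Rightarrow> int" where
  "flow S d w k m = (\<Sum>l<m.
    if gen (w ! l) = gen (w ! k) \<and> same_prefix S d w (edge_pos w l) (edge_pos w k)
    then sgn_letter (w ! l) else 0)"

lemma same_prefix_0:
  assumes "w \<in> words S" shows "same_prefix S 0 w i j"
proof -
  interpret free_normal S "carrier (free_group S)"
    using group.normal_self[OF group_free_group] by (rule free_normal.intro)
  have "take i w \<in> words S" "take j w \<in> words S" using assms by (auto dest: in_set_takeD)
  then show ?thesis by (simp add: same_prefix_def derived_term_def vert_eq_iff)
qed

text \<open>Testing the edges crossed by letters of \<open>w\<close> suffices, since neither prefix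
  sends any flow through another edge.\<close>

lemma same_prefix_Suc:
  assumes w: "w \<in> words S" and i: "i \<le> length w" and j: "j \<le> length w"
  shows "same_prefix S (Suc d) w i j \<longleftrightarrow> (\<forall>k<length w. flow S d w k i = flow S d w k j)"
proof -
  interpret free_normal S "derived_term (free_group S) d"
    by (rule free_normal.intro) (rule derived_term_normal[OF group_free_group])
  let ?edge = "\<lambda>l. (vert (c (take (edge_pos w l) w)), gen (w ! l))"
  have t: "take m w \<in> words S" for m using w by (auto dest: in_set_takeD)
  have flow: "net (steps \<one>\<^bsub>F\<^esub> (take m w)) (?edge k) = flow S d w k m" if "m \<le> length w" for m k
    unfolding net_steps_take[OF w that] flow_def same_prefix_def
    by (intro sum.cong HOL.refl) auto
  have "same_prefix S (Suc d) w i j \<longleftrightarrow>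
      (\<forall>e. net (steps \<one>\<^bsub>F\<^esub> (take i w)) e = net (steps \<one>\<^bsub>F\<^esub> (take j w)) e)"
    using derived_coset_iff_net[OF t t] by (simp add: same_prefix_def derived_term_def)
  also have "\<dots> \<longleftrightarrow> (\<forall>k<length w. flow S d w k i = flow S d w k j)"
  proof (intro iffI allI impI)
    fix e assume R: "\<forall>k<length w. flow S d w k i = flow S d w k j"
    show "net (steps \<one>\<^bsub>F\<^esub> (take i w)) e = net (steps \<one>\<^bsub>F\<^esub> (take j w)) e"
    proof (cases "\<exists>k<length w. e = ?edge k")
      case True
      then show ?thesis using R flow i j by auto
    next
      case False
      then have "net (steps \<one>\<^bsub>F\<^esub> (take m w)) e = 0" if "m \<le> length w" for m
        unfolding net_steps_take[OF w that] using that
        by (intro sum.neutral ballI if_not_P) (metis lessThan_iff order.strict_trans2)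
      then show ?thesis using i j by simp
    qed
  qed (use flow i j in metis)
  finally show ?thesis .
qed

lemma same_prefix_full:
  assumes "w \<in> words S"
  shows "same_prefix S d w 0 (length w) \<longleftrightarrow> cls S w \<in> derived_term (free_group S) d"
proof -
  interpret free_normal S "derived_term (free_group S) d"
    by (rule free_normal.intro) (rule derived_term_normal[OF group_free_group])
  show ?thesis using assms vert_eq_iff[of "c []" "c w"]
    by (simp add: same_prefix_def cls_Nil)
qed

section \<open>Programs over read-only heads\<close>

datatype content = Empty | Mark | Letter "nat letter"

text \<open>The mark at the origin turns a head position into a counter that can be tested for
  zero.\<close>

datatype cell = Cell (origin: bool) (content: content)

datatype com =
    Skip
  | Move "nat \<Rightarrow> dir"
  | Seq com com (infixr ";;" 60)
  | Cond "(nat \<Rightarrow> cell) \<Rightarrow> bool" com com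
  | Loop "(nat \<Rightarrow> cell) \<Rightarrow> bool" com

definition shift :: "(nat \<Rightarrow> dir) \<Rightarrow> (nat \<Rightarrow> int) \<Rightarrow> nat \<Rightarrow> int" where
  "shift m s = (\<lambda>v. s v + dir_offset (m v))"

definition view :: "(nat \<Rightarrow> int \<Rightarrow> cell) \<Rightarrow> (nat \<Rightarrow> int) \<Rightarrow> nat \<Rightarrow> cell" where
  "view T s = (\<lambda>v. T v (s v))"

text \<open>\<open>I\<close> is a set of head positions that the execution does not leave.\<close>

inductive exec :: "(nat \<Rightarrow> int) set \<Rightarrow> (nat \<Rightarrow> int \<Rightarrow> cell) \<Rightarrow> com \<Rightarrow> (nat \<Rightarrow> int) \<Rightarrow> (nat \<Rightarrow> int) \<Rightarrow> bool"
  for I T where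
  Skip: "s \<in> I \<Longrightarrow> exec I T Skip s s"
| Move: "s \<in> I \<Longrightarrow> shift m s \<in> I \<Longrightarrow> exec I T (Move m) s (shift m s)"
| Seq: "exec I T c s t \<Longrightarrow> exec I T d t u \<Longrightarrow> exec I T (c ;; d) s u"
| CondT: "b (view T s) \<Longrightarrow> exec I T c s t \<Longrightarrow> exec I T (Cond b c d) s t"
| CondF: "\<not> b (view T s) \<Longrightarrow> exec I T d s t \<Longrightarrow> exec I T (Cond b c d) s t"
| LoopF: "s \<in> I \<Longrightarrow> \<not> b (view T s) \<Longrightarrow> exec I T (Loop b c) s s"
| LoopT: "b (view T s) \<Longrightarrow> exec I T c s t \<Longrightarrow> exec I T (Loop b c) t u \<Longrightarrow> exec I T (Loop b c) s u"

lemma exec_in: "exec I T c s t \<Longrightarrow> s \<in> I \<and> t \<in> I"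
  by (induction rule: exec.induct) auto

lemma exec_mono: "exec I T c s t \<Longrightarrow> I \<subseteq> J \<Longrightarrow> exec J T c s t"
  by (induction rule: exec.induct) (auto intro: exec.intros)

lemma exec_Loop_iterate:
  assumes "\<And>m. m < n \<Longrightarrow> b (view T (St m)) \<and> exec I T c (St m) (St (Suc m))"
    and "St n \<in> I" "\<not> b (view T (St n))"
  shows "exec I T (Loop b c) (St 0) (St n)"
proof -
  have "exec I T (Loop b c) (St (n - k)) (St n)" if "k \<le> n" for k
    using that
  proof (induction k)
    case 0
    then show ?case using assms(2,3) by (simp add: LoopF)
  next
    case (Suc k)
    then show ?case
      using assms(1)[of "n - Suc k"] by (intro LoopT[of b T "St (n - Suc k)"]) (auto simp: Suc_diff_Suc)
  qed
  from this[of n] show ?thesis by simp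
qed

section \<open>Small steps and the counting of configurations\<close>

fun step_com :: "com \<Rightarrow> (nat \<Rightarrow> cell) \<Rightarrow> com \<times> (nat \<Rightarrow> dir)" where
  "step_com Skip V = (Skip, \<lambda>_. Stay)"
| "step_com (Move m) V = (Skip, m)"
| "step_com (c ;; d) V =
    (if c = Skip then (d, \<lambda>_. Stay) else (fst (step_com c V) ;; d, snd (step_com c V)))"
| "step_com (Cond b c d) V = (if b V then c else d, \<lambda>_. Stay)"
| "step_com (Loop b c) V = (if b V then c ;; Loop b c else Skip, \<lambda>_. Stay)"

definition step :: "(nat \<Rightarrow> int \<Rightarrow> cell) \<Rightarrow> com \<times> (nat \<Rightarrow> int) \<Rightarrow> com \<times> (nat \<Rightarrow> int)" where
  "step T cs = (case step_com (fst cs) (view T (snd cs)) of (c', m) \<Rightarrow> (c', shift m (snd cs)))"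

text \<open>All programs that can remain while \<open>c\<close> runs; being finitely many, they
  serve as control states.\<close>

fun residuals :: "com \<Rightarrow> com set" where
  "residuals Skip = {Skip}"
| "residuals (Move m) = {Move m, Skip}"
| "residuals (c ;; d) = (\<lambda>c'. c' ;; d) ` residuals c \<union> residuals d"
| "residuals (Cond b c d) = {Cond b c d} \<union> residuals c \<union> residuals d"
| "residuals (Loop b c) = {Loop b c, Skip} \<union> (\<lambda>c'. c' ;; Loop b c) ` residuals c"

lemma finite_residuals: "finite (residuals c)"
  by (induction c) auto

lemma residuals_self: "c \<in> residuals c"
  by (induction c) auto

lemma Skip_residuals: "Skip \<in> residuals c"
  by (induction c) auto

lemma step_com_residuals: "c' \<in> residuals c \<Longrightarrow> fst (step_com c' V) \<in> residuals c"
  by (induction c arbitrary: c') (auto simp: residuals_self split: if_splits)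

definition step_rel :: "(nat \<Rightarrow> int) set \<Rightarrow> (nat \<Rightarrow> int \<Rightarrow> cell) \<Rightarrow>
    ((com \<times> (nat \<Rightarrow> int)) \<times> (com \<times> (nat \<Rightarrow> int))) set" where
  "step_rel I T = {(x, step T x) |x. snd x \<in> I \<and> snd (step T x) \<in> I}"

lemma shift_Stay [simp]: "shift (\<lambda>_. Stay) s = s"
  by (simp add: shift_def)

lemma step_rel_Seq:
  assumes "((c, s), (c', s')) \<in> (step_rel I T)\<^sup>*"
  shows "((c ;; d, s), (c' ;; d, s')) \<in> (step_rel I T)\<^sup>*"
  using assms
proof (induction rule: rtrancl_induct2)
  case (step c1 s1 c2 s2)
  show ?case
  proof (cases "c1 = Skip")
    \<comment> \<open>\<open>Skip\<close> idles under \<open>step\<close> while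
      \<open>Skip ;; d\<close> passes on to \<open>d\<close>, so idle steps are dropped rather than
      simulated.\<close>
    case True
    then have "c2 = c1" "s2 = s1" using step.hyps(2) by (auto simp: step_rel_def step_def)
    then show ?thesis using step.IH by simp
  next
    case False
    then have "((c1 ;; d, s1), (c2 ;; d, s2)) \<in> step_rel I T"
      using step.hyps(2) by (auto simp: step_rel_def step_def split: prod.splits)
    then show ?thesis using step.IH by (rule rtrancl_into_rtrancl[rotated])
  qed
qed simp

lemma exec_step_rel: "exec I T c s t \<Longrightarrow> ((c, s), (Skip, t)) \<in> (step_rel I T)\<^sup>*"
proof (induction rule: exec.induct)
  case (Move s m)
  then have "((Move m, s), (Skip, shift m s)) \<in> step_rel I T" by (auto simp: step_rel_def step_def)
  then show ?case by (rule r_into_rtrancl)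
next
  case (Seq c s t d u)
  then have "((Skip ;; d, t), (d, t)) \<in> step_rel I T"
    using exec_in[OF Seq(1)] by (auto simp: step_rel_def step_def)
  then show ?case using step_rel_Seq[OF Seq.IH(1)] Seq.IH(2)
    by (meson converse_rtrancl_into_rtrancl rtrancl_trans)
next
  case (CondT b s c t d)
  then have "((Cond b c d, s), (c, s)) \<in> step_rel I T"
    using exec_in[OF CondT(2)] by (auto simp: step_rel_def step_def)
  then show ?case using CondT.IH by (rule converse_rtrancl_into_rtrancl)
next
  case (CondF b s d t c)
  then have "((Cond b c d, s), (d, s)) \<in> step_rel I T"
    using exec_in[OF CondF(2)] by (auto simp: step_rel_def step_def)
  then show ?case using CondF.IH by (rule converse_rtrancl_into_rtrancl)
next
  case (LoopF s b c)
  then have "((Loop b c, s), (Skip, s)) \<in> step_rel I T" by (auto simp: step_rel_def step_def)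
  then show ?case by (rule r_into_rtrancl)
next
  case (LoopT b s c t u)
  have "((Loop b c, s), (c ;; Loop b c, s)) \<in> step_rel I T"
    using exec_in[OF LoopT(2)] LoopT(1) by (auto simp: step_rel_def step_def)
  moreover have "((Skip ;; Loop b c, t), (Loop b c, t)) \<in> step_rel I T"
    using exec_in[OF LoopT(2)] by (auto simp: step_rel_def step_def)
  ultimately show ?case using step_rel_Seq[OF LoopT.IH(1)] LoopT.IH(2)
    by (meson converse_rtrancl_into_rtrancl rtrancl_trans)
qed simp

text \<open>A shortest deterministic path does not repeat a configuration.\<close>

lemma funpow_reach_le_card:
  assumes "(x, y) \<in> {(x, f x) |x. x \<in> A \<and> f x \<in> A}\<^sup>*" "x \<in> A" "finite A"
  shows "\<exists>n\<le>card A. (f ^^ n) x = y"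
proof -
  have "\<exists>n. (f ^^ n) x = y \<and> (\<forall>i\<le>n. (f ^^ i) x \<in> A)"
    using assms(1)
  proof (induction rule: rtrancl_induct)
    case base
    then show ?case using assms(2) by (intro exI[of _ 0]) simp
  next
    case (step y z)
    then obtain n where "(f ^^ n) x = y" "\<forall>i\<le>n. (f ^^ i) x \<in> A" by blast
    then show ?case using step.hyps by (intro exI[of _ "Suc n"]) (auto simp: le_Suc_eq)
  qed
  then obtain m where m: "(f ^^ m) x = y" "\<forall>i\<le>m. (f ^^ i) x \<in> A" by blast
  define n where "n = (LEAST n. (f ^^ n) x = y)"
  have n: "(f ^^ n) x = y" "n \<le> m"
    unfolding n_def using m(1) by (rule LeastI, rule Least_le)
  have inj: "inj_on (\<lambda>i. (f ^^ i) x) {..<n}"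
  proof (rule linorder_inj_onI')
    fix i j assume ij: "i < j" "j \<in> {..<n}"
    show "(f ^^ i) x \<noteq> (f ^^ j) x"
    proof
      assume eq: "(f ^^ i) x = (f ^^ j) x"
      have "(f ^^ (n - j + i)) x = (f ^^ (n - j)) ((f ^^ j) x)" by (simp add: funpow_add eq)
      also have "\<dots> = (f ^^ (n - j + j)) x" by (simp add: funpow_add del: le_add_diff_inverse2)
      also have "\<dots> = y" using ij n by simp
      finally have "n \<le> n - j + i" unfolding n_def by (rule Least_le)
      then show False using ij by simp
    qed
  qed
  have "(\<lambda>i. (f ^^ i) x) ` {..<n} \<subseteq> A" using m n by auto
  then have "n \<le> card A" using card_inj_on_le[OF inj] assms(3) by simp
  then show ?thesis using n by blast
qed

text \<open>Since a terminating run repeats no configuration, a bound on the visited positions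
  already bounds the time; no loop has to be analysed.\<close>

theorem exec_time:
  assumes "exec I T c s t" "finite I"
  shows "\<exists>n \<le> card (residuals c) * card I. (step T ^^ n) (c, s) = (Skip, t)"
proof -
  let ?A = "residuals c \<times> I"
  let ?R = "{(x, step T x) |x. x \<in> ?A \<and> step T x \<in> ?A}"
  have "((c, s), x) \<in> ?R\<^sup>* \<and> x \<in> ?A" if "((c, s), x) \<in> (step_rel I T)\<^sup>*" for x
    using that
  proof (induction rule: rtrancl_induct)
    case base
    then show ?case using exec_in[OF assms(1)] residuals_self by simp
  next
    case (step y z)
    then have z: "z = step T y" "snd z \<in> I" and y: "y \<in> ?A" by (auto simp: step_rel_def)
    have "fst z = fst (step_com (fst y) (view T (snd y)))"
      unfolding z(1) step_def by (simp add: case_prod_beta)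
    moreover have "fst (step_com (fst y) (view T (snd y))) \<in> residuals c"
      using y by (intro step_com_residuals) (simp add: mem_Times_iff)
    ultimately have zA: "z \<in> ?A" using z(2) by (simp only: mem_Times_iff simp_thms)
    have yz: "(y, z) \<in> ?R"
      by (rule CollectI, rule exI[of _ y]) (simp only: z(1)[symmetric] y zA simp_thms)
    have "((c, s), y) \<in> ?R\<^sup>*" using step.IH by (rule conjunct1)
    then have "((c, s), z) \<in> ?R\<^sup>*" using yz by (rule rtrancl_into_rtrancl)
    then show ?case using zA by (rule conjI)
  qed
  from this[OF exec_step_rel[OF assms(1)]] show ?thesis
    using funpow_reach_le_card[of "(c, s)" "(Skip, t)" "step T" ?A] exec_in[OF assms(1)]
      residuals_self assms(2) finite_residuals by (simp add: card_cartesian_product)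
qed

text \<open>Head positions are total functions; fixing them at 0 from \<open>K\<close> on keeps the
  set finite.\<close>

definition box :: "nat \<Rightarrow> int \<Rightarrow> (nat \<Rightarrow> int) set" where
  "box K B = {s. (\<forall>v<K. \<bar>s v\<bar> \<le> B) \<and> (\<forall>v\<ge>K. s v = 0)}"

lemma box_upd: "s \<in> box K B \<Longrightarrow> v < K \<Longrightarrow> \<bar>x\<bar> \<le> B \<Longrightarrow> s(v := x) \<in> box K B"
  by (simp add: box_def)

lemma finite_card_box: "finite (box K B) \<and> card (box K B) \<le> nat (2 * B + 1) ^ K"
proof -
  let ?A = "{xs. set xs \<subseteq> {-B..B} \<and> length xs = K}"
  let ?f = "\<lambda>s::nat \<Rightarrow> int. map s [0..<K]"
  have inj: "inj_on ?f (box K B)"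
  proof (rule inj_onI, rule ext)
    fix s t v assume st: "s \<in> box K B" "t \<in> box K B" "?f s = ?f t"
    show "s v = t v"
    proof (cases "v < K")
      case True
      have "?f s ! v = ?f t ! v" using st(3) by (rule arg_cong)
      then show ?thesis using True by simp
    qed (use st in \<open>simp add: box_def\<close>)
  qed
  have sub: "?f ` box K B \<subseteq> ?A" by (auto simp: box_def abs_le_iff minus_le_iff)
  have fin: "finite ?A" by (rule finite_lists_length_eq) simp
  have "card ?A = nat (2 * B + 1) ^ K" by (subst card_lists_length_eq) (simp_all add: algebra_simps)
  then show ?thesis using inj_on_finite[OF inj sub fin] card_inj_on_le[OF inj sub fin] by simp
qed

section \<open>Elementary programs and bounded loops\<close>

definition up :: "nat \<Rightarrow> com" where "up v = Move (\<lambda>u. if u = v then MoveRight else Stay)"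
definition down :: "nat \<Rightarrow> com" where "down v = Move (\<lambda>u. if u = v then MoveLeft else Stay)"

lemma exec_up: "s \<in> I \<Longrightarrow> t = s(v := s v + 1) \<Longrightarrow> t \<in> I \<Longrightarrow> exec I T (up v) s t"
proof -
  have "shift (\<lambda>u. if u = v then MoveRight else Stay) s = s(v := s v + 1)"
    by (auto simp: shift_def)
  then show "s \<in> I \<Longrightarrow> t = s(v := s v + 1) \<Longrightarrow> t \<in> I \<Longrightarrow> exec I T (up v) s t"
    unfolding up_def using exec.Move by metis
qed

lemma exec_down: "s \<in> I \<Longrightarrow> t = s(v := s v - 1) \<Longrightarrow> t \<in> I \<Longrightarrow> exec I T (down v) s t"
proof -
  have "shift (\<lambda>u. if u = v then MoveLeft else Stay) s = s(v := s v - 1)"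
    by (auto simp: shift_def)
  then show "s \<in> I \<Longrightarrow> t = s(v := s v - 1) \<Longrightarrow> t \<in> I \<Longrightarrow> exec I T (down v) s t"
    unfolding down_def using exec.Move by metis
qed

lemma exec_Cond:
  "(b (view T s) \<Longrightarrow> exec I T c s t) \<Longrightarrow> (\<not> b (view T s) \<Longrightarrow> exec I T d s t) \<Longrightarrow> exec I T (Cond b c d) s t"
  using exec.CondT exec.CondF by metis

text \<open>Head \<open>l\<close> must start at 0. Heads cannot be compared, so the position \<open>n\<close> of head \<open>i\<close> is
  transferred to head \<open>l\<close> step by step, with the body run at \<open>l = 0, \<dots>, n - 1\<close>, and back again.\<close>

definition for_below :: "nat \<Rightarrow> nat \<Rightarrow> com \<Rightarrow> com" where
  "for_below i l body =
    Loop (\<lambda>V. \<not> origin (V i)) (down i ;; body ;; up l) ;;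
    Loop (\<lambda>V. \<not> origin (V l)) (down l ;; up i)"

text \<open>Head \<open>c\<close> is an accumulator and \<open>g m\<close> its value after
  \<open>m\<close> rounds. The body runs while head \<open>i\<close> is displaced to
  \<open>n - m - 1\<close>, so it has to work with \<open>l\<close> instead.\<close>

lemma exec_for_below:
  assumes s: "s \<in> box K B" "s i = int n" "s l = 0" "s c = g 0"
    and vars: "i < K" "l < K" "c < K" "i \<noteq> l" "c \<noteq> i" "c \<noteq> l"
    and T: "\<And>p. origin (T i p) \<longleftrightarrow> p = 0" "\<And>p. origin (T l p) \<longleftrightarrow> p = 0"
    and g: "\<And>m. m \<le> n \<Longrightarrow> \<bar>g m\<bar> \<le> B"
    and body: "\<And>m. m < n \<Longrightarrow> exec (box K B) T body
      (s(i := int n - int m - 1, l := int m, c := g m))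
      (s(i := int n - int m - 1, l := int m, c := g (Suc m)))"
  shows "exec (box K B) T (for_below i l body) s (s(c := g n))"
proof -
  let ?I = "box K B"
  \<comment> \<open>\<open>St\<close> describes the transfer from \<open>i\<close> to
    \<open>l\<close>, and \<open>Rt\<close> the way back.\<close>
  define St where "St m = s(i := int n - int m, l := int m, c := g m)" for m
  define Rt where "Rt m = s(i := int m, l := int n - int m, c := g n)" for m
  have n: "int n \<le> B" using s vars by (auto simp: box_def)
  have St: "St m \<in> ?I" "m < n \<Longrightarrow> (St m)(i := int n - int m - 1) \<in> ?I" if "m \<le> n" for m
    unfolding St_def using that vars n g by (auto intro!: box_upd s(1))
  have Rt: "Rt m \<in> ?I" "m < n \<Longrightarrow> (Rt m)(l := int n - int m - 1) \<in> ?I" if "m \<le> n" for m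
    unfolding Rt_def using that vars n g by (auto intro!: box_upd s(1))
  have 1: "exec ?I T (Loop (\<lambda>V. \<not> origin (V i)) (down i ;; body ;; up l)) (St 0) (St n)"
  proof (rule exec_Loop_iterate)
    fix m assume m: "m < n"
    have "exec ?I T (down i) (St m) ((St m)(i := int n - int m - 1))"
      using m St vars by (intro exec_down) (auto simp: St_def)
    moreover have "(St m)(i := int n - int m - 1) = s(i := int n - int m - 1, l := int m, c := g m)"
      using vars by (auto simp: St_def)
    ultimately have "exec ?I T (down i) (St m) (s(i := int n - int m - 1, l := int m, c := g m))"
      by simp
    moreover have "exec ?I T (up l) (s(i := int n - int m - 1, l := int m, c := g (Suc m))) (St (Suc m))"
      using exec_in[OF body[OF m]] St(1)[of "Suc m"] m vars
      by (intro exec_up) (auto simp: St_def fun_eq_iff)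
    ultimately have "exec ?I T (down i ;; body ;; up l) (St m) (St (Suc m))"
      using body[OF m] by (blast intro: exec.Seq)
    moreover have "\<not> origin (view T (St m) i)"
      using m vars T(1) by (simp add: view_def St_def)
    ultimately show "\<not> origin (view T (St m) i) \<and> exec ?I T (down i ;; body ;; up l) (St m) (St (Suc m))"
      by blast
  next
    show "St n \<in> ?I" using St by simp
    show "\<not> \<not> origin (view T (St n) i)" using T vars by (simp add: view_def St_def)
  qed
  have 2: "exec ?I T (Loop (\<lambda>V. \<not> origin (V l)) (down l ;; up i)) (Rt 0) (Rt n)"
  proof (rule exec_Loop_iterate)
    fix m assume m: "m < n"
    have "exec ?I T (down l) (Rt m) ((Rt m)(l := int n - int m - 1))"
      using m Rt vars by (intro exec_down) (auto simp: Rt_def)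
    moreover have "exec ?I T (up i) ((Rt m)(l := int n - int m - 1)) (Rt (Suc m))"
      using Rt(1)[of "Suc m"] Rt(2)[of m] m vars by (intro exec_up) (auto simp: Rt_def fun_eq_iff)
    ultimately show "\<not> origin (view T (Rt m) l) \<and> exec ?I T (down l ;; up i) (Rt m) (Rt (Suc m))"
      using m vars T(2) by (auto simp: view_def Rt_def intro: exec.Seq)
  next
    show "Rt n \<in> ?I" using Rt by simp
    show "\<not> \<not> origin (view T (Rt n) l)" using T vars by (simp add: view_def Rt_def)
  qed
  have "St 0 = s" using s by (auto simp: St_def)
  moreover have "St n = Rt 0" by (simp add: St_def Rt_def)
  moreover have "Rt n = s(c := g n)" using s vars by (auto simp: Rt_def)
  ultimately show ?thesis unfolding for_below_def using exec.Seq[OF 1, of _ "Rt n"] 2 by simp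
qed

section \<open>Deciding equality of prefixes modulo a derived term\<close>

definition word_cell :: "nat letter list \<Rightarrow> int \<Rightarrow> cell" where
  "word_cell w p = Cell (p = 0) (if 0 \<le> p \<and> p < int (length w) then Letter (w ! nat p) else Empty)"

definition letter_at :: "cell \<Rightarrow> nat letter" where
  "letter_at a = (case content a of Letter l \<Rightarrow> l | _ \<Rightarrow> Gen 0)"

definition up_unless :: "bool \<Rightarrow> nat \<Rightarrow> com" where
  "up_unless b v = (if b then Skip else up v)"

definition down_unless :: "bool \<Rightarrow> nat \<Rightarrow> com" where
  "down_unless b v = (if b then Skip else down v)"

text \<open>Programs have no variables, so the signs \<open>pl\<close> and \<open>pk\<close> of the
  two letters are parameters, fixed by branching in \<open>flow_step\<close>. They move the heads to
  the origins of the two edges before the comparison \<open>e\<close>; \<open>\<sigma>\<close> is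
  the sign with which the flow is added to \<open>c\<close>.\<close>

definition count_edge :: "com \<Rightarrow> nat \<Rightarrow> nat \<Rightarrow> nat \<Rightarrow> nat \<Rightarrow> bool \<Rightarrow> bool \<Rightarrow> bool \<Rightarrow> com" where
  "count_edge e r l k c \<sigma> pl pk =
    up_unless pl l ;; up_unless pk k ;; e ;; down_unless pl l ;; down_unless pk k ;;
    Cond (\<lambda>V. \<not> origin (V r)) (down r ;; (if \<sigma> = pl then up c else down c)) Skip"

definition flow_step :: "com \<Rightarrow> nat \<Rightarrow> nat \<Rightarrow> nat \<Rightarrow> nat \<Rightarrow> bool \<Rightarrow> com" where
  "flow_step e r l k c \<sigma> =
    Cond (\<lambda>V. gen (letter_at (V l)) = gen (letter_at (V k)))
      (Cond (\<lambda>V. positive (letter_at (V l)))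
        (Cond (\<lambda>V. positive (letter_at (V k)))
          (count_edge e r l k c \<sigma> True True) (count_edge e r l k c \<sigma> True False))
        (Cond (\<lambda>V. positive (letter_at (V k)))
          (count_edge e r l k c \<sigma> False True) (count_edge e r l k c \<sigma> False False)))
      Skip"

text \<open>Level \<open>d\<close> uses the heads \<open>4 d, \<dots>, 4 d + 3\<close> as result, edge, running position and counter.
  The counter is reset by running the summation with opposite signs.\<close>

primrec eqprog :: "nat \<Rightarrow> nat \<Rightarrow> nat \<Rightarrow> com" where
  "eqprog 0 i j = up 0"
| "eqprog (Suc d) i j =
    (let r = 4 * Suc d; k = r + 1; l = r + 2; c = r + 3;
         body = flow_step (eqprog d l k) (4 * d) l k c
     in up r ;;
        Loop (\<lambda>V. content (V k) \<noteq> Empty)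
          (for_below j l (body True) ;; for_below i l (body False) ;;
           Cond (\<lambda>V. \<not> origin (V c) \<and> \<not> origin (V r)) (down r) Skip ;;
           for_below j l (body False) ;; for_below i l (body True) ;; up k) ;;
        Loop (\<lambda>V. \<not> origin (V k)) (down k))"

text \<open>In \<open>B\<close>, the term \<open>3 * int (length w)\<close> is for the counter: it
  holds a difference of two flows, at most twice the length in size, while a further flow is being
  added or subtracted.\<close>

locale word_heads =
  fixes S :: "nat set" and w :: "nat letter list" and T :: "nat \<Rightarrow> int \<Rightarrow> cell"
    and W K :: nat and B :: int
  assumes w: "w \<in> words S" and T: "v < W \<Longrightarrow> T v = word_cell w"
    and W: "W \<le> K" and B: "3 * int (length w) + 3 \<le> B"
begin

abbreviation "I \<equiv> box K B"
abbreviation "run \<equiv> exec (box K B) T"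
abbreviation "same \<equiv> same_prefix S"

lemma origin_T: "v < W \<Longrightarrow> origin (T v p) \<longleftrightarrow> p = 0"
  by (simp add: T word_cell_def)

lemma content_T: "v < W \<Longrightarrow> 0 \<le> p \<Longrightarrow> content (T v p) \<noteq> Empty \<longleftrightarrow> p < int (length w)"
  by (simp add: T word_cell_def)

lemma letter_T: "v < W \<Longrightarrow> p < length w \<Longrightarrow> letter_at (T v (int p)) = w ! p"
  by (simp add: T word_cell_def letter_at_def)

lemma upd_I: "s \<in> I \<Longrightarrow> v < W \<Longrightarrow> \<bar>x\<bar> \<le> B \<Longrightarrow> s(v := x) \<in> I"
  using W by (intro box_upd) simp_all

lemma run_up_unless: "s \<in> I \<Longrightarrow> t = s(v := if b then s v else s v + 1) \<Longrightarrow> t \<in> I \<Longrightarrow> run (up_unless b v) s t"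
  unfolding up_unless_def using exec.Skip[of s I T] by (auto intro!: exec_up)

lemma run_down_unless: "s \<in> I \<Longrightarrow> t = s(v := if b then s v else s v - 1) \<Longrightarrow> t \<in> I \<Longrightarrow> run (down_unless b v) s t"
  unfolding down_unless_def using exec.Skip[of s I T] by (auto intro!: exec_down)

text \<open>The calling convention: the heads of levels up to \<open>d\<close> start at 0 and all
  heads but the result head are restored, so the program can be called inside loops.\<close>

definition decides_same :: "nat \<Rightarrow> com \<Rightarrow> nat \<Rightarrow> nat \<Rightarrow> bool" where
  "decides_same d e i j \<longleftrightarrow> (\<forall>s a b. s \<in> I \<longrightarrow> s i = int a \<longrightarrow> s j = int b \<longrightarrow> a \<le> length w \<longrightarrow>
    b \<le> length w \<longrightarrow> (\<forall>v<4 * Suc d. s v = 0) \<longrightarrow>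
    run e s (s(4 * d := if same d w a b then 1 else 0)))"

lemma run_count_edge:
  assumes e: "decides_same d e l k"
    and vars: "4 * Suc d \<le> l" "4 * Suc d \<le> k" "4 * Suc d \<le> c" "l < W" "k < W" "c < W"
      "l \<noteq> k" "c \<noteq> l" "c \<noteq> k"
    and s: "s \<in> I" "s l = int p" "s k = int m" "p < length w" "m < length w" "\<forall>v<4 * Suc d. s v = 0"
    and a: "a = (if pl then p else Suc p)" and b: "b = (if pk then m else Suc m)"
    and t: "t = s(c := s c + (if same d w a b then (if \<sigma> = pl then 1 else - 1) else 0))" "t \<in> I"
  shows "run (count_edge e (4 * d) l k c \<sigma> pl pk) s t"
proof -
  let ?q = "if same d w a b then 1 else 0 :: int"
  have d: "4 * d < W" "4 * d \<noteq> l" "4 * d \<noteq> k" "4 * d \<noteq> c" using vars by auto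
  have L: "int a \<le> B" "int b \<le> B" "a \<le> length w" "b \<le> length w" "int p \<le> B" "int m \<le> B" "1 \<le> B"
    using s B a b by auto
  have 1: "run (up_unless pl l) s (s(l := int a))"
    using s a L vars by (intro run_up_unless upd_I) auto
  have 2: "run (up_unless pk k) (s(l := int a)) (s(l := int a, k := int b))"
    using s b L vars by (intro run_up_unless upd_I) auto
  have "s(l := int a, k := int b) \<in> I" using s L vars by (intro upd_I) auto
  then have 3: "run e (s(l := int a, k := int b)) (s(l := int a, k := int b, 4 * d := ?q))"
    using e[unfolded decides_same_def, rule_format, of "s(l := int a, k := int b)" a b] s L vars
    by simp
  have 4: "run (down_unless pl l) (s(l := int a, k := int b, 4 * d := ?q))
      (s(k := int b, 4 * d := ?q))"
    using s a L vars d by (intro run_down_unless upd_I) (auto simp: fun_eq_iff)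
  have 5: "run (down_unless pk k) (s(k := int b, 4 * d := ?q)) (s(4 * d := ?q))"
    using s b L vars d by (intro run_down_unless upd_I) (auto simp: fun_eq_iff)
  have sd: "s (4 * d) = 0" using s by simp
  have 6: "run (Cond (\<lambda>V. \<not> origin (V (4 * d))) (down (4 * d) ;; (if \<sigma> = pl then up c else down c)) Skip)
      (s(4 * d := ?q)) t"
  proof (cases "same d w a b")
    case True
    have "run (down (4 * d)) (s(4 * d := 1)) s"
      using sd s d L by (intro exec_down upd_I) (auto simp: fun_eq_iff)
    moreover have "run (if \<sigma> = pl then up c else down c) s t"
      using True t s by (auto intro!: exec_up exec_down)
    ultimately have "run (down (4 * d) ;; (if \<sigma> = pl then up c else down c)) (s(4 * d := 1)) t"
      by (rule exec.Seq)
    then show ?thesis using True d by (intro exec_Cond) (auto simp: view_def origin_T)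
  next
    case False
    then have "t = s" "s(4 * d := ?q) = s" using t sd by (auto simp: fun_eq_iff)
    then show ?thesis using d s by (intro exec_Cond) (auto simp: view_def origin_T sd exec.Skip)
  qed
  show ?thesis unfolding count_edge_def
    by (rule exec.Seq[OF 1 exec.Seq[OF 2 exec.Seq[OF 3 exec.Seq[OF 4 exec.Seq[OF 5 6]]]]])
qed

definition flow_term :: "nat \<Rightarrow> nat \<Rightarrow> nat \<Rightarrow> int" where
  "flow_term d k l = (if gen (w ! l) = gen (w ! k) \<and> same d w (edge_pos w l) (edge_pos w k)
    then sgn_letter (w ! l) else 0)"

lemma flow_Suc: "flow S d w k (Suc m) = flow S d w k m + flow_term d k m"
  by (simp add: flow_def flow_term_def)

lemma flow_0: "flow S d w k 0 = 0"
  by (simp add: flow_def)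

lemma abs_flow_le: "\<bar>flow S d w k m\<bar> \<le> int m"
proof (induction m)
  case (Suc m)
  have "\<bar>flow_term d k m\<bar> \<le> 1" by (simp add: flow_term_def sgn_letter_def)
  then show ?case using Suc by (simp add: flow_Suc)
qed (simp add: flow_0)

lemma run_flow_step:
  assumes e: "decides_same d e l k"
    and vars: "4 * Suc d \<le> l" "4 * Suc d \<le> k" "4 * Suc d \<le> c" "l < W" "k < W" "c < W"
      "l \<noteq> k" "c \<noteq> l" "c \<noteq> k"
    and s: "s \<in> I" "s l = int p" "s k = int m" "p < length w" "m < length w" "\<forall>v<4 * Suc d. s v = 0"
    and t: "t = s(c := s c + (if \<sigma> then 1 else - 1) * flow_term d m p)" "t \<in> I"
  shows "run (flow_step e (4 * d) l k c \<sigma>) s t"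
proof -
  note ce = run_count_edge[OF e vars s HOL.refl HOL.refl _ t(2), where \<sigma> = \<sigma>]
  have v: "view T s l = T l (int p)" "view T s k = T k (int m)" using s by (simp_all add: view_def)
  note L = letter_T[OF vars(4) s(4)] letter_T[OF vars(5) s(5)]
  show ?thesis unfolding flow_step_def
  proof (intro exec_Cond; (simp only: v L)?)
    assume g: "gen (w ! p) = gen (w ! m)" "positive (w ! p)" "positive (w ! m)"
    show "run (count_edge e (4 * d) l k c \<sigma> True True) s t"
      using g t by (intro ce) (auto simp: flow_term_def edge_pos_def sgn_letter_def)
  next
    assume g: "gen (w ! p) = gen (w ! m)" "positive (w ! p)" "\<not> positive (w ! m)"
    show "run (count_edge e (4 * d) l k c \<sigma> True False) s t"
      using g t by (intro ce) (auto simp: flow_term_def edge_pos_def sgn_letter_def)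
  next
    assume g: "gen (w ! p) = gen (w ! m)" "\<not> positive (w ! p)" "positive (w ! m)"
    show "run (count_edge e (4 * d) l k c \<sigma> False True) s t"
      using g t by (intro ce) (auto simp: flow_term_def edge_pos_def sgn_letter_def)
  next
    assume g: "gen (w ! p) = gen (w ! m)" "\<not> positive (w ! p)" "\<not> positive (w ! m)"
    show "run (count_edge e (4 * d) l k c \<sigma> False False) s t"
      using g t by (intro ce) (auto simp: flow_term_def edge_pos_def sgn_letter_def)
  next
    assume "gen (w ! p) \<noteq> gen (w ! m)"
    then show "run Skip s t" using s t by (auto simp: flow_term_def exec.Skip)
  qed
qed

lemma run_sum_flow:
  assumes e: "decides_same d e l k"
    and vars: "4 * Suc d \<le> l" "4 * Suc d \<le> k" "4 * Suc d \<le> c" "l < W" "k < W" "c < W"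
      "l \<noteq> k" "c \<noteq> l" "c \<noteq> k" "i < W" "4 * Suc d \<le> i" "i \<noteq> l" "i \<noteq> k" "i \<noteq> c"
    and s: "s \<in> I" "s l = 0" "s k = int m" "s i = int n" "n \<le> length w" "m < length w"
      "\<forall>v<4 * Suc d. s v = 0"
    and c: "\<bar>s c\<bar> \<le> 2 * int (length w)"
  shows "run (for_below i l (flow_step e (4 * d) l k c \<sigma>)) s
    (s(c := s c + (if \<sigma> then 1 else - 1) * flow S d w m n))"
proof -
  define g where "g p = s c + (if \<sigma> then 1 else - 1) * flow S d w m p" for p
  have gB: "\<bar>g p\<bar> \<le> B" if "p \<le> n" for p
  proof -
    have "\<bar>flow S d w m p\<bar> \<le> int (length w)" using that s(5) abs_flow_le[of d m p] by linarith
    then have "\<bar>s c\<bar> + \<bar>(if \<sigma> then 1 else - 1) * flow S d w m p\<bar> \<le> B" using c B by (simp add: abs_mult)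
    then show ?thesis unfolding g_def by (rule order_trans[OF abs_triangle_ineq])
  qed
  have g0: "s c = g 0" by (simp add: g_def flow_0)
  have gSuc: "g (Suc p) = g p + (if \<sigma> then 1 else - 1) * flow_term d m p" for p
    by (simp add: g_def flow_Suc)
  have body: "run (flow_step e (4 * d) l k c \<sigma>)
      (s(i := int n - int p - 1, l := int p, c := g p))
      (s(i := int n - int p - 1, l := int p, c := g (Suc p)))" (is "run _ ?s ?t") if p: "p < n" for p
  proof (rule run_flow_step[OF e vars(1-9), where p = p and m = m])
    have n: "\<bar>int n - int p - 1\<bar> \<le> B" "\<bar>int p\<bar> \<le> B" using p s(5) B by linarith+
    show "?s \<in> I" "?t \<in> I"
      by (intro upd_I s(1) vars n gB; use p in simp)+
    show "?t = ?s(c := ?s c + (if \<sigma> then 1 else - 1) * flow_term d m p)"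
      using vars by (simp add: gSuc)
    show "p < length w" using p s(5) by simp
    show "m < length w" by (rule s)
    show "\<forall>v<4 * Suc d. ?s v = 0" using s(7) vars by auto
  qed (use s vars in simp_all)
  show ?thesis unfolding g_def[symmetric]
    by (rule exec_for_below[where g = g and c = c and i = i and l = l and n = n and s = s, OF s(1,4,2) g0 _ _ _ vars(12) vars(14)[symmetric] vars(8)]; (rule body gB | use vars W origin_T in simp)?)
qed

lemma run_eqprog:
  assumes "i < W" "j < W" "4 * Suc d \<le> i" "4 * Suc d \<le> j" "i \<noteq> j"
  shows "decides_same d (eqprog d i j) i j"
  using assms
proof (induction d arbitrary: i j)
  case 0
  have "run (up 0) s (s(0 := 1))" if "s \<in> I" "s 0 = 0" for s
    using that 0 B by (intro exec_up upd_I) auto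
  then show ?case by (simp add: decides_same_def same_prefix_0[OF w])
next
  case (Suc d)
  define r where "r = 4 * Suc d"
  define k where "k = r + 1"
  define l where "l = r + 2"
  define c where "c = r + 3"
  let ?e = "eqprog d l k"
  let ?body = "flow_step ?e (4 * d) l k c"
  let ?main = "for_below j l (?body True) ;; for_below i l (?body False) ;;
           Cond (\<lambda>V. \<not> origin (V c) \<and> \<not> origin (V r)) (down r) Skip ;;
           for_below j l (?body False) ;; for_below i l (?body True) ;; up k"
  have prog: "eqprog (Suc d) i j = up r ;; Loop (\<lambda>V. content (V k) \<noteq> Empty) ?main ;;
      Loop (\<lambda>V. \<not> origin (V k)) (down k)"
    by (simp only: eqprog.simps Let_def r_def k_def l_def c_def)
  have ij: "r + 4 \<le> i" "r + 4 \<le> j" "i < W" "j < W" "i \<noteq> j" using Suc.prems by (auto simp: r_def)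
  have rW: "r < W" "k < W" "l < W" "c < W" using ij by (auto simp: k_def l_def c_def)
  have neq: "r \<noteq> k" "r \<noteq> l" "r \<noteq> c" "k \<noteq> l" "k \<noteq> c" "l \<noteq> c" "i \<noteq> r" "i \<noteq> k" "i \<noteq> l" "i \<noteq> c"
    "j \<noteq> r" "j \<noteq> k" "j \<noteq> l" "j \<noteq> c"
    using ij by (auto simp: k_def l_def c_def)
  have low: "4 * Suc d \<le> r" "4 * Suc d \<le> k" "4 * Suc d \<le> l" "4 * Suc d \<le> c" "4 * Suc d \<le> i" "4 * Suc d \<le> j"
    using ij by (auto simp: r_def k_def l_def c_def)
  have e: "decides_same d ?e l k" using rW low neq by (intro Suc.IH) auto
  show ?case unfolding decides_same_def
  proof (intro allI impI)
    fix s a b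
    assume s: "s \<in> I" "s i = int a" "s j = int b" "a \<le> length w" "b \<le> length w"
      and z: "\<forall>v<4 * Suc (Suc d). s v = 0"
    have z': "s r = 0" "s k = 0" "s l = 0" "s c = 0" "\<forall>v<4 * Suc d. s v = 0"
      using z by (auto simp: r_def k_def l_def c_def)
    let ?fl = "flow S d w"
    \<comment> \<open>The result head starts at 1 and is pulled down at the first edge where the
      flows differ; the program tests the head so that this happens only once.\<close>
    define ok where "ok m = (if \<forall>k<m. ?fl k a = ?fl k b then 1 else 0 :: int)" for m
    define St where "St m = s(r := ok m, k := int m)" for m
    have okB: "\<bar>ok m\<bar> \<le> B" for m using B by (simp add: ok_def)
    have St: "St m \<in> I" if "m \<le> length w" for m
      unfolding St_def using that s B rW okB by (auto intro!: upd_I)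
    have main: "run ?main (St m) (St (Suc m))" if m: "m < length w" for m
    proof -
      let ?u = "St m" and ?v = "s(r := ok (Suc m), k := int m)"
      have fb: "\<bar>?fl m a\<bar> \<le> int (length w)" "\<bar>?fl m b\<bar> \<le> int (length w)"
        using abs_flow_le[of d m a] abs_flow_le[of d m b] s(4,5) by linarith+
      \<comment> \<open>The invariant between the four summations: everything but the counter is in
        place, and the counter leaves room for one more flow.\<close>
      define P where "P u x \<longleftrightarrow> u \<in> I \<and> u l = 0 \<and> u k = int m \<and> u i = int a \<and> u j = int b \<and>
        (\<forall>v<4 * Suc d. u v = 0) \<and> u c = x \<and> \<bar>x\<bar> \<le> 2 * int (length w)" for u x
      have P_I: "u \<in> I" if "P u x" for u x using that by (simp add: P_def)
      have P_upd: "P (u(c := y)) y" if "P u x" "\<bar>y\<bar> \<le> 2 * int (length w)" for u x y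
      proof -
        have "u(c := y) \<in> I" using that B rW by (intro upd_I) (auto simp: P_def)
        then show ?thesis using that neq low unfolding P_def by auto
      qed
      have sum: "run (for_below v l (?body \<sigma>)) u (u(c := x + (if \<sigma> then 1 else - 1) * ?fl m n))"
        if P: "P u x" and v: "v = i \<and> n = a \<or> v = j \<and> n = b" for u x v n \<sigma>
      proof -
        have u: "u \<in> I" "u l = 0" "u k = int m" "u v = int n" "n \<le> length w" "\<forall>v<4 * Suc d. u v = 0"
          "u c = x" "\<bar>u c\<bar> \<le> 2 * int (length w)" using P v s(4,5) unfolding P_def by auto
        have v': "v < W" "4 * Suc d \<le> v" "v \<noteq> l" "v \<noteq> k" "v \<noteq> c" using v ij low neq by auto
        show ?thesis
          using run_sum_flow[OF e low(3,2,4) rW(3,2,4) neq(4)[symmetric] neq(6)[symmetric]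
              neq(5)[symmetric] v' u(1-5) m u(6,8)] u(7) by simp
      qed
      have v: "?v \<in> I" using m B rW okB by (intro upd_I s(1)) auto
      have Pu: "P ?u 0" and Pv: "P ?v 0"
        using v St[of m] m s(2,3) z' neq low unfolding P_def St_def by auto
      let ?x = "?fl m b - ?fl m a"
      have x: "\<bar>?x\<bar> \<le> 2 * int (length w)" using fb by linarith
      have Pb: "P (?u(c := ?fl m b)) (?fl m b)" using Pu fb by (intro P_upd) auto
      have Pux: "P (?u(c := ?x)) ?x" using Pu x by (rule P_upd)
      have Pvx: "P (?v(c := ?x)) ?x" using Pv x by (rule P_upd)
      have Pva: "P (?v(c := - ?fl m a)) (- ?fl m a)" using Pv fb by (intro P_upd) auto
      have 1: "run (for_below j l (?body True)) ?u (?u(c := ?fl m b))"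
        using sum[OF Pu, of j b True] by simp
      have 2: "run (for_below i l (?body False)) (?u(c := ?fl m b)) (?u(c := ?x))"
        using sum[OF Pb, of i a False] by simp
      have 3: "run (Cond (\<lambda>V. \<not> origin (V c) \<and> \<not> origin (V r)) (down r) Skip) (?u(c := ?x)) (?v(c := ?x))"
      proof (rule exec_Cond)
        have oc: "origin (view T (?u(c := ?x)) c) \<longleftrightarrow> ?fl m a = ?fl m b"
          using rW by (auto simp: view_def origin_T)
        have or: "origin (view T (?u(c := ?x)) r) \<longleftrightarrow> ok m = 0"
          using rW neq by (simp add: view_def origin_T St_def)
        {
          assume "\<not> origin (view T (?u(c := ?x)) c) \<and> \<not> origin (view T (?u(c := ?x)) r)"
          then have "?fl m a \<noteq> ?fl m b" "ok m = 1" unfolding oc or by (auto simp: ok_def split: if_splits)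
          then have "ok (Suc m) = ok m - 1" by (auto simp: ok_def less_Suc_eq)
          then have "?v(c := ?x) = (?u(c := ?x))(r := (?u(c := ?x)) r - 1)"
            using neq by (auto simp: St_def)
          then show "run (down r) (?u(c := ?x)) (?v(c := ?x))"
            using P_I[OF Pux] P_I[OF Pvx] by (intro exec_down)
        next
          assume "\<not> (\<not> origin (view T (?u(c := ?x)) c) \<and> \<not> origin (view T (?u(c := ?x)) r))"
          then have "?fl m a = ?fl m b \<or> ok m = 0" unfolding oc or by blast
          then have "ok (Suc m) = ok m" by (auto simp: ok_def less_Suc_eq split: if_splits)
          then have "?u(c := ?x) = ?v(c := ?x)" by (simp add: St_def)
          then show "run Skip (?u(c := ?x)) (?v(c := ?x))"
            using exec.Skip[OF P_I[OF Pvx]] by simp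
        }
      qed
      have 4: "run (for_below j l (?body False)) (?v(c := ?x)) (?v(c := - ?fl m a))"
        using sum[OF Pvx, of j b False] by simp
      have "?v c = 0" using Pv by (simp only: P_def)
      then have "?v(c := 0) = ?v" by (metis fun_upd_triv)
      then have 5: "run (for_below i l (?body True)) (?v(c := - ?fl m a)) ?v"
        using sum[OF Pva, of i a True] by simp
      have 6: "run (up k) ?v (St (Suc m))"
        using v St[of "Suc m"] m by (intro exec_up) (auto simp: St_def)
      show ?thesis by (rule exec.Seq[OF 1 exec.Seq[OF 2 exec.Seq[OF 3 exec.Seq[OF 4 exec.Seq[OF 5 6]]]]])
    qed
    let ?L = "length w"
    have 1: "run (up r) s (St 0)"
      using s St[of 0] z' neq by (intro exec_up) (auto simp: St_def ok_def fun_eq_iff)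
    have 2: "run (Loop (\<lambda>V. content (V k) \<noteq> Empty) ?main) (St 0) (St ?L)"
    proof (rule exec_Loop_iterate)
      fix m assume m: "m < ?L"
      have "content (view T (St m) k) \<noteq> Empty"
        using m rW by (simp add: view_def St_def content_T)
      then show "content (view T (St m) k) \<noteq> Empty \<and> run ?main (St m) (St (Suc m))"
        using main[OF m] by blast
    next
      show "St ?L \<in> I" using St by simp
      show "\<not> content (view T (St ?L) k) \<noteq> Empty"
        using rW by (simp add: view_def St_def content_T del: not_not)
    qed
    define Rt where "Rt m = s(r := ok ?L, k := int ?L - int m)" for m
    have Rt: "Rt m \<in> I" if "m \<le> ?L" for m
      unfolding Rt_def using that s B rW okB by (auto intro!: upd_I)
    have 3: "run (Loop (\<lambda>V. \<not> origin (V k)) (down k)) (Rt 0) (Rt ?L)"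
    proof (rule exec_Loop_iterate)
      fix m assume m: "m < ?L"
      have "run (down k) (Rt m) (Rt (Suc m))"
        using m Rt[of m] Rt[of "Suc m"] by (intro exec_down) (auto simp: Rt_def)
      then show "\<not> origin (view T (Rt m) k) \<and> run (down k) (Rt m) (Rt (Suc m))"
        using m rW by (simp add: view_def Rt_def origin_T)
    next
      show "Rt ?L \<in> I" using Rt by simp
      show "\<not> \<not> origin (view T (Rt ?L) k)" using rW by (simp add: view_def Rt_def origin_T)
    qed
    have "St ?L = Rt 0" by (simp add: St_def Rt_def)
    moreover have ok: "ok ?L = (if same (Suc d) w a b then 1 else 0)"
      using same_prefix_Suc[OF w s(4,5), of d] by (simp add: ok_def)
    have "Rt ?L = s(r := ok ?L)"
      using z'(2) neq by (auto simp: Rt_def fun_eq_iff)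
    then have "Rt ?L = s(4 * Suc d := if same (Suc d) w a b then 1 else 0)"
      by (simp only: r_def ok)
    ultimately have "run (Loop (\<lambda>V. \<not> origin (V k)) (down k)) (St ?L)
        (s(4 * Suc d := if same (Suc d) w a b then 1 else 0))"
      using 3 by simp
    then show "run (eqprog (Suc d) i j) s (s(4 * Suc d := if same (Suc d) w a b then 1 else 0))"
      unfolding prog by (rule exec.Seq[OF 1 exec.Seq[OF 2]])
  qed
qed

end

section \<open>Turing machines running a program after a loading phase\<close>

instance letter :: (countable) countable by countable_datatype
instance content :: countable by countable_datatype
instance cell :: countable by countable_datatype

section \<open>Encoded cells, loading and the machine\<close>

type_synonym cell_tape = "int \<times> (int \<Rightarrow> cell)"
type_synonym action = "(content \<Rightarrow> content) \<times> dir"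

abbreviation blank_cell :: cell where "blank_cell \<equiv> Cell False Empty"

text \<open>An untouched square of a tape must already be the code of an empty cell.\<close>

definition enc :: "cell \<Rightarrow> 'l symbol" where
  "enc a = (if a = blank_cell then Blank else Work (to_nat a))"

lemma enc_inject [simp]: "enc a = enc b \<longleftrightarrow> a = b"
  by (auto simp: enc_def)

lemma enc_blank [simp]: "enc blank_cell = Blank"
  by (simp add: enc_def)

definition write_content :: "(content \<Rightarrow> content) \<Rightarrow> cell \<Rightarrow> cell" where
  "write_content f a = Cell (origin a) (f (content a))"

fun load_step :: "action \<Rightarrow> cell_tape \<Rightarrow> cell_tape" where
  "load_step (f, m) (h, t) = (h + dir_offset m, t(h := write_content f (t h)))"

definition load :: "(nat letter \<Rightarrow> action) \<Rightarrow> nat letter list \<Rightarrow> cell_tape" where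
  "load r v = foldl (\<lambda>x l. load_step (r l) x) (0, \<lambda>p. Cell (p = 0) Empty) v"

lemma load_Nil: "load r [] = (0, \<lambda>p. Cell (p = 0) Empty)"
  by (simp add: load_def)

lemma load_snoc: "load r (v @ [l]) = load_step (r l) (load r v)"
  by (simp add: load_def)

datatype pc = Init | Load "nat letter list" | Run com | Final bool

lemma tm_step_fixed: "halted M c \<Longrightarrow> (tm_step M ^^ k) c = c"
  by (induction k) (simp_all add: tm_step_def)

lemma config_after_add: "config_after M w (s + t) = (tm_step M ^^ s) (config_after M w t)"
  by (simp add: config_after_def funpow_add)

lemma halting_run:
  assumes t: "fst (config_after M w t) = (if b then accept M else reject M)"
    and ar: "accept M \<noteq> reject M"
  shows "halts_on M w" "accepts M w \<longleftrightarrow> b" "running_time M w \<le> t"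
proof -
  have h: "halted M (config_after M w t)" using t by (simp add: halted_def split: if_splits)
  show "halts_on M w" unfolding halts_on_def using h by blast
  show "running_time M w \<le> t" unfolding running_time_def using h by (rule Least_le)
  have eq: "config_after M w u = config_after M w s"
    if "halted M (config_after M w s)" "s \<le> u" for s u
    using that tm_step_fixed[OF that(1), of "u - s"] config_after_add[of M w "u - s" s] by simp
  show "accepts M w \<longleftrightarrow> b"
  proof
    assume "accepts M w"
    then obtain s where s: "fst (config_after M w s) = accept M" by (auto simp: accepts_def)
    then have hs: "halted M (config_after M w s)" by (simp add: halted_def)
    have "config_after M w s = config_after M w t"
      using eq[OF h, of s] eq[OF hs, of t] by (cases "s \<le> t") simp_all
    then show b using s t ar by (simp split: if_splits)
  qed (use t in \<open>auto simp: accepts_def\<close>)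
qed

text \<open>The word \<open>\<omega> a\<close> replaces the input letter \<open>a\<close>, and
  \<open>\<rho> j l\<close> is what work tape \<open>j\<close> does on the letter \<open>l\<close>.
  Only this phase writes contents; afterwards \<open>prog\<close> just moves the heads.\<close>

locale loader =
  fixes A :: "'l set" and \<omega> :: "'l \<Rightarrow> nat letter list" and \<Sigma> :: "nat letter set"
    and K :: nat and \<rho> :: "nat \<Rightarrow> nat letter \<Rightarrow> action"
    and prog :: com and fin :: "(nat \<Rightarrow> cell) \<Rightarrow> bool"
  assumes finite_A: "finite A" and finite_\<Sigma>: "finite \<Sigma>"
    and \<omega>: "a \<in> A \<Longrightarrow> \<omega> a \<in> lists \<Sigma>"
    and \<rho>: "l \<in> \<Sigma> \<Longrightarrow> x \<in> {Empty, Mark} \<union> Letter ` \<Sigma> \<Longrightarrow>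
      fst (\<rho> j l) x \<in> {Empty, Mark} \<union> Letter ` \<Sigma>"
begin

definition cells :: "cell set" where
  "cells = (\<lambda>(b, x). Cell b x) ` (UNIV \<times> ({Empty, Mark} \<union> Letter ` \<Sigma>))"

lemma finite_cells: "finite cells"
  unfolding cells_def by (intro finite_imageI finite_cartesian_product) (simp_all add: finite_\<Sigma>)

lemma cells_iff: "a \<in> cells \<longleftrightarrow> content a \<in> {Empty, Mark} \<union> Letter ` \<Sigma>"
  by (cases a) (auto simp: cells_def)

lemma blank_in_cells: "blank_cell \<in> cells"
  by (simp add: cells_iff)

text \<open>The default makes \<open>delta\<close> total and keeps its outputs legal also on symbols
  that code no cell.\<close>

definition dec :: "'l symbol \<Rightarrow> cell" where
  "dec s = (if s \<in> enc ` cells then inv_into UNIV enc s else blank_cell)"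

lemma inj_enc: "inj (enc :: cell \<Rightarrow> 'l symbol)"
  by (simp add: inj_def)

lemma dec_enc: "a \<in> cells \<Longrightarrow> dec (enc a) = a"
  by (simp add: dec_def inv_f_f[OF inj_enc])

lemma dec_in_cells: "dec s \<in> cells"
  using inv_f_f[OF inj_enc] by (auto simp: dec_def blank_in_cells)

definition scan :: "'l symbol list \<Rightarrow> nat \<Rightarrow> cell" where
  "scan ss j = (if j < K then dec (ss ! Suc j) else blank_cell)"

definition keep :: "'l symbol list \<Rightarrow> dir \<Rightarrow> (nat \<Rightarrow> dir) \<Rightarrow> ('l symbol \<times> dir) list" where
  "keep ss d m = (ss ! 0, d) # map (\<lambda>j. (ss ! Suc j, m j)) [0..<K]"

fun delta :: "pc \<Rightarrow> 'l symbol list \<Rightarrow> pc \<times> ('l symbol \<times> dir) list" where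
  "delta Init ss = (Load [], (ss ! 0, Stay) # map (\<lambda>j. (enc (Cell True Empty), Stay)) [0..<K])"
| "delta (Load []) ss =
    (case ss ! 0 of Input a \<Rightarrow> (Load (\<omega> a), keep ss MoveRight (\<lambda>_. Stay))
     | _ \<Rightarrow> (Run prog, keep ss Stay (\<lambda>_. Stay)))"
| "delta (Load (l # ls)) ss =
    (Load ls, (ss ! 0, Stay) #
      map (\<lambda>j. (enc (write_content (fst (\<rho> j l)) (scan ss j)), snd (\<rho> j l))) [0..<K])"
| "delta (Run c) ss =
    (if c = Skip then (Final (fin (scan ss)), keep ss Stay (\<lambda>_. Stay))
     else (Run (fst (step_com c (scan ss))), keep ss Stay (snd (step_com c (scan ss)))))"
| "delta (Final b) ss = (Final b, keep ss Stay (\<lambda>_. Stay))"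

text \<open>The suffixes of the words \<open>\<omega> a\<close>: what may still have to be loaded
  for the current input letter.\<close>

definition rests :: "nat letter list set" where
  "rests = {[]} \<union> (\<Union>a\<in>A. (\<lambda>i. drop i (\<omega> a)) ` {..length (\<omega> a)})"

lemma rests_Cons: "l # ls \<in> rests \<Longrightarrow> l \<in> \<Sigma> \<and> ls \<in> rests"
proof -
  assume "l # ls \<in> rests"
  then obtain a i where a: "a \<in> A" "l # ls = drop i (\<omega> a)" "i \<le> length (\<omega> a)"
    by (auto simp: rests_def)
  have "l \<in> set (\<omega> a)" using in_set_dropD[of l i "\<omega> a"] by (simp add: a(2)[symmetric])
  moreover have "ls = drop (Suc i) (\<omega> a)" using arg_cong[OF a(2), of tl] by (simp add: drop_Suc tl_drop)
  moreover have "Suc i \<le> length (\<omega> a)" using a(2,3) by (cases "i = length (\<omega> a)") auto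
  ultimately show ?thesis using \<omega>[OF a(1)] a(1) unfolding rests_def by blast
qed

lemma rests_\<omega>: "a \<in> A \<Longrightarrow> \<omega> a \<in> rests"
  unfolding rests_def by (intro UnI2 UN_I[of a]) (auto intro: image_eqI[of _ _ 0])

definition pcs :: "pc set" where
  "pcs = {Init, Final True, Final False} \<union> Load ` rests \<union> Run ` residuals prog"

lemma finite_pcs: "finite pcs"
  unfolding pcs_def rests_def using finite_A finite_residuals by auto

text \<open>States of a machine are natural numbers; any injection on the finite set
  \<open>pcs\<close> will do.\<close>

definition code :: "pc \<Rightarrow> nat" where
  "code = (SOME f. inj_on f pcs)"

lemma inj_code: "inj_on code pcs"
proof -
  obtain f :: "pc \<Rightarrow> nat" where "inj_on f pcs" using finite_imp_inj_to_nat_seg[OF finite_pcs] by blast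
  then show ?thesis unfolding code_def by (rule someI[of "\<lambda>f. inj_on f pcs"])
qed

definition machine :: "'l tm" where
  "machine = \<lparr>tapes = Suc K, states = code ` pcs,
    symbols = {Blank} \<union> Input ` A \<union> enc ` cells,
    start = code Init, accept = code (Final True), reject = code (Final False),
    trans_fun = (\<lambda>q ss. case delta (inv_into pcs code q) ss of (p, acts) \<Rightarrow> (code p, acts))\<rparr>"

lemma pcs_simps [simp]: "Init \<in> pcs" "Final b \<in> pcs" "Load [] \<in> pcs" "Run prog \<in> pcs"
  by (cases b) (auto simp: pcs_def rests_def residuals_self)

lemma code_eq: "p \<in> pcs \<Longrightarrow> q \<in> pcs \<Longrightarrow> code p = code q \<longleftrightarrow> p = q"
  using inj_code by (simp add: inj_on_eq_iff)

lemma keep_ok: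
  assumes "ss \<in> lists X" "length ss = Suc K"
  shows "length (keep ss d m) = Suc K \<and> fst ` set (keep ss d m) \<subseteq> X"
  using assms by (auto simp: keep_def in_lists_conv_set)

lemma delta_ok:
  assumes q: "q \<in> pcs" and ss: "ss \<in> lists (symbols machine)" "length ss = Suc K"
  shows "fst (delta q ss) \<in> pcs \<and> length (snd (delta q ss)) = Suc K \<and>
    fst ` set (snd (delta q ss)) \<subseteq> symbols machine"
proof -
  have enc: "enc a \<in> symbols machine" if "a \<in> cells" for a
    using that by (simp add: machine_def)
  have ss0: "ss ! 0 \<in> symbols machine" using ss by (auto simp: in_lists_conv_set)
  show ?thesis
  proof (cases q)
    case Init
    have "Cell True Empty \<in> cells" by (simp add: cells_iff)
    then show ?thesis using Init ss0 enc by auto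
  next
    case (Load v)
    show ?thesis
    proof (cases v)
      case Nil
      have "Load (\<omega> a) \<in> pcs" if "ss ! 0 = Input a" for a
      proof -
        have "a \<in> A" using ss0 that by (auto simp: machine_def enc_def split: if_splits)
        then show ?thesis using rests_\<omega> by (simp add: pcs_def)
      qed
      then show ?thesis using keep_ok[OF ss] Load Nil by (auto split: symbol.split)
    next
      case (Cons l ls)
      then have l: "l \<in> \<Sigma>" "ls \<in> rests" using q Load rests_Cons by (auto simp: pcs_def)
      have "write_content (fst (\<rho> j l)) (scan ss j) \<in> cells" for j
      proof -
        have "scan ss j \<in> cells" by (simp add: scan_def dec_in_cells blank_in_cells)
        then show ?thesis using \<rho>[OF l(1)] unfolding cells_iff write_content_def by simp
      qed
      then show ?thesis using Load Cons l ss0 enc by (auto simp: pcs_def)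
    qed
  next
    case (Run c)
    then have "c \<in> residuals prog" using q by (auto simp: pcs_def)
    then have "Run (fst (step_com c V)) \<in> pcs" for V
      using step_com_residuals by (simp add: pcs_def)
    then show ?thesis using keep_ok[OF ss] Run by auto
  next
    case (Final b)
    then show ?thesis using keep_ok[OF ss] by auto
  qed
qed

lemma machine_wf: "tm_wf A machine"
  unfolding tm_wf_def
proof (intro conjI ballI impI)
  fix q ss assume q: "q \<in> states machine - {accept machine, reject machine}"
    and ss: "ss \<in> lists (symbols machine)" "length ss = tapes machine"
  obtain p where p: "p \<in> pcs" "q = code p" using q by (auto simp: machine_def)
  have "inv_into pcs code q = p" using p inj_code by simp
  then show "case trans_fun machine q ss of (q', acts) \<Rightarrow>
        q' \<in> states machine \<and> length acts = tapes machine \<and> fst ` set acts \<subseteq> symbols machine"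
  proof -
    have tr: "trans_fun machine q ss = (code (fst (delta p ss)), snd (delta p ss))"
      using \<open>inv_into pcs code q = p\<close> by (simp add: machine_def case_prod_beta)
    have "length ss = Suc K" "tapes machine = Suc K" "states machine = code ` pcs"
      using ss(2) by (simp_all add: machine_def)
    then show ?thesis using delta_ok[OF p(1) ss(1)] unfolding tr by simp
  qed
qed (use finite_pcs finite_cells finite_A in \<open>auto simp: machine_def code_eq\<close>)

section \<open>Simulation of loading and running\<close>

definition tape_of :: "cell_tape \<Rightarrow> 'l tape" where
  "tape_of x = (fst x, \<lambda>p. enc (snd x p))"

definition conf :: "pc \<Rightarrow> nat \<Rightarrow> 'l list \<Rightarrow> (nat \<Rightarrow> cell_tape) \<Rightarrow> 'l config" where
  "conf q i w x = (code q, (int i, snd (input_tape w)) # map (\<lambda>j. tape_of (x j)) [0..<K])"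

definition symbols_at :: "nat \<Rightarrow> 'l list \<Rightarrow> (nat \<Rightarrow> cell_tape) \<Rightarrow> 'l symbol list" where
  "symbols_at i w x = snd (input_tape w) (int i) # map (\<lambda>j. enc (snd (x j) (fst (x j)))) [0..<K]"

text \<open>The form common to all nonhalting transitions: the input tape is left as it is, and work
  tape \<open>j\<close> writes \<open>a j\<close> and moves by \<open>m j\<close>.\<close>

lemma step_conf:
  assumes q: "q \<in> pcs" "\<And>b. q \<noteq> Final b"
    and d: "delta q (symbols_at i w x) =
      (q', (snd (input_tape w) (int i), m0) # map (\<lambda>j. (enc (a j), m j)) [0..<K])"
    and m0: "int i' = int i + dir_offset m0"
  shows "tm_step machine (conf q i w x) = conf q' i' w
    (\<lambda>j. (fst (x j) + dir_offset (m j), (snd (x j))(fst (x j) := a j)))"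
proof -
  have "\<not> halted machine (conf q i w x)"
    using q by (simp add: halted_def conf_def machine_def code_eq)
  moreover have "map (\<lambda>(h, t). t h) (snd (conf q i w x)) = symbols_at i w x"
    by (simp add: conf_def symbols_at_def tape_of_def)
  moreover have "inv_into pcs code (code q) = q" using q inj_code by simp
  ultimately have "tm_step machine (conf q i w x) = (code q',
      map2 act ((int i, snd (input_tape w)) # map (\<lambda>j. tape_of (x j)) [0..<K])
        ((snd (input_tape w) (int i), m0) # map (\<lambda>j. (enc (a j), m j)) [0..<K]))"
    using d by (simp add: tm_step_def conf_def machine_def)
  also have "\<dots> = conf q' i' w (\<lambda>j. (fst (x j) + dir_offset (m j), (snd (x j))(fst (x j) := a j)))"
    using m0 by (simp add: conf_def map2_map_map tape_of_def fun_eq_iff)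
  finally show ?thesis .
qed

definition in_cells :: "(nat \<Rightarrow> cell_tape) \<Rightarrow> bool" where
  "in_cells x \<longleftrightarrow> (\<forall>j p. snd (x j) p \<in> cells)"

lemma scan_symbols_at:
  assumes "in_cells x" "j < K" shows "scan (symbols_at i w x) j = snd (x j) (fst (x j))"
  using assms by (simp add: scan_def symbols_at_def dec_enc in_cells_def)

lemma keep_symbols_at:
  "keep (symbols_at i w x) d m = (snd (input_tape w) (int i), d) #
    map (\<lambda>j. (enc (snd (x j) (fst (x j))), m j)) [0..<K]"
  by (simp add: keep_def symbols_at_def)

definition loaded :: "nat letter list \<Rightarrow> nat \<Rightarrow> cell_tape" where
  "loaded v j = load (\<rho> j) v"

lemma in_cells_loaded: "v \<in> lists \<Sigma> \<Longrightarrow> in_cells (loaded v)"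
proof (induction v rule: rev_induct)
  case Nil
  then show ?case by (simp add: in_cells_def loaded_def load_Nil cells_iff)
next
  case (snoc l v)
  then have l: "l \<in> \<Sigma>" and IH: "in_cells (loaded v)" by simp_all
  show ?case unfolding in_cells_def
  proof (intro allI)
    fix j p
    obtain f m where r: "\<rho> j l = (f, m)" by (cases "\<rho> j l")
    obtain h t where x: "load (\<rho> j) v = (h, t)" by (cases "load (\<rho> j) v")
    have t: "t q \<in> cells" for q using IH x by (auto simp: in_cells_def loaded_def dest: spec[of _ j])
    have "write_content f (t h) \<in> cells"
      using \<rho>[OF l, of "content (t h)" j] t[of h] r unfolding cells_iff write_content_def by simp
    then show "snd (loaded (v @ [l]) j) p \<in> cells"
      using t by (simp add: loaded_def load_snoc r x)
  qed
qed

lemma step_Load_letter: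
  assumes "l # ls \<in> rests" "v \<in> lists \<Sigma>"
  shows "tm_step machine (conf (Load (l # ls)) i w (loaded v)) = conf (Load ls) i w (loaded (v @ [l]))"
proof -
  have "(\<lambda>j. (fst (loaded v j) + dir_offset (snd (\<rho> j l)), (snd (loaded v j))
      (fst (loaded v j) := write_content (fst (\<rho> j l)) (snd (loaded v j) (fst (loaded v j))))))
    = loaded (v @ [l])"
  proof
    fix j
    show "(fst (loaded v j) + dir_offset (snd (\<rho> j l)), (snd (loaded v j))
      (fst (loaded v j) := write_content (fst (\<rho> j l)) (snd (loaded v j) (fst (loaded v j)))))
      = loaded (v @ [l]) j"
      by (cases "\<rho> j l"; cases "load (\<rho> j) v") (simp add: loaded_def load_snoc)
  qed
  moreover have "Load (l # ls) \<in> pcs" using assms by (simp add: pcs_def)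
  ultimately show ?thesis
    using step_conf[of "Load (l # ls)" i w "loaded v" "Load ls" Stay
        "\<lambda>j. write_content (fst (\<rho> j l)) (snd (loaded v j) (fst (loaded v j)))"
        "\<lambda>j. snd (\<rho> j l)" i]
    by (simp add: scan_symbols_at in_cells_loaded[OF assms(2)]) (simp add: symbols_at_def)
qed

lemma steps_Load:
  assumes "ls \<in> rests" "v \<in> lists \<Sigma>"
  shows "(tm_step machine ^^ length ls) (conf (Load ls) i w (loaded v)) = conf (Load []) i w (loaded (v @ ls))"
  using assms
proof (induction ls arbitrary: v)
  case (Cons l ls)
  then have l: "l \<in> \<Sigma>" "ls \<in> rests" using rests_Cons by blast+
  then show ?case
    using Cons.IH[of "v @ [l]"] Cons.prems step_Load_letter[of l ls v i w]
    by (simp add: funpow_swap1 del: funpow.simps(2)) (simp add: funpow_Suc_right del: funpow.simps(2))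
qed simp

lemma step_Load_Nil:
  assumes "i < length w"
  shows "tm_step machine (conf (Load []) i w x) = conf (Load (\<omega> (w ! i))) (Suc i) w x"
proof -
  have "snd (input_tape w) (int i) = Input (w ! i)" using assms by (simp add: input_tape_def)
  then show ?thesis
    using step_conf[of "Load []" i w x "Load (\<omega> (w ! i))" MoveRight
        "\<lambda>j. snd (x j) (fst (x j))" "\<lambda>_. Stay" "Suc i"] keep_symbols_at[of i w x MoveRight "\<lambda>_. Stay"]
    by (simp add: symbols_at_def)
qed

lemma step_Load_end: "tm_step machine (conf (Load []) (length w) w x) = conf (Run prog) (length w) w x"
proof -
  have "snd (input_tape w) (int (length w)) = Blank" by (simp add: input_tape_def)
  then show ?thesis
    using step_conf[of "Load []" "length w" w x "Run prog" Stay
        "\<lambda>j. snd (x j) (fst (x j))" "\<lambda>_. Stay" "length w"]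
      keep_symbols_at[of "length w" w x Stay "\<lambda>_. Stay"]
    by (simp add: symbols_at_def)
qed

lemma step_Init: "tm_step machine (init_config machine w) = conf (Load []) 0 w (loaded [])"
proof -
  let ?x = "\<lambda>_::nat. (0, \<lambda>_. blank_cell) :: cell_tape"
  have "input_tape [] = tape_of (0, \<lambda>_. blank_cell)"
    by (auto simp: input_tape_def tape_of_def fun_eq_iff)
  then have "init_config machine w = conf Init 0 w ?x"
    by (simp add: init_config_def conf_def machine_def map_replicate_const input_tape_def)
  moreover have "(\<lambda>j. (fst (?x j) + dir_offset Stay, (snd (?x j))(fst (?x j) := Cell True Empty))) = loaded []"
    by (auto simp: loaded_def load_Nil fun_eq_iff)
  ultimately show ?thesis
    using step_conf[of Init 0 w ?x "Load []" Stay "\<lambda>_. Cell True Empty" "\<lambda>_. Stay" 0]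
    by (simp add: symbols_at_def)
qed

definition expand :: "'l list \<Rightarrow> nat letter list" where
  "expand w = concat (map \<omega> w)"

lemma expand_in: "w \<in> lists A \<Longrightarrow> expand w \<in> lists \<Sigma>"
  using \<omega> by (induction w) (auto simp: expand_def)

lemma load_phase:
  assumes "w \<in> lists A" "i \<le> length w"
  shows "config_after machine w (1 + i + length (expand (take i w))) =
    conf (Load []) i w (loaded (expand (take i w)))"
  using assms(2)
proof (induction i)
  case 0
  then show ?case using step_Init by (simp add: config_after_def expand_def)
next
  case (Suc i)
  let ?v = "expand (take i w)" and ?a = "w ! i"
  have t: "expand (take (Suc i) w) = ?v @ \<omega> ?a"
    using Suc by (simp add: expand_def take_Suc_conv_app_nth)
  have a: "?a \<in> A" using assms Suc by (auto simp: in_lists_conv_set)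
  have v: "?v \<in> lists \<Sigma>" using assms by (intro expand_in) (auto dest: in_set_takeD)
  have "1 + Suc i + length (expand (take (Suc i) w)) = length (\<omega> ?a) + (1 + (1 + i + length ?v))"
    by (simp add: t)
  then have "config_after machine w (1 + Suc i + length (expand (take (Suc i) w))) =
      (tm_step machine ^^ length (\<omega> ?a)) (tm_step machine (conf (Load []) i w (loaded ?v)))"
    using Suc by (simp only: config_after_add) simp
  also have "\<dots> = conf (Load []) (Suc i) w (loaded (?v @ \<omega> ?a))"
    using Suc steps_Load[OF rests_\<omega>[OF a] v] by (simp add: step_Load_Nil)
  finally show ?case by (simp add: t)
qed

text \<open>The values beyond the \<open>K\<close> work tapes match the convention of
  \<open>box\<close>.\<close>

definition heads :: "nat letter list \<Rightarrow> nat \<Rightarrow> int" where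
  "heads v j = (if j < K then fst (loaded v j) else 0)"

definition contents :: "nat letter list \<Rightarrow> nat \<Rightarrow> int \<Rightarrow> cell" where
  "contents v j = (if j < K then snd (loaded v j) else (\<lambda>_. blank_cell))"

lemma conf_cong: "(\<And>j. j < K \<Longrightarrow> x j = y j) \<Longrightarrow> conf q i w x = conf q i w y"
  by (simp add: conf_def)

abbreviation placed :: "nat letter list \<Rightarrow> (nat \<Rightarrow> int) \<Rightarrow> nat \<Rightarrow> cell_tape" where
  "placed v s \<equiv> \<lambda>j. (s j, contents v j)"

lemma scan_view:
  assumes "v \<in> lists \<Sigma>"
  shows "scan (symbols_at i w (placed v s)) = view (contents v) s"
proof
  fix j
  have "contents v k p \<in> cells" for k p
    using in_cells_loaded[OF assms] by (simp add: contents_def in_cells_def blank_in_cells)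
  then have "in_cells (placed v s)" by (simp add: in_cells_def)
  then show "scan (symbols_at i w (placed v s)) j = view (contents v) s j"
    using scan_symbols_at[of "\<lambda>j. (s j, contents v j)" j i w]
    by (cases "j < K") (simp_all add: view_def scan_def contents_def)
qed

lemma step_Run:
  assumes v: "v \<in> lists \<Sigma>" and c: "c \<in> residuals prog" "c \<noteq> Skip"
  shows "tm_step machine (conf (Run c) i w (placed v s)) =
    (case step (contents v) (c, s) of (c', s') \<Rightarrow> conf (Run c') i w (placed v s'))"
proof -
  let ?x = "\<lambda>j. (s j, contents v j)" and ?V = "view (contents v) s"
  have "Run c \<in> pcs" using c by (simp add: pcs_def)
  then have "tm_step machine (conf (Run c) i w ?x) = conf (Run (fst (step_com c ?V))) i w
      (\<lambda>j. (fst (?x j) + dir_offset (snd (step_com c ?V) j), (snd (?x j))(fst (?x j) := contents v j (s j))))"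
    using c keep_symbols_at[of i w ?x]
    by (intro step_conf[where ?m0.0 = Stay]) (simp_all add: scan_view[OF v])
  then show ?thesis by (simp add: step_def shift_def split: prod.split)
qed

text \<open>The inequality is needed because \<open>step\<close> idles at \<open>Skip\<close>, where
  the machine goes on to a final state.\<close>

lemma steps_Run:
  assumes v: "v \<in> lists \<Sigma>"
  shows "c \<in> residuals prog \<Longrightarrow> (step (contents v) ^^ n) (c, s) = (Skip, t) \<Longrightarrow>
    \<exists>k\<le>n. (tm_step machine ^^ k) (conf (Run c) i w (placed v s))
      = conf (Run Skip) i w (placed v t)"
proof (induction n arbitrary: c s)
  case 0
  then show ?case by (intro exI[of _ 0]) simp
next
  case (Suc n)
  show ?case
  proof (cases "c = Skip")
    case True
    then have idle: "step (contents v) (c, s) = (c, s)" by (simp add: step_def)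
    have "(step (contents v) ^^ m) (c, s) = (c, s)" for m
      by (induction m) (simp_all add: idle)
    from this[of "Suc n"] have "(step (contents v) ^^ Suc n) (c, s) = (c, s)" .
    then show ?thesis using Suc.prems True by (intro exI[of _ 0]) simp
  next
    case False
    obtain c' s' where s': "step (contents v) (c, s) = (c', s')" by (cases "step (contents v) (c, s)")
    have "c' = fst (step_com c (view (contents v) s))"
      using s' by (simp add: step_def split: prod.splits)
    then have c': "c' \<in> residuals prog" using step_com_residuals Suc.prems(1) by simp
    have "(step (contents v) ^^ n) (c', s') = (Skip, t)"
      using Suc.prems(2) s' by (simp add: funpow_swap1)
    then obtain k where k: "k \<le> n" "(tm_step machine ^^ k) (conf (Run c') i w (placed v s'))
      = conf (Run Skip) i w (placed v t)" using Suc.IH c' by blast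
    have "(tm_step machine ^^ Suc k) (conf (Run c) i w (placed v s))
      = conf (Run Skip) i w (placed v t)"
      using k step_Run[OF v Suc.prems(1) False] s' by (simp add: funpow_swap1)
    then show ?thesis using k(1) by (intro exI[of _ "Suc k"]) simp
  qed
qed

theorem machine_correct:
  assumes w: "w \<in> lists A" and "finite I"
    and ex: "exec I (contents (expand w)) prog (heads (expand w)) t"
  shows "halts_on machine w \<and>
    (accepts machine w \<longleftrightarrow> fin (view (contents (expand w)) t)) \<and>
    running_time machine w \<le> length w + length (expand w) + card (residuals prog) * card I + 3"
proof -
  let ?v = "expand w"
  have v: "?v \<in> lists \<Sigma>" using w by (rule expand_in)
  obtain n where n: "n \<le> card (residuals prog) * card I"
    "(step (contents ?v) ^^ n) (prog, heads ?v) = (Skip, t)"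
    using exec_time[OF ex \<open>finite I\<close>] by blast
  have 1: "config_after machine w (1 + length w + length ?v) = conf (Load []) (length w) w (loaded ?v)"
    using load_phase[OF w, of "length w"] by simp
  have 2: "conf (Run prog) (length w) w (loaded ?v) =
      conf (Run prog) (length w) w (placed ?v (heads ?v))"
    by (rule conf_cong) (simp add: heads_def contents_def)
  obtain k where k: "k \<le> n"
    "(tm_step machine ^^ k) (conf (Run prog) (length w) w (placed ?v (heads ?v)))
      = conf (Run Skip) (length w) w (placed ?v t)"
    using steps_Run[OF v residuals_self n(2)] by blast
  \<comment> \<open>The three extra steps are initialization, the end of the input and the final
    test.\<close>
  let ?b = "fin (view (contents ?v) t)" and ?t = "1 + (k + (1 + (1 + length w + length ?v)))"
  have "Run Skip \<in> pcs" using Skip_residuals by (simp add: pcs_def)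
  then have "tm_step machine (conf (Run Skip) (length w) w (placed ?v t)) =
      conf (Final ?b) (length w) w (\<lambda>j. (fst (t j, contents ?v j) + dir_offset Stay,
        (snd (t j, contents ?v j))(fst (t j, contents ?v j) := contents ?v j (t j))))"
    using keep_symbols_at[of "length w" w "\<lambda>j. (t j, contents ?v j)"]
    by (intro step_conf[where ?m0.0 = Stay]) (simp_all add: scan_view[OF v])
  then have 3: "fst (tm_step machine (conf (Run Skip) (length w) w (placed ?v t))) =
      code (Final ?b)" by (simp add: conf_def)
  have "config_after machine w ?t = tm_step machine ((tm_step machine ^^ k)
      (tm_step machine (config_after machine w (1 + length w + length ?v))))"
    by (simp only: config_after_add) simp
  then have "fst (config_after machine w ?t) = code (Final ?b)"
    by (simp only: 1 step_Load_end 2 k(2) 3)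
  then have "fst (config_after machine w ?t) = (if ?b then accept machine else reject machine)"
    by (simp add: machine_def)
  from halting_run[OF this] show ?thesis
    using k(1) n(1) by (auto simp: machine_def code_eq)
qed

end

section \<open>The lamplighter group\<close>

text \<open>A lamplighter position with a lamp configuration. This is the unrestricted wreath
  product of Z/2 by Z; that values of words have only finitely many lit lamps follows from
  \<open>lit_lamp_value\<close>.\<close>

datatype lamp = Lamp (pos: int) (lit: "int \<Rightarrow> bool")

instantiation lamp :: group_add
begin

definition "0 = Lamp 0 (\<lambda>_. False)"
definition "x + y = Lamp (pos x + pos y) (\<lambda>i. lit x i \<noteq> lit y (i - pos x))"
definition "- x = Lamp (- pos x) (\<lambda>i. lit x (i + pos x))"
definition "x - y = x + - (y :: lamp)"

instance
  by standard (auto simp: zero_lamp_def plus_lamp_def uminus_lamp_def minus_lamp_def fun_eq_iff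
      algebra_simps)

end

lemma lamp_simps [simp]:
  "pos 0 = 0" "lit 0 i = False" "pos (x + y) = pos x + pos y"
  "lit (x + y) i \<longleftrightarrow> lit x i \<noteq> lit y (i - pos x)"
  by (simp_all add: zero_lamp_def plus_lamp_def)

lemma lamp_eq_0_iff: "x = 0 \<longleftrightarrow> pos x = 0 \<and> (\<forall>i. \<not> lit x i)"
  by (cases x) (auto simp: zero_lamp_def)

text \<open>Generator 0 moves the lamplighter, generator 1 switches the lamp at the current
  position, and all others act trivially. Switching is its own inverse.\<close>

fun lamp_step :: "nat letter \<Rightarrow> lamp" where
  "lamp_step (Gen x) = Lamp (if x = 0 then 1 else 0) (\<lambda>i. x = 1 \<and> i = 0)"
| "lamp_step (InvGen x) = Lamp (if x = 0 then - 1 else 0) (\<lambda>i. x = 1 \<and> i = 0)"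

lemma lamp_step_inv: "lamp_step (inv_letter l) = - lamp_step l"
  by (cases l) (auto simp: uminus_lamp_def)

abbreviation lamp_value :: "nat letter list \<Rightarrow> lamp" where
  "lamp_value v \<equiv> sum_list (map lamp_step v)"

section \<open>Homomorphisms vanishing on derived terms\<close>

lemma sum_list_inv_word:
  fixes f :: "'b letter \<Rightarrow> 'c::group_add"
  assumes "\<And>l. f (inv_letter l) = - f l"
  shows "sum_list (map f (inv_word u)) = - sum_list (map f u)"
  by (induction u) (simp_all add: assms minus_add)

lemma sum_list_free_cong:
  fixes f :: "'b letter \<Rightarrow> 'c::group_add"
  assumes "(u, v) \<in> free_cong S" and f: "\<And>l. f (inv_letter l) = - f l"
  shows "sum_list (map f u) = sum_list (map f v)"
  using assms(1) by (induction rule: free_cong.induct) (simp_all add: f add.assoc[symmetric])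

text \<open>A homomorphism that is commutative on the image of \<open>H\<close> kills the
  commutators of \<open>H\<close>. It is given by its values on letters, so elements are handled
  through words.\<close>

lemma sum_list_derived:
  fixes f :: "'b letter \<Rightarrow> 'c::group_add"
  assumes f: "\<And>l. f (inv_letter l) = - f l" and H: "H \<subseteq> carrier (free_group S)"
    and comm: "\<And>u v. u \<in> words S \<Longrightarrow> v \<in> words S \<Longrightarrow> cls S u \<in> H \<Longrightarrow> cls S v \<in> H \<Longrightarrow>
      sum_list (map f u) + sum_list (map f v) = sum_list (map f v) + sum_list (map f u)"
    and w: "w \<in> words S" "cls S w \<in> derived (free_group S) H"
  shows "sum_list (map f w) = 0"
proof -
  let ?F = "free_group S"
  have com: "\<exists>u\<in>words S. x = cls S u \<and> sum_list (map f u) = 0" if x: "x \<in> derived_set ?F H" for x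
  proof -
    obtain g h where gh: "g \<in> H" "h \<in> H"
      and x: "x = g \<otimes>\<^bsub>?F\<^esub> h \<otimes>\<^bsub>?F\<^esub> inv\<^bsub>?F\<^esub> g \<otimes>\<^bsub>?F\<^esub> inv\<^bsub>?F\<^esub> h"
      using x by blast
    have "g \<in> carrier ?F" "h \<in> carrier ?F" using gh H by auto
    then obtain a b where ab: "a \<in> words S" "g = cls S a" "b \<in> words S" "h = cls S b"
      by (elim carrier_free_group_E)
    have "x = cls S (((a @ b) @ inv_word a) @ inv_word b)"
      using ab by (simp only: x cls_append words_append inv_word_in_words cls_inv_word simp_thms)
    moreover have "sum_list (map f (((a @ b) @ inv_word a) @ inv_word b)) = 0"
    proof -
      let ?x = "sum_list (map f a)" and ?y = "sum_list (map f b)"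
      have "?x + ?y = ?y + ?x" using comm ab gh by simp
      then have "?x + ?y + - ?x + - ?y = ?y + ?x + - ?x + - ?y" by (rule arg_cong)
      also have "\<dots> = 0" by (simp add: add.assoc)
      finally show ?thesis by (simp only: map_append sum_list_append sum_list_inv_word[of f, OF f])
    qed
    ultimately show ?thesis using ab
      by (intro bexI[of _ "((a @ b) @ inv_word a) @ inv_word b"]) simp_all
  qed
  have "\<exists>u\<in>words S. cls S w = cls S u \<and> sum_list (map f u) = 0"
    using w(2) unfolding derived_def
  proof (induction rule: generate.induct)
    case one
    then show ?case by (intro bexI[of _ "[]"]) (auto simp: cls_Nil)
  next
    case (incl x)
    then show ?case by (rule com)
  next
    case (inv x)
    then obtain u where u: "u \<in> words S" "x = cls S u" "sum_list (map f u) = 0"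
      using com by blast
    then show ?case
      using sum_list_inv_word[of f u, OF f]
      by (intro bexI[of _ "inv_word u"]) (simp_all add: cls_inv_word del: in_lists_conv_set)
  next
    case (eng x y)
    then obtain u v where "u \<in> words S" "x = cls S u" "sum_list (map f u) = 0"
      "v \<in> words S" "y = cls S v" "sum_list (map f v) = 0" by blast
    then show ?case
      by (intro bexI[of _ "u @ v"]) (simp_all add: cls_append del: in_lists_conv_set)
  qed
  then obtain u where u: "u \<in> words S" "cls S w = cls S u" "sum_list (map f u) = 0" by blast
  then have "(w, u) \<in> free_cong S" using w(1) cls_eq_iff by blast
  then show ?thesis using sum_list_free_cong[of w u S f, OF _ f] u(3) by simp
qed

lemma derived_term_subset: "derived_term (free_group S) d \<subseteq> carrier (free_group S)"
  using normal_imp_subgroup[OF derived_term_normal[OF group_free_group]] subgroup.subset by blast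

lemma sum_list_derived_term_1:
  fixes f :: "'b letter \<Rightarrow> 'c::ab_group_add"
  assumes "\<And>l. f (inv_letter l) = - f l" "w \<in> words S" "cls S w \<in> derived_term (free_group S) d" "d \<ge> 1"
  shows "sum_list (map f w) = 0"
proof -
  obtain e where "d = Suc e" using assms(4) by (cases d) auto
  then have "cls S w \<in> derived (free_group S) (derived_term (free_group S) e)"
    using assms(3) by (simp add: derived_term_def)
  from sum_list_derived[of f, OF assms(1) derived_term_subset _ assms(2) this] show ?thesis
    by (simp add: add.commute)
qed

lemma pos_sum_list: "pos (sum_list xs) = sum_list (map pos xs)"
  by (induction xs) simp_all

text \<open>The lamplighter group is metabelian: from the first derived term on the position is 0,
  and configurations without displacement commute.\<close>

lemma lamp_value_derived_term:
  assumes w: "w \<in> words S" "cls S w \<in> derived_term (free_group S) d" "d \<ge> 2"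
  shows "lamp_value w = 0"
proof -
  obtain e where e: "d = Suc e" "e \<ge> 1" using w(3) by (cases d) auto
  have pos0: "pos (lamp_value u) = 0"
    if u: "u \<in> words S" "cls S u \<in> derived_term (free_group S) e" for u
    using sum_list_derived_term_1[of "\<lambda>l. pos (lamp_step l)", OF _ u e(2)]
    by (simp add: pos_sum_list lamp_step_inv uminus_lamp_def o_def)
  have "cls S w \<in> derived (free_group S) (derived_term (free_group S) e)"
    using w(2) e by (simp add: derived_term_def)
  then show ?thesis
  proof (rule sum_list_derived[of lamp_step, OF lamp_step_inv derived_term_subset _ w(1), rotated])
    fix u v assume "u \<in> words S" "v \<in> words S" "cls S u \<in> derived_term (free_group S) e"
      "cls S v \<in> derived_term (free_group S) e"
    then have "pos (lamp_value u) = 0" "pos (lamp_value v) = 0" using pos0 by blast+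
    then show "lamp_value u + lamp_value v = lamp_value v + lamp_value u"
      by (auto simp: plus_lamp_def fun_eq_iff)
  qed
qed

section \<open>Return to the identity in the lamplighter group\<close>

text \<open>Advance by two cells, lighting both or neither. Two cells per bit allow words for both
  bits of equal, even length; see \<open>U\<close> in \<open>lamplighter_return\<close>.\<close>

definition block :: "bool \<Rightarrow> lamp" where
  "block b = Lamp 2 (\<lambda>i. b \<and> (i = 0 \<or> i = 1))"

lemma lit_blocks_neg: "i < 0 \<Longrightarrow> \<not> lit (sum_list (map block bs)) i"
  by (induction bs arbitrary: i) (auto simp: block_def)

text \<open>The lamp at 0 shows the first bit, since later blocks switch only lamps from position 2
  on.\<close>

lemma blocks_inj: "length bs = length cs \<Longrightarrow>
    sum_list (map block bs) = sum_list (map block cs) \<Longrightarrow> bs = cs"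
proof (induction bs cs rule: list_induct2)
  case (Cons b bs c cs)
  have "lit (block b + sum_list (map block bs)) 0 \<longleftrightarrow> b" for b bs
    using lit_blocks_neg[of "-2" bs] by (simp add: block_def)
  then have "b = c" using Cons.prems by (metis list.simps(9) sum_list.Cons)
  then show ?case using Cons by simp
qed simp

section \<open>Decay faster than every power\<close>

lemma power_le_exp: "x \<ge> 0 \<Longrightarrow> x ^ M \<le> real M ^ M * exp (x::real)"
proof (cases "M = 0")
  case False
  assume "x \<ge> 0"
  have "x / M \<le> exp (x / M)" using exp_ge_add_one_self[of "x / M"] by linarith
  then have "(x / M) ^ M \<le> exp (x / M) ^ M" using \<open>x \<ge> 0\<close> by (intro power_mono) auto
  also have "\<dots> = exp x" using False by (simp add: exp_of_nat_mult[symmetric])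
  finally show ?thesis using False by (simp add: power_divide field_simps)
qed simp

lemma power_times_exp_bounded:
  assumes "c > 0"
  shows "real (k + 1) ^ M * exp (- c * real k) \<le> (real M / c) ^ M * exp c"
proof -
  have "(c * real (k + 1)) ^ M \<le> real M ^ M * exp (c * real (k + 1))"
    using assms by (intro power_le_exp) simp
  then have "real (k + 1) ^ M * c ^ M \<le> real M ^ M * exp (c * real (k + 1))"
    by (simp only: power_mult_distrib mult.commute)
  then have "real (k + 1) ^ M \<le> real M ^ M * exp (c * real (k + 1)) / c ^ M"
    using assms by (simp only: pos_le_divide_eq zero_less_power)
  then have "real (k + 1) ^ M \<le> (real M / c) ^ M * exp (c * real (k + 1))"
    by (simp only: power_divide times_divide_eq_left)
  then have "real (k + 1) ^ M * exp (- c * real k) \<le>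
      (real M / c) ^ M * exp (c * real (k + 1)) * exp (- c * real k)"
    by (intro mult_right_mono) simp_all
  also have "\<dots> = (real M / c) ^ M * exp c"
    by (simp add: mult.assoc exp_add[symmetric] algebra_simps)
  finally show ?thesis .
qed

text \<open>With \<open>k\<close> about the cube root of \<open>n\<close>, both terms decay like \<open>exp (- c n\<^bsup>1/3\<^esup>)\<close>.\<close>

lemma cube_root_tradeoff:
  fixes Q :: real
  assumes Q: "Q \<ge> 1"
  shows "\<exists>C. \<forall>n. \<exists>k\<ge>1. real (n + 1) ^ E * (1 / 2 ^ k + (1 - 1 / (real k ^ 2 * Q)) ^ (n div 2)) \<le> C"
proof -
  define c1 where "c1 = ln (2::real)"
  define c2 where "c2 = 1 / (2 * Q)"
  have c: "c1 > 0" "c2 > 0" using Q by (simp_all add: c1_def c2_def)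
  \<comment> \<open>\<open>n + 1\<close> is below the cube of \<open>k + 1\<close>, so its power
    \<open>E\<close> costs the power \<open>3 * E\<close> of \<open>k + 1\<close>.\<close>
  define M where "M = 3 * E"
  let ?b = "\<lambda>c. (real M / c) ^ M * exp c"
  have "\<exists>k\<ge>1. real (n + 1) ^ E * (1 / 2 ^ k + (1 - 1 / (real k ^ 2 * Q)) ^ (n div 2))
      \<le> ?b c1 + exp 1 * ?b c2" for n
  proof -
    define k where "k = (GREATEST k. k ^ 3 \<le> n + 1)"
    have le: "k \<le> k ^ 3" for k :: nat using self_le_power[of k 3] by (cases "k = 0") simp_all
    have bnd: "\<And>y. y ^ 3 \<le> n + 1 \<Longrightarrow> y \<le> n + 1" using le order_trans by blast
    have k1: "1 \<le> k" unfolding k_def by (rule Greatest_le_nat[OF _ bnd]) simp_all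
    have k3: "k ^ 3 \<le> n + 1"
      unfolding k_def by (rule GreatestI_nat[where P = "\<lambda>k. k ^ 3 \<le> n + 1", of 1 "n + 1", OF _ bnd]) simp_all
    have kS: "n + 1 < (k + 1) ^ 3"
    proof (rule ccontr)
      assume "\<not> n + 1 < (k + 1) ^ 3"
      then have "k + 1 \<le> (GREATEST k. k ^ 3 \<le> n + 1)" by (intro Greatest_le_nat[OF _ bnd]) simp
      then show False by (simp add: k_def)
    qed
    have "real (n + 1) \<le> real ((k + 1) ^ 3)" using kS by (simp only: of_nat_le_iff)
    then have "real (n + 1) ^ E \<le> real ((k + 1) ^ 3) ^ E" by (rule power_mono) (rule of_nat_0_le_iff)
    then have nE: "real (n + 1) ^ E \<le> real (k + 1) ^ M" by (simp only: M_def power_mult of_nat_power)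
    let ?K = "real k ^ 2 * Q"
    have K: "?K \<ge> 1" using Q k1 by (simp add: one_le_power mult_ge1_I)
    have "(1 - 1 / ?K) ^ (n div 2) \<le> exp (- 1 / ?K) ^ (n div 2)"
      using K exp_ge_add_one_self[of "- 1 / ?K"] by (intro power_mono) (simp_all add: field_simps)
    also have "\<dots> = exp (- real (n div 2) / ?K)" by (simp add: exp_of_nat_mult[symmetric])
    \<comment> \<open>The summand 1 pays for the rounding in \<open>n div 2\<close> and for
      \<open>k ^ 3\<close> being bounded by \<open>n + 1\<close> rather than
      \<open>n\<close>.\<close>
    also have "\<dots> \<le> exp (1 - c2 * real k)"
    proof -
      have "real k ^ 3 \<le> real n + 1" using k3 by (metis of_nat_1 of_nat_add of_nat_le_iff of_nat_power)
      moreover have "real n \<le> 2 * real (n div 2) + 1" by linarith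
      ultimately have "real k ^ 3 \<le> 2 * real (n div 2) + 2" by linarith
      then have "real k ^ 3 / (2 * ?K) \<le> (2 * real (n div 2) + 2) / (2 * ?K)"
        using K by (intro divide_right_mono) simp_all
      also have "\<dots> = real (n div 2) / ?K + 1 / ?K" by (simp add: add_divide_distrib)
      also have "\<dots> \<le> real (n div 2) / ?K + 1" using K by (simp add: field_simps)
      finally have "real k ^ 3 / (2 * ?K) - 1 \<le> real (n div 2) / ?K" by simp
      moreover have "real k ^ 3 / (2 * ?K) = c2 * real k"
        using k1 by (simp add: c2_def power2_eq_square power3_eq_cube)
      ultimately show ?thesis by simp
    qed
    finally have 2: "(1 - 1 / ?K) ^ (n div 2) \<le> exp 1 * exp (- c2 * real k)"
      by (simp add: exp_add[symmetric])
    have 1: "1 / 2 ^ k = exp (- c1 * real k)"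
      by (simp add: c1_def exp_minus exp_of_nat_mult divide_inverse mult.commute[of "ln 2"])
    have nn: "0 \<le> (1 - 1 / ?K) ^ (n div 2)" using K by simp
    have "real (n + 1) ^ E * (1 / 2 ^ k + (1 - 1 / ?K) ^ (n div 2))
        \<le> real (k + 1) ^ M * (exp (- c1 * real k) + exp 1 * exp (- c2 * real k))"
      using nE 1 2 nn by (intro mult_mono add_mono) simp_all
    also have "\<dots> = real (k + 1) ^ M * exp (- c1 * real k) + exp 1 * (real (k + 1) ^ M * exp (- c2 * real k))"
      by (simp add: algebra_simps)
    also have "\<dots> \<le> ?b c1 + exp 1 * ?b c2"
      by (intro add_mono mult_left_mono power_times_exp_bounded c) simp
    finally show ?thesis using k1 by blast
  qed
  then show ?thesis by blast
qed

lemma (in symmetric_walk) sum_list_pad: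
  assumes "l \<in> L" shows "sum_list (map h (concat (replicate m [l, bar l]))) = 0"
  by (induction m) (simp_all add: h_bar[OF assms])

text \<open>Only some words \<open>t\<close> and \<open>a\<close> for the two standard generators
  are required of the steps; then the products of blocks form a set of 2^k elements reached by words
  of one common length linear in \<open>k\<close>.\<close>

theorem lamplighter_return:
  fixes h :: "'l \<Rightarrow> lamp"
  assumes "symmetric_walk L h bar"
    and t: "t \<in> lists L" "sum_list (map h t) = Lamp 1 (\<lambda>_. False)"
    and a: "a \<in> lists L" "sum_list (map h a) = Lamp 0 (\<lambda>i. i = 0)"
  shows "\<exists>C. \<forall>n. real (n + 1) ^ E * real (card (loops L h n))
    \<le> C * real (card L) ^ n"
proof -
  interpret symmetric_walk L h bar by fact
  have "t \<noteq> []" using t(2) by (auto simp: zero_lamp_def)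
  then obtain l where l: "l \<in> L" using t(1) by (cases t) auto
  define q where "q = length t + length a"
  have q: "q > 0" using \<open>t \<noteq> []\<close> by (simp add: q_def)
  \<comment> \<open>The unlit block lacks two copies of \<open>a\<close>; \<open>length a\<close>
    cancelling pairs make up exactly for their length.\<close>
  define U where "U b = (if b then a @ t @ a @ t else t @ t @ concat (replicate (length a) [l, bar l]))" for b
  have pad: "concat (replicate m [l, bar l]) \<in> lists L" "length (concat (replicate m [l, bar l])) = 2 * m" for m
    using l bar_closed by (induction m) simp_all
  have U: "U b \<in> lists L" "length (U b) = 2 * q" "sum_list (map h (U b)) = block b" for b
    using t a pad sum_list_pad[OF l]
    by (auto simp: U_def q_def block_def plus_lamp_def zero_lamp_def fun_eq_iff simp del: in_lists_conv_set)
  define Q where "Q = (real q)\<^sup>2 * N\<^sup>2"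
  have Q1: "Q \<ge> 1" unfolding Q_def using q N_pos by (intro mult_ge1_I one_le_power) simp_all
  have key: "real (card (loops L h n)) \<le>
      N ^ n * (1 / 2 ^ k + (1 - 1 / (real k ^ 2 * Q)) ^ (n div 2))" if k: "k \<ge> 1" for n k
  proof -
    let ?X = "{bs :: bool list. set bs \<subseteq> UNIV \<and> length bs = k}"
    let ?v = "\<lambda>bs. sum_list (map block bs)"
    define B where "B = ?v ` ?X"
    have "inj_on ?v ?X" by (rule inj_onI) (use blocks_inj in auto)
    then have "card B = card ?X" unfolding B_def by (rule card_image)
    also have "\<dots> = 2 ^ k" by (subst card_lists_length_eq) simp_all
    finally have card: "card B = 2 ^ k" .
    then have B: "finite B" "B \<noteq> {}" by (metis card.infinite power_not_zero zero_neq_numeral, auto)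
    \<comment> \<open>Each of the \<open>k\<close> blocks takes \<open>2 * q\<close> letters, so
      \<open>2 * Suc r\<close> is their total length.\<close>
    obtain r where r: "Suc r = q * k" using q k by (cases "q * k") auto
    have "card (loops L h n)
      \<le> N ^ n * (1 / card B + (1 - 1 / ((Suc r)\<^sup>2 * N\<^sup>2)) ^ (n div 2))"
    proof (rule return_count[OF B])
      fix g assume "g \<in> B"
      then obtain bs where bs: "length bs = k" "g = ?v bs" by (auto simp: B_def)
      have "concat (map U bs) \<in> lists L" using U(1) by (induction bs) simp_all
      moreover have "length (concat (map U bs)) = length bs * (2 * q)"
        by (induction bs) (simp_all add: U(2))
      moreover have "sum_list (map h (concat (map U bs))) = ?v bs"
        by (induction bs) (simp_all add: U(3))
      ultimately show "\<exists>w\<in>lists L. length w = 2 * Suc r \<and> sum_list (map h w) = g"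
        using bs r by (intro bexI[of _ "concat (map U bs)"]) (simp_all add: mult_ac)
    qed
    also have "(Suc r)\<^sup>2 * N\<^sup>2 = real k ^ 2 * Q"
      by (simp only: r Q_def) (simp add: power_mult_distrib mult_ac)
    finally show ?thesis by (simp add: card)
  qed
  obtain C where C: "\<And>n. \<exists>k\<ge>1. real (n + 1) ^ E * (1 / 2 ^ k + (1 - 1 / (real k ^ 2 * Q)) ^ (n div 2)) \<le> C"
    using cube_root_tradeoff[OF Q1, of E] by blast
  have "real (n + 1) ^ E * real (card (loops L h n)) \<le> C * N ^ n" for n
  proof -
    obtain k where k: "k \<ge> 1"
      "real (n + 1) ^ E * (1 / 2 ^ k + (1 - 1 / (real k ^ 2 * Q)) ^ (n div 2)) \<le> C" using C by blast
    have "real (n + 1) ^ E * real (card (loops L h n)) \<le>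
        real (n + 1) ^ E * (N ^ n * (1 / 2 ^ k + (1 - 1 / (real k ^ 2 * Q)) ^ (n div 2)))"
      by (intro mult_left_mono key k) simp
    also have "\<dots> = N ^ n * (real (n + 1) ^ E * (1 / 2 ^ k + (1 - 1 / (real k ^ 2 * Q)) ^ (n div 2)))"
      by (simp add: mult_ac)
    also have "\<dots> \<le> N ^ n * C" by (intro mult_left_mono k) simp
    finally show ?thesis by (simp add: mult.commute)
  qed
  then show ?thesis by blast
qed

section \<open>Tapes\<close>

definition word_tape :: "nat letter \<Rightarrow> action" where
  "word_tape l = (\<lambda>_. Letter l, MoveRight)"

lemma load_word_tape: "load word_tape v = (int (length v), word_cell v)"
proof (induction v rule: rev_induct)
  case Nil
  then show ?case by (auto simp: load_Nil word_cell_def fun_eq_iff)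
next
  case (snoc l v)
  then show ?case
    by (auto simp: load_snoc word_tape_def write_content_def word_cell_def fun_eq_iff nth_append)
qed

definition counter_tape :: "nat \<Rightarrow> nat letter \<Rightarrow> action" where
  "counter_tape x l = (\<lambda>a. a, if gen l = x then if positive l then MoveRight else MoveLeft else Stay)"

definition exponent :: "nat \<Rightarrow> nat letter list \<Rightarrow> int" where
  "exponent x v = sum_list (map (\<lambda>l. if gen l = x then sgn_letter l else 0) v)"

lemma load_counter_tape: "load (counter_tape x) v = (exponent x v, \<lambda>p. Cell (p = 0) Empty)"
proof (induction v rule: rev_induct)
  case Nil
  then show ?case by (simp add: load_Nil exponent_def)
next
  case (snoc l v)
  then show ?case
    by (auto simp: load_snoc counter_tape_def write_content_def exponent_def sgn_letter_def fun_eq_iff)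
qed

definition lamp_tape :: "nat letter \<Rightarrow> action" where
  "lamp_tape l = (if gen l = 1 then (\<lambda>a. if a = Empty then Mark else Empty) else (\<lambda>a. a),
    if gen l = 0 then if positive l then MoveRight else MoveLeft else Stay)"

definition lamp_cell :: "lamp \<Rightarrow> int \<Rightarrow> cell" where
  "lamp_cell x p = Cell (p = 0) (if lit x p then Mark else Empty)"

text \<open>Appending a letter multiplies on the right, which changes the element only at the
  position of the lamplighter, that is, under the head.\<close>

lemma load_lamp_tape: "load lamp_tape v = (pos (lamp_value v), lamp_cell (lamp_value v))"
proof (induction v rule: rev_induct)
  case Nil
  then show ?case by (simp add: load_Nil lamp_cell_def fun_eq_iff)
next
  case (snoc l v)
  then show ?case
    by (cases l) (auto simp: load_snoc lamp_tape_def write_content_def lamp_cell_def fun_eq_iff)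
qed

lemma abs_pos_lamp_value: "\<bar>pos (lamp_value v)\<bar> \<le> int (length v)"
proof (induction v)
  case (Cons l v)
  then show ?case by (cases l) auto
qed simp

text \<open>A lamp is switched only where the lamplighter has been.\<close>

lemma lit_lamp_value: "lit (lamp_value v) p \<Longrightarrow> \<bar>p\<bar> \<le> int (length v)"
proof (induction v rule: rev_induct)
  case (snoc l v)
  then show ?case using abs_pos_lamp_value[of v] by (cases l) (auto split: if_splits)
qed simp

section \<open>The program for non-abelian quotients\<close>

definition go :: "nat \<Rightarrow> bool \<Rightarrow> com" where
  "go W e = Move (\<lambda>j. if j = 0 then MoveLeft
    else if j = W then if e then MoveRight else MoveLeft else Stay)"

definition go_back :: "nat \<Rightarrow> bool \<Rightarrow> com" where
  "go_back W e = Move (\<lambda>j. if j = 0 then MoveRight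
    else if j = W then if e then MoveLeft else MoveRight else Stay)"

definition scan_half :: "nat \<Rightarrow> bool \<Rightarrow> com" where
  "scan_half W e = Loop (\<lambda>V. \<not> origin (V 0) \<and> content (V W) = Empty) (go W e)"

definition return_half :: "nat \<Rightarrow> bool \<Rightarrow> com" where
  "return_half W e = Loop (\<lambda>V. content (V 0) \<noteq> Empty) (go_back W e)"

text \<open>The heads of levels 0 to \<open>d\<close> end at \<open>4 * d + 3\<close>. The next two
  are put on the empty prefix and on the whole word, the pair to be compared.\<close>

definition slow_prog :: "nat \<Rightarrow> nat \<Rightarrow> com" where
  "slow_prog d W = Loop (\<lambda>V. \<not> origin (V 0)) (Move (\<lambda>j. if j < W then MoveLeft else Stay)) ;;
    Loop (\<lambda>V. content (V (4 * d + 5)) \<noteq> Empty) (up (4 * d + 5)) ;;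
    eqprog d (4 * d + 4) (4 * d + 5)"

text \<open>The heads below \<open>W\<close> are on copies of the word, all at its right end initially, and head \<open>W\<close> is
  on the lamp tape. All lit lamps are within distance \<open>L\<close> of the origin, where \<open>L\<close> is the length of the
  word, so head 0 measures how far head \<open>W\<close> has to scan.\<close>

definition main_prog :: "nat \<Rightarrow> nat \<Rightarrow> com" where
  "main_prog d W = Cond (\<lambda>V. origin (V W))
    (scan_half W True ;; Cond (\<lambda>V. content (V W) = Empty)
      (return_half W True ;; scan_half W False ;; Cond (\<lambda>V. content (V W) = Empty)
        (return_half W False ;; slow_prog d W) Skip) Skip) Skip"

text \<open>One test serves all exits: an early exit leaves head \<open>W\<close> off the origin or
  on a lit lamp, and after the slow part the result head decides.\<close>

definition main_fin :: "nat \<Rightarrow> nat \<Rightarrow> (nat \<Rightarrow> cell) \<Rightarrow> bool" where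
  "main_fin d W V \<longleftrightarrow> origin (V W) \<and> content (V W) = Empty \<and> \<not> origin (V (4 * d))"

section \<open>Correctness of the program on its tapes\<close>

locale main_tapes =
  fixes r d W :: nat and v :: "nat letter list" and T :: "nat \<Rightarrow> int \<Rightarrow> cell"
    and s0 :: "nat \<Rightarrow> int"
  assumes v: "v \<in> words {..<r}" and W_eq: "W = 4 * d + 6"
    and T_word: "j < W \<Longrightarrow> T j = word_cell v" and T_lamp: "T W = lamp_cell (lamp_value v)"
    and s0: "s0 j = (if j < W then int (length v) else if j = W then pos (lamp_value v) else 0)"
begin

abbreviation "x \<equiv> lamp_value v"
abbreviation "L \<equiv> length v"

definition sg :: "bool \<Rightarrow> int" where "sg e = (if e then 1 else - 1)"

definition st :: "bool \<Rightarrow> nat \<Rightarrow> nat \<Rightarrow> int" where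
  "st e m = s0(0 := int L - int m, W := sg e * int m)"

text \<open>The head positions during the scans form a set of linear size, which is what makes the
  rejection linear.\<close>

definition scan_set :: "(nat \<Rightarrow> int) set" where
  "scan_set = (\<lambda>(e, m). st e m) ` (UNIV \<times> {..L})"

lemma finite_scan_set: "finite scan_set"
  by (simp add: scan_set_def)

lemma card_scan_set: "card scan_set \<le> 2 * L + 2"
proof -
  have "card scan_set \<le> card ((UNIV :: bool set) \<times> {..L})"
    unfolding scan_set_def by (rule card_image_le) simp
  then show ?thesis by (simp add: card_cartesian_product)
qed

lemma st_in: "m \<le> L \<Longrightarrow> st e m \<in> scan_set"
  unfolding scan_set_def by (rule image_eqI[of _ _ "(e, m)"]) auto

lemma W_pos: "W \<noteq> 0" "0 < W" using W_eq by simp_all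

lemma view_st:
  assumes "m \<le> L"
  shows "origin (view T (st e m) 0) \<longleftrightarrow> m = L" "content (view T (st e m) 0) \<noteq> Empty \<longleftrightarrow> m \<noteq> 0"
    "content (view T (st e m) W) = Empty \<longleftrightarrow> \<not> lit x (sg e * int m)"
  using assms W_pos by (auto simp: view_def st_def T_word T_lamp word_cell_def lamp_cell_def)

lemma exec_go: "Suc m \<le> L \<Longrightarrow> exec scan_set T (go W e) (st e m) (st e (Suc m))"
proof -
  assume m: "Suc m \<le> L"
  have "shift (\<lambda>j. if j = 0 then MoveLeft else if j = W then if e then MoveRight else MoveLeft else Stay)
      (st e m) = st e (Suc m)"
    using W_pos by (auto simp: shift_def st_def sg_def fun_eq_iff algebra_simps)
  then show ?thesis using exec.Move[OF st_in[of m e]] st_in[of "Suc m" e] m unfolding go_def by (metis Suc_leD)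
qed

lemma exec_go_back: "Suc m \<le> L \<Longrightarrow> exec scan_set T (go_back W e) (st e (Suc m)) (st e m)"
proof -
  assume m: "Suc m \<le> L"
  have "shift (\<lambda>j. if j = 0 then MoveRight else if j = W then if e then MoveLeft else MoveRight else Stay)
      (st e (Suc m)) = st e m"
    using W_pos by (auto simp: shift_def st_def sg_def fun_eq_iff algebra_simps)
  then show ?thesis using exec.Move[OF st_in[of "Suc m" e]] st_in[of m e] m unfolding go_back_def by (metis Suc_leD)
qed

lemma st_0: "pos x = 0 \<Longrightarrow> st e 0 = s0"
  using W_pos by (auto simp: st_def s0 fun_eq_iff)

lemma exec_scan_half:
  assumes "pos x = 0"
  shows "\<exists>n\<le>L. exec scan_set T (scan_half W e) s0 (st e n) \<and>
    (lit x (sg e * int n) \<or> n = L \<and> (\<forall>m\<le>L. \<not> lit x (sg e * int m)))"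
proof -
  define n where "n = (LEAST m. m = L \<or> lit x (sg e * int m))"
  have n: "n = L \<or> lit x (sg e * int n)" unfolding n_def by (rule LeastI[of _ L]) simp
  have nL: "n \<le> L" unfolding n_def by (rule Least_le) simp
  have less: "m \<noteq> L \<and> \<not> lit x (sg e * int m)" if "m < n" for m
    using not_less_Least[of m] that unfolding n_def by blast
  have "exec scan_set T (scan_half W e) (st e 0) (st e n)"
    unfolding scan_half_def
  proof (rule exec_Loop_iterate)
    fix m assume m: "m < n"
    then show "(\<not> origin (view T (st e m) 0) \<and> content (view T (st e m) W) = Empty) \<and>
        exec scan_set T (go W e) (st e m) (st e (Suc m))"
      using less[OF m] nL view_st[of m e] exec_go[of m e] by simp
  next
    show "st e n \<in> scan_set" using nL by (rule st_in)
    show "\<not> (\<not> origin (view T (st e n) 0) \<and> content (view T (st e n) W) = Empty)"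
      using n view_st[OF nL] by blast
  qed
  moreover have "lit x (sg e * int n) \<or> n = L \<and> (\<forall>m\<le>L. \<not> lit x (sg e * int m))"
    using n less nL by (metis le_neq_implies_less)
  ultimately show ?thesis using nL st_0[OF assms] by auto
qed

lemma exec_return_half:
  assumes "pos x = 0" shows "exec scan_set T (return_half W e) (st e L) s0"
proof -
  have "exec scan_set T (return_half W e) (st e (L - 0)) (st e (L - L))"
    unfolding return_half_def
  proof (rule exec_Loop_iterate[where St = "\<lambda>m. st e (L - m)"])
    fix m assume "m < L"
    then show "content (view T (st e (L - m)) 0) \<noteq> Empty \<and>
        exec scan_set T (go_back W e) (st e (L - m)) (st e (L - Suc m))"
      using exec_go_back[of "L - Suc m" e] view_st(2)[of "L - m" e] by (simp add: Suc_diff_Suc)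
  next
    show "st e (L - L) \<in> scan_set" by (simp add: st_in)
    show "\<not> content (view T (st e (L - L)) 0) \<noteq> Empty" using view_st(2)[of 0 e] by simp
  qed
  then show ?thesis by (simp add: st_0[OF assms])
qed

abbreviation "B \<equiv> 3 * int L + 3"

sublocale word_heads "{..<r}" v T W "Suc W" B
  by unfold_locales (use v T_word in auto)

lemma s0_box: "pos x = 0 \<Longrightarrow> s0 \<in> box (Suc W) B"
  by (auto simp: box_def s0)

lemma scan_set_box:
  assumes "pos x = 0" shows "scan_set \<subseteq> box (Suc W) B"
  unfolding scan_set_def st_def using assms W_pos
  by (auto intro!: box_upd s0_box simp: sg_def)

lemma exec_slow_prog:
  assumes "pos x = 0"
  shows "\<exists>t. exec (box (Suc W) B) T (slow_prog d W) s0 t \<and> t W = 0 \<and>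
    t (4 * d) = (if cls {..<r} v \<in> derived_term (free_group {..<r}) d then 1 else 0)"
proof -
  let ?I = "box (Suc W) B" and ?j = "4 * d + 5"
  define z where "z m = (\<lambda>j. if j < W then int L - int m else 0)" for m
  have z: "z m \<in> ?I" if "m \<le> L" for m using that by (auto simp: z_def box_def)
  have z0: "z 0 = s0" using assms by (auto simp: z_def s0 fun_eq_iff)
  have 1: "exec ?I T (Loop (\<lambda>V. \<not> origin (V 0)) (Move (\<lambda>j. if j < W then MoveLeft else Stay))) (z 0) (z L)"
  proof (rule exec_Loop_iterate)
    fix m assume m: "m < L"
    have "shift (\<lambda>j. if j < W then MoveLeft else Stay) (z m) = z (Suc m)"
      by (auto simp: shift_def z_def fun_eq_iff)
    then have "exec ?I T (Move (\<lambda>j. if j < W then MoveLeft else Stay)) (z m) (z (Suc m))"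
      using exec.Move[of "z m" ?I "\<lambda>j. if j < W then MoveLeft else Stay" T] z[of m] z[of "Suc m"] m by simp
    then show "\<not> origin (view T (z m) 0) \<and>
        exec ?I T (Move (\<lambda>j. if j < W then MoveLeft else Stay)) (z m) (z (Suc m))"
      using m W_pos by (simp add: view_def z_def origin_T)
  next
    show "z L \<in> ?I" by (simp add: z)
    show "\<not> \<not> origin (view T (z L) 0)" using W_pos by (simp add: view_def z_def origin_T)
  qed
  define y where "y m = (z L)(?j := int m)" for m
  have y: "y m \<in> ?I" if "m \<le> L" for m unfolding y_def using z[of L] that W_eq by (intro box_upd) auto
  have 2: "exec ?I T (Loop (\<lambda>V. content (V ?j) \<noteq> Empty) (up ?j)) (y 0) (y L)"
  proof (rule exec_Loop_iterate)
    fix m assume m: "m < L"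
    have "exec ?I T (up ?j) (y m) (y (Suc m))"
      using m y[of m] y[of "Suc m"] by (intro exec_up) (auto simp: y_def)
    then show "content (view T (y m) ?j) \<noteq> Empty \<and> exec ?I T (up ?j) (y m) (y (Suc m))"
      using m W_eq by (simp add: view_def y_def content_T)
  next
    show "y L \<in> ?I" by (simp add: y)
    show "\<not> content (view T (y L) ?j) \<noteq> Empty"
      using W_eq content_T[of ?j "int L"] by (simp add: view_def y_def)
  qed
  have y0: "y 0 = z L" by (auto simp: y_def z_def fun_eq_iff)
  let ?t = "(y L)(4 * d := if same_prefix {..<r} d v 0 L then 1 else 0)"
  have "decides_same d (eqprog d (4 * d + 4) ?j) (4 * d + 4) ?j"
    using W_eq by (intro run_eqprog) auto
  then have 3: "exec ?I T (eqprog d (4 * d + 4) ?j) (y L) ?t"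
    using y[of L] unfolding decides_same_def by (auto simp: y_def z_def)
  have "exec ?I T (slow_prog d W) s0 ?t"
    unfolding slow_prog_def using exec.Seq[OF 1[unfolded z0] exec.Seq[OF 2[unfolded y0] 3]] .
  moreover have "?t W = 0" using W_eq by (simp add: y_def z_def)
  ultimately show ?thesis using same_prefix_full[OF v, of d] by (intro exI[of _ ?t]) simp
qed

lemma lamp_value_eq_0_iff:
  "x = 0 \<longleftrightarrow> pos x = 0 \<and> (\<forall>e. \<forall>m\<le>L. \<not> lit x (sg e * int m))"
proof -
  have "\<not> lit x p" if "\<forall>e. \<forall>m\<le>L. \<not> lit x (sg e * int m)" for p
  proof
    assume p: "lit x p"
    then have "nat \<bar>p\<bar> \<le> L" using lit_lamp_value[of v p] by linarith
    moreover have "p = sg (p \<ge> 0) * int (nat \<bar>p\<bar>)" by (simp add: sg_def)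
    ultimately show False using that p by metis
  qed
  then show ?thesis by (auto simp: lamp_eq_0_iff)
qed

lemma fin_st_lit: "m \<le> L \<Longrightarrow> lit x (sg e * int m) \<Longrightarrow> \<not> main_fin d W (view T (st e m))"
  using view_st(3)[of m e] by (auto simp: main_fin_def)

text \<open>The set \<open>I\<close> depends on the word: a single position if the lamplighter is
  away from the origin, \<open>scan_set\<close> if a scan finds a lit lamp, and the whole box
  otherwise. Its size governs the running time.\<close>

theorem main_prog_correct:
  "\<exists>I t. finite I \<and> exec I T (main_prog d W) s0 t \<and>
    (main_fin d W (view T t) \<longleftrightarrow> x = 0 \<and> cls {..<r} v \<in> derived_term (free_group {..<r}) d) \<and>
    card I \<le> (if x = 0 then (6 * L + 7) ^ Suc W else 2 * L + 2)"
proof (cases "pos x = 0")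
  case False
  have orig: "\<not> origin (view T s0 W)" using False by (simp add: view_def s0 T_lamp lamp_cell_def)
  have "exec {s0} T (main_prog d W) s0 s0" unfolding main_prog_def
    using orig by (intro exec_Cond) (auto intro: exec.Skip)
  moreover have "x \<noteq> 0" using False by auto
  ultimately show ?thesis using orig
    by (intro exI[of _ "{s0}"] exI[of _ s0]) (auto simp: main_fin_def)
next
  case True
  have orig: "origin (view T s0 W)" using True by (simp add: view_def s0 T_lamp lamp_cell_def)
  \<comment> \<open>Both exits at a lit lamp are settled alike.\<close>
  have fail: ?thesis if "exec scan_set T (main_prog d W) s0 (st e m)" "m \<le> L" "lit x (sg e * int m)" for e m
  proof -
    have "x \<noteq> 0" using that(3) by (auto simp: lamp_eq_0_iff)
    then show ?thesis using that fin_st_lit[of m e] finite_scan_set card_scan_set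
      by (intro exI[of _ scan_set] exI[of _ "st e m"]) auto
  qed
  obtain n1 where n1: "n1 \<le> L" "exec scan_set T (scan_half W True) s0 (st True n1)"
    "lit x (sg True * int n1) \<or> n1 = L \<and> (\<forall>m\<le>L. \<not> lit x (sg True * int m))"
    using exec_scan_half[OF True] by blast
  obtain n2 where n2: "n2 \<le> L" "exec scan_set T (scan_half W False) s0 (st False n2)"
    "lit x (sg False * int n2) \<or> n2 = L \<and> (\<forall>m\<le>L. \<not> lit x (sg False * int m))"
    using exec_scan_half[OF True] by blast
  note ret = exec_return_half[OF True]
  consider "lit x (sg True * int n1)"
    | "\<not> lit x (sg True * int n1)" "n1 = L" "lit x (sg False * int n2)"
    | "n1 = L" "n2 = L" "\<forall>m\<le>L. \<not> lit x (sg True * int m)" "\<forall>m\<le>L. \<not> lit x (sg False * int m)"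
    using n1(3) n2(3) by blast
  then show ?thesis
  proof cases
    case 1
    have "exec scan_set T (main_prog d W) s0 (st True n1)" unfolding main_prog_def
      by (rule exec.CondT, rule orig, rule exec.Seq, rule n1(2), rule exec.CondF,
          use 1 view_st(3)[OF n1(1)] in simp, rule exec.Skip, rule st_in, rule n1(1))
    then show ?thesis using n1(1) 1 by (rule fail)
  next
    case 2
    have "exec scan_set T (main_prog d W) s0 (st False n2)" unfolding main_prog_def
      by (rule exec.CondT, rule orig, rule exec.Seq, rule n1(2), rule exec.CondT,
          use 2 view_st(3)[OF n1(1)] in simp, rule exec.Seq, rule ret[folded 2(2)], rule exec.Seq,
          rule n2(2), rule exec.CondF, use 2 view_st(3)[OF n2(1)] in simp, rule exec.Skip,
          rule st_in, rule n2(1))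
    then show ?thesis using n2(1) 2(3) by (rule fail)
  next
    case 3
    have all: "\<not> lit x (sg e * int m)" if "m \<le> L" for e m using 3(3,4) that by (cases e) auto
    then have x0: "x = 0" using lamp_value_eq_0_iff True by blast
    note box = exec_mono[OF _ scan_set_box[OF True]]
    obtain t where t: "exec (box (Suc W) B) T (slow_prog d W) s0 t" "t W = 0"
      "t (4 * d) = (if cls {..<r} v \<in> derived_term (free_group {..<r}) d then 1 else 0)"
      using exec_slow_prog[OF True] by blast
    have vE: "content (view T (st e L) W) = Empty" for e
      using view_st(3)[of L e] all[of L e] by simp
    have "exec (box (Suc W) B) T (main_prog d W) s0 t" unfolding main_prog_def
      by (rule exec.CondT, rule orig, rule exec.Seq, rule box[OF n1(2)[unfolded 3(1)]],
          rule exec.CondT, rule vE, rule exec.Seq, rule box[OF ret], rule exec.Seq,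
          rule box[OF n2(2)[unfolded 3(2)]], rule exec.CondT, rule vE, rule exec.Seq,
          rule box[OF ret], rule t(1))
    moreover have "4 * d < W" using W_eq by simp
    then have "main_fin d W (view T t) \<longleftrightarrow> cls {..<r} v \<in> derived_term (free_group {..<r}) d"
      using t(2,3) x0 by (simp add: main_fin_def view_def T_lamp lamp_cell_def origin_T)
    moreover have "finite (box (Suc W) B)" "card (box (Suc W) B) \<le> (6 * L + 7) ^ Suc W"
    proof -
      have "nat (2 * B + 1) = 6 * L + 7" by simp
      then show "finite (box (Suc W) B)" "card (box (Suc W) B) \<le> (6 * L + 7) ^ Suc W"
        using finite_card_box[of "Suc W" B] by auto
    qed
    ultimately show ?thesis using x0 by (intro exI[of _ "box (Suc W) B"] exI[of _ t]) auto
  qed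
qed

end

section \<open>Presentations and average running time\<close>

locale presented =
  fixes G :: "('g, 'm) monoid_scheme" and X :: "'g set" and r d :: nat and \<phi>
  assumes G: "group G" and X: "finite X" "X \<subseteq> carrier G" "generate G X = carrier G"
    and \<phi>: "\<phi> \<in> iso G (free_group {..<r} Mod derived_term (free_group {..<r}) d)"
begin

abbreviation "S \<equiv> {..<r}"
abbreviation "F \<equiv> free_group S"
abbreviation "N \<equiv> derived_term F d"
abbreviation "coset w \<equiv> N #>\<^bsub>F\<^esub> cls S w"

sublocale G: group G by (rule G)
sublocale N: normal N F by (rule derived_term_normal[OF group_free_group])

text \<open>The elements of \<open>X\<close> need not be images of the free generators, so each is
  lifted to some word in them.\<close>

definition gen_word :: "'g \<Rightarrow> nat letter list" where
  "gen_word x = (SOME w. w \<in> words S \<and> \<phi> x = coset w)"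

lemma \<phi>_hom: "x \<in> carrier G \<Longrightarrow> y \<in> carrier G \<Longrightarrow> \<phi> (x \<otimes>\<^bsub>G\<^esub> y) = \<phi> x <#>\<^bsub>F\<^esub> \<phi> y"
  using \<phi> hom_mult[of \<phi> G "F Mod N" x y] by (simp add: iso_def)

lemma coset_append: "u \<in> words S \<Longrightarrow> v \<in> words S \<Longrightarrow> coset u <#>\<^bsub>F\<^esub> coset v = coset (u @ v)"
  by (simp add: N.rcos_sum cls_append)

lemma gen_word: "x \<in> X \<Longrightarrow> gen_word x \<in> words S \<and> \<phi> x = coset (gen_word x)"
proof -
  assume "x \<in> X"
  then have "\<phi> x \<in> carrier (F Mod N)" using \<phi> X(2) by (auto simp: iso_def hom_def)
  then obtain g where "g \<in> carrier F" "\<phi> x = N #>\<^bsub>F\<^esub> g" by (auto simp: carrier_FactGroup)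
  then have "\<exists>w. w \<in> words S \<and> \<phi> x = coset w" by (metis carrier_free_group_E)
  then show ?thesis unfolding gen_word_def by (rule someI_ex)
qed

fun letter_word :: "'g letter \<Rightarrow> nat letter list" where
  "letter_word (Gen x) = gen_word x"
| "letter_word (InvGen x) = inv_word (gen_word x)"

lemma letter_word_in: "l \<in> letters X \<Longrightarrow> letter_word l \<in> words S"
proof -
  assume "l \<in> letters X"
  then obtain x where "x \<in> X" "l = Gen x \<or> l = InvGen x" by (auto simp: letters_def)
  then show ?thesis using gen_word[of x] inv_word_in_words[of "gen_word x" S]
    by (elim disjE) (simp_all del: in_lists_conv_set)
qed

lemma letter_word_inv: "letter_word (inv_letter l) = inv_word (letter_word l)"
  by (cases l) simp_all

lemma letter_value_in: "l \<in> letters X \<Longrightarrow> letter_value G l \<in> carrier G"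
  using X(2) by (auto simp: letters_def)

lemma \<phi>_letter: "l \<in> letters X \<Longrightarrow> \<phi> (letter_value G l) = coset (letter_word l)"
proof -
  interpret FN: group "F Mod N" by (rule N.factorgroup_is_group)
  interpret \<phi>: group_hom G "F Mod N" \<phi>
    using \<phi> by unfold_locales (simp add: iso_def)
  assume l: "l \<in> letters X"
  show ?thesis
  proof (cases l)
    case (Gen x)
    then show ?thesis using l gen_word by (auto simp: letters_def)
  next
    case (InvGen x)
    then have x: "x \<in> X" using l by (auto simp: letters_def)
    then have w: "cls S (gen_word x) \<in> carrier F" using gen_word by simp
    have "\<phi> (inv\<^bsub>G\<^esub> x) = inv\<^bsub>F Mod N\<^esub> (coset (gen_word x))"
      using x X(2) gen_word by (metis \<phi>.hom_inv subsetD)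
    also have "\<dots> = N #>\<^bsub>F\<^esub> (inv\<^bsub>F\<^esub> cls S (gen_word x))"
      using w by (simp add: N.inv_FactGroup N.rcos_inv carrier_FactGroup)
    finally show ?thesis using InvGen gen_word[OF x] cls_inv_word[of "gen_word x" S] by simp
  qed
qed

definition expansion :: "'g letter list \<Rightarrow> nat letter list" where
  "expansion w = concat (map letter_word w)"

lemma expansion_in: "w \<in> words X \<Longrightarrow> expansion w \<in> words S"
  using letter_word_in by (induction w) (simp_all add: expansion_def del: in_lists_conv_set)

lemma \<phi>_word:
  "w \<in> words X \<Longrightarrow> word_value G w \<in> carrier G \<and> \<phi> (word_value G w) = coset (expansion w)"
proof (induction w)
  case Nil
  interpret FN: group "F Mod N" by (rule N.factorgroup_is_group)
  have "\<phi> \<one>\<^bsub>G\<^esub> = \<one>\<^bsub>F Mod N\<^esub>"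
    using \<phi> hom_one[OF _ G FN.group_axioms] by (simp add: iso_def)
  then show ?case by (simp add: word_value_def expansion_def cls_Nil N.subset)
next
  case (Cons l w)
  then have l: "l \<in> letters X" and w: "w \<in> words X" by simp_all
  have "word_value G (l # w) = letter_value G l \<otimes>\<^bsub>G\<^esub> word_value G w" by (simp add: word_value_def)
  moreover have "expansion (l # w) = letter_word l @ expansion w" by (simp add: expansion_def)
  ultimately show ?case
    using Cons.IH[OF w] letter_value_in[OF l] \<phi>_letter[OF l] letter_word_in[OF l] expansion_in[OF w]
    by (simp add: \<phi>_hom coset_append del: in_lists_conv_set)
qed

lemma word_problem_iff:
  assumes "w \<in> words X" shows "w \<in> word_problem G X \<longleftrightarrow> cls S (expansion w) \<in> N"
proof -
  have inj: "inj_on \<phi> (carrier G)" using \<phi> by (auto simp: iso_def bij_betw_def)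
  interpret S: free_normal S N by (rule free_normal.intro[OF N.normal_axioms])
  have "word_value G [] = \<one>\<^bsub>G\<^esub>" "expansion [] = []" by (simp_all add: word_value_def expansion_def)
  then have "word_value G w = \<one>\<^bsub>G\<^esub> \<longleftrightarrow> coset (expansion w) = coset []"
    using \<phi>_word[OF assms] \<phi>_word[of "[]"] inj by (metis G.one_closed inj_onD lists.Nil)
  also have "\<dots> \<longleftrightarrow> cls S (expansion w) \<in> N"
    using S.vert_eq_iff[of "cls S []" "cls S (expansion w)"] expansion_in[OF assms]
    by (auto simp: cls_Nil)
  finally show ?thesis using assms by (simp add: word_problem_def)
qed

text \<open>Since \<open>X\<close> generates \<open>G\<close>, expansions meet every coset; this
  later supplies words over \<open>X\<close> for the two lamplighter generators.\<close>

lemma expansion_surj: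
  assumes "v \<in> words S" shows "\<exists>w\<in>words X. coset (expansion w) = coset v"
proof -
  have "\<exists>w\<in>words X. word_value G w = g" if "g \<in> generate G X" for g
    using that
  proof (induction rule: generate.induct)
    case one
    then show ?case by (intro bexI[of _ "[]"]) (simp_all add: word_value_def)
  next
    case (incl g)
    then show ?case using X(2) by (intro bexI[of _ "[Gen g]"]) (auto simp: word_value_def letters_def)
  next
    case (inv g)
    then show ?case using X(2) by (intro bexI[of _ "[InvGen g]"]) (auto simp: word_value_def letters_def)
  next
    case (eng g h)
    then obtain u v where uv: "u \<in> words X" "word_value G u = g" "v \<in> words X" "word_value G v = h"
      by blast
    have "word_value G (u @ v) = word_value G u \<otimes>\<^bsub>G\<^esub> word_value G v"
      using uv(1)
    proof (induction u)
      case (Cons l u)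
      then show ?case
        using letter_value_in \<phi>_word uv(3) by (simp add: word_value_def G.m_assoc)
    qed (use \<phi>_word[OF uv(3)] in \<open>simp add: word_value_def\<close>)
    then show ?case using uv by (intro bexI[of _ "u @ v"]) simp_all
  qed
  moreover have "coset v \<in> carrier (F Mod N)" using assms by (simp add: carrier_FactGroup)
  then have "coset v \<in> \<phi> ` carrier G" using \<phi> by (simp add: iso_def bij_betw_def)
  then obtain g where g: "g \<in> carrier G" "coset v = \<phi> g" by blast
  ultimately obtain w where "w \<in> words X" "word_value G w = g" using X(3) by blast
  then show ?thesis using \<phi>_word[of w] g(2) by (intro bexI[of _ w]) simp_all
qed

lemma finite_letters: "finite (letters X)"
  using X(1) by (simp add: letters_def)

text \<open>The inserted 0 covers an empty generating set.\<close>

definition max_expansion :: nat where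
  "max_expansion = Max (insert 0 ((length \<circ> letter_word) ` letters X))"

lemma length_expansion: "w \<in> words X \<Longrightarrow> length (expansion w) \<le> max_expansion * length w"
proof (induction w)
  case (Cons l w)
  then have "length (letter_word l) \<le> max_expansion"
    unfolding max_expansion_def using finite_letters by (intro Max_ge) auto
  then show ?case using Cons by (simp add: expansion_def)
qed (simp add: expansion_def)

lemma linear_averageI:
  assumes "decides M (letters X) (word_problem G X)"
    and bound: "\<And>n. (\<Sum>w\<in>words_of_length X n. real (running_time M w)) \<le>
      C * real (n + 1) * real (card (words_of_length X n))"
  shows "linear_average_case_word_problem G X"
proof -
  have "average_time M X \<in> O(\<lambda>n. real n)"
  proof (rule bigoI[of _ "2 * \<bar>C\<bar>"], rule eventually_sequentiallyI[of 1])
    fix n :: nat assume n: "1 \<le> n"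
    let ?W = "words_of_length X n"
    have nn: "0 \<le> average_time M X n" by (simp add: average_time_def sum_nonneg)
    have "average_time M X n \<le> \<bar>C\<bar> * real (n + 1)"
    \<comment> \<open>Without letters there are no words of positive length; the average is then 0,
      as a quotient by 0.\<close>
    proof (cases "card ?W = 0")
      case False
      then have "average_time M X n \<le> C * real (n + 1)"
        using bound[of n] by (simp add: average_time_def pos_divide_le_eq)
      also have "\<dots> \<le> \<bar>C\<bar> * real (n + 1)" by (intro mult_right_mono) auto
      finally show ?thesis .
    qed (simp add: average_time_def)
    also have "\<dots> \<le> \<bar>C\<bar> * (2 * real n)" using n by (intro mult_left_mono) auto
    finally show "norm (average_time M X n) \<le> 2 * \<bar>C\<bar> * norm (real n)" using nn by simp
  qed
  then show ?thesis using assms(1) by (auto simp: linear_average_case_word_problem_def)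
qed

lemma words_of_length_in: "w \<in> words_of_length X n \<Longrightarrow> w \<in> words X \<and> length w = n"
  by (simp add: words_of_length_def)

lemma finite_words_of_length: "finite (words_of_length X n)"
  using finite_lists_length_eq[OF finite_letters, of n]
  by (rule finite_subset[rotated]) (auto simp: words_of_length_def)

text \<open>Each tape counts one exponent sum by its head position while the input is read; no
  computation remains after loading, so every input takes linear time.\<close>

lemma linear_if_counters:
  assumes iff: "\<And>v. v \<in> words S \<Longrightarrow> cls S v \<in> N \<longleftrightarrow> (\<forall>x<k. exponent x v = 0)"
  shows "linear_average_case_word_problem G X"
proof -
  interpret loader "letters X" letter_word "letters S" k counter_tape Skip "\<lambda>V. \<forall>x<k. origin (V x)"
  proof
    fix l and x :: content and j
    assume "x \<in> {Empty, Mark} \<union> Letter ` letters S"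
    then show "fst (counter_tape j l) x \<in> {Empty, Mark} \<union> Letter ` letters S"
      by (simp add: counter_tape_def)
  qed (use finite_letters letter_word_in in \<open>auto simp: letters_def\<close>)
  have ex: "expand w = expansion w" for w by (simp add: expand_def expansion_def)
  have run: "halts_on machine w \<and> (accepts machine w \<longleftrightarrow> w \<in> word_problem G X) \<and>
    running_time machine w \<le> length w + length (expansion w) + 4" if w: "w \<in> words X" for w
  proof -
    let ?v = "expansion w"
    have "exec {heads ?v} (contents ?v) Skip (heads ?v) (heads ?v)" by (rule exec.Skip) simp
    from machine_correct[OF w _ this[folded ex]] have 1: "halts_on machine w"
      "accepts machine w \<longleftrightarrow> (\<forall>x<k. origin (view (contents ?v) (heads ?v) x))"
      "running_time machine w \<le> length w + length ?v + 4"
      by (simp_all add: ex)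
    have "origin (view (contents ?v) (heads ?v) x) \<longleftrightarrow> exponent x ?v = 0" if "x < k" for x
      using that by (simp add: view_def contents_def heads_def loaded_def load_counter_tape)
    then show ?thesis using 1 iff[OF expansion_in[OF w]] word_problem_iff[OF w] by auto
  qed
  have "decides machine (letters X) (word_problem G X)"
    using run machine_wf by (auto simp: decides_def simp del: in_lists_conv_set)
  moreover have "(\<Sum>w\<in>words_of_length X n. real (running_time machine w)) \<le>
      real (max_expansion + 5) * real (n + 1) * real (card (words_of_length X n))" for n
  proof -
    have "real (running_time machine w) \<le> real (max_expansion + 5) * real (n + 1)"
      if w: "w \<in> words_of_length X n" for w
    proof -
      have "running_time machine w \<le> n + max_expansion * n + 4"
        using run[of w] words_of_length_in[OF w] length_expansion[of w] by force
      also have "\<dots> \<le> (max_expansion + 5) * (n + 1)" by (simp add: algebra_simps)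
      finally show ?thesis by (metis of_nat_le_iff of_nat_mult)
    qed
    then have "(\<Sum>w\<in>words_of_length X n. real (running_time machine w)) \<le>
        (\<Sum>w\<in>words_of_length X n. real (max_expansion + 5) * real (n + 1))" by (rule sum_mono)
    then show ?thesis by (simp add: mult.commute)
  qed
  ultimately show ?thesis by (rule linear_averageI)
qed

text \<open>The slow bound of order \<open>(n + 1) ^ E\<close> is paid only for words trivial in the
  lamplighter group. By \<open>lamplighter_return\<close> with this same \<open>E\<close>, they
  contribute a bounded amount to the average.\<close>

lemma linear_if_nonabelian:
  assumes d: "2 \<le> d" and r: "2 \<le> r"
  shows "linear_average_case_word_problem G X"
proof -
  define W where "W = 4 * d + 6"
  define \<rho> where "\<rho> j = (if j < W then word_tape else lamp_tape)" for j
  interpret loader "letters X" letter_word "letters S" "Suc W" \<rho> "main_prog d W" "main_fin d W"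
  proof
    fix l and x :: content and j
    assume "l \<in> letters S" "x \<in> {Empty, Mark} \<union> Letter ` letters S"
    then show "fst (\<rho> j l) x \<in> {Empty, Mark} \<union> Letter ` letters S"
      by (simp add: \<rho>_def word_tape_def lamp_tape_def)
  qed (use finite_letters letter_word_in in \<open>auto simp: letters_def\<close>)
  have ex: "expand w = expansion w" for w by (simp add: expand_def expansion_def)
  define R where "R = card (residuals (main_prog d W))"
  define m where "m = max_expansion"
  define E where "E = Suc W"
  have run: "halts_on machine w \<and> (accepts machine w \<longleftrightarrow> w \<in> word_problem G X) \<and>
      running_time machine w \<le> length w + length (expansion w) + 3 +
        R * (if lamp_value (expansion w) = 0 then (6 * length (expansion w) + 7) ^ E
          else 2 * length (expansion w) + 2)" if wX: "w \<in> words X" for w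
  proof -
    let ?v = "expansion w"
    have "contents ?v j = word_cell ?v" "heads ?v j = int (length ?v)" if "j < W" for j
      using that by (simp_all add: contents_def heads_def loaded_def \<rho>_def load_word_tape)
    moreover have "contents ?v W = lamp_cell (lamp_value ?v)" "heads ?v W = pos (lamp_value ?v)"
      by (simp_all add: contents_def heads_def loaded_def \<rho>_def load_lamp_tape)
    moreover have "heads ?v j = 0" if "\<not> j < W" "j \<noteq> W" for j
      using that by (simp add: heads_def)
    ultimately interpret main_tapes r d W ?v "contents ?v" "heads ?v"
      by (intro main_tapes.intro expansion_in[OF wX] W_def) simp_all
    obtain I t where It: "finite I" "exec I (contents ?v) (main_prog d W) (heads ?v) t"
      "main_fin d W (view (contents ?v) t) \<longleftrightarrow> lamp_value ?v = 0 \<and> cls S ?v \<in> N"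
      "card I \<le> (if lamp_value ?v = 0 then (6 * length ?v + 7) ^ E else 2 * length ?v + 2)"
      using main_prog_correct unfolding E_def by blast
    have "cls S ?v \<in> N \<longrightarrow> lamp_value ?v = 0"
      using lamp_value_derived_term[OF expansion_in[OF wX] _ d] by blast
    then have "main_fin d W (view (contents ?v) t) \<longleftrightarrow> w \<in> word_problem G X"
      using It(3) word_problem_iff[OF wX] by blast
    moreover have "R * card I \<le> R * (if lamp_value ?v = 0 then (6 * length ?v + 7) ^ E else 2 * length ?v + 2)"
      using It(4) by (rule mult_le_mono2)
    ultimately show ?thesis
      using machine_correct[OF wX It(1), of t] It(2) unfolding ex R_def[symmetric] by linarith
  qed
  have dec: "decides machine (letters X) (word_problem G X)"
    using run machine_wf by (auto simp: decides_def simp del: in_lists_conv_set)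
  define h where "h l = lamp_value (letter_word l)" for l
  have h_sum: "sum_list (map h w) = lamp_value (expansion w)" for w
    by (induction w) (simp_all add: h_def expansion_def)
  \<comment> \<open>A word over \<open>X\<close> whose expansion lies in the coset of
    \<open>v\<close> will do, because the lamplighter value is trivial on \<open>N\<close>.\<close>
  have lamp_lift: "\<exists>w\<in>words X. sum_list (map h w) = lamp_value v" if v: "v \<in> words S" for v
  proof -
    obtain w where w: "w \<in> words X" "coset (expansion w) = coset v" using expansion_surj[OF v] by blast
    interpret S: free_normal S N by (rule free_normal.intro[OF N.normal_axioms])
    have "cls S (v @ inv_word (expansion w)) \<in> N"
      using w(2) S.vert_eq_iff[of "cls S (expansion w)" "cls S v"] v expansion_in[OF w(1)]
      by (simp add: cls_append cls_inv_word)
    then have "lamp_value (v @ inv_word (expansion w)) = 0"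
      using v expansion_in[OF w(1)] d by (intro lamp_value_derived_term) simp_all
    then have "lamp_value (expansion w) = lamp_value v"
      using sum_list_inv_word[of lamp_step "expansion w", OF lamp_step_inv] by simp
    then show ?thesis using w(1) h_sum by metis
  qed
  have "[Gen 0] \<in> words S" "[Gen 1] \<in> words S" using r by (auto simp: letters_def)
  then obtain t a where t: "t \<in> words X" "sum_list (map h t) = Lamp 1 (\<lambda>_. False)"
    and a: "a \<in> words X" "sum_list (map h a) = Lamp 0 (\<lambda>i. i = 0)"
    using lamp_lift[of "[Gen 0]"] lamp_lift[of "[Gen 1]"] by auto
  have "t \<noteq> []" using t(2) by (auto simp: zero_lamp_def)
  then have ne: "letters X \<noteq> {}" using t(1) by (cases t) auto
  have walk: "symmetric_walk (letters X) h inv_letter"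
    using finite_letters ne sum_list_inv_word[of lamp_step, OF lamp_step_inv]
    by unfold_locales (simp_all add: h_def letter_word_inv)
  obtain C where C: "\<And>n. real (n + 1) ^ E *
      real (card {w \<in> words X. length w = n \<and> sum_list (map h w) = 0}) \<le> C * real (card (letters X)) ^ n"
    using lamplighter_return[OF walk t a, of E] by blast
  \<comment> \<open>\<open>C1\<close> collects loading and the scans, \<open>C2\<close> the box;
    \<open>m\<close> bounds the expansion of one letter.\<close>
  define C1 where "C1 = 1 + m + 3 + R * (2 * m + 2)"
  define C2 where "C2 = R * (6 * m + 7) ^ E"
  have "(\<Sum>w\<in>words_of_length X n. real (running_time machine w)) \<le>
      (real C1 + real C2 * \<bar>C\<bar>) * real (n + 1) * real (card (words_of_length X n))" for n
  proof -
    let ?W = "words_of_length X n"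
    let ?Z = "{w \<in> words X. length w = n \<and> sum_list (map h w) = 0}"
    have time: "real (running_time machine w) \<le> real C1 * real (n + 1) +
        (if w \<in> ?Z then real C2 * real (n + 1) ^ E else 0)" if w: "w \<in> ?W" for w
    proof -
      have wX: "w \<in> words X" "length w = n" using words_of_length_in[OF w] by auto
      have len: "length (expansion w) \<le> m * n" using length_expansion[OF wX(1)] wX(2) by (simp add: m_def)
      have Z: "w \<in> ?Z \<longleftrightarrow> lamp_value (expansion w) = 0" using wX h_sum by simp
      have "running_time machine w \<le> C1 * (n + 1) + (if w \<in> ?Z then C2 * (n + 1) ^ E else 0)"
      proof (cases "lamp_value (expansion w) = 0")
        case True
        have "6 * length (expansion w) + 7 \<le> (6 * m + 7) * (n + 1)"
          using len by (simp add: algebra_simps)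
        then have "R * (6 * length (expansion w) + 7) ^ E \<le> R * ((6 * m + 7) * (n + 1)) ^ E"
          by (intro mult_le_mono2 power_mono) simp_all
        also have "\<dots> = C2 * (n + 1) ^ E" by (simp only: C2_def power_mult_distrib mult.assoc)
        finally have 1: "R * (6 * length (expansion w) + 7) ^ E \<le> C2 * (n + 1) ^ E" .
        have "n + length (expansion w) + 3 \<le> (1 + m + 3) * (n + 1)"
          using len by (simp add: algebra_simps)
        also have "\<dots> \<le> C1 * (n + 1)" unfolding C1_def by (intro mult_le_mono1) simp
        finally show ?thesis using run[OF wX(1)] 1 True unfolding Z wX(2) by simp
      next
        case False
        have "2 * length (expansion w) + 2 \<le> (2 * m + 2) * (n + 1)" using len by (simp add: algebra_simps)
        then have "R * (2 * length (expansion w) + 2) \<le> R * ((2 * m + 2) * (n + 1))" by (rule mult_le_mono2)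
        moreover have "n + length (expansion w) + 3 \<le> (1 + m + 3) * (n + 1)"
          using len by (simp add: algebra_simps)
        moreover have "C1 * (n + 1) = (1 + m + 3) * (n + 1) + R * ((2 * m + 2) * (n + 1))"
          by (simp only: C1_def add_mult_distrib mult.assoc)
        moreover have "running_time machine w \<le> n + length (expansion w) + 3 + R * (2 * length (expansion w) + 2)"
          using conjunct2[OF conjunct2[OF run[OF wX(1)]]] unfolding wX(2) if_not_P[OF False] .
        ultimately show ?thesis unfolding Z if_not_P[OF False] by linarith
      qed
      then have "real (running_time machine w) \<le> real (C1 * (n + 1) + (if w \<in> ?Z then C2 * (n + 1) ^ E else 0))"
        by (simp only: of_nat_le_iff)
      also have "\<dots> = real C1 * real (n + 1) + (if w \<in> ?Z then real C2 * real (n + 1) ^ E else 0)"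
        by (simp only: of_nat_add of_nat_mult of_nat_power of_nat_0 if_distrib[of real])
      finally show ?thesis .
    qed
    have ZW: "?Z \<subseteq> ?W" by (auto simp: words_of_length_def)
    have cardW: "card ?W = card (letters X) ^ n"
      using card_lists_length_eq[OF finite_letters, of n] by (simp add: words_of_length_def lists_eq_set)
    have "(\<Sum>w\<in>?W. real (running_time machine w)) \<le>
        (\<Sum>w\<in>?W. real C1 * real (n + 1) + (if w \<in> ?Z then real C2 * real (n + 1) ^ E else 0))"
      by (rule sum_mono) (rule time)
    also have "\<dots> = real (card ?W) * (real C1 * real (n + 1)) + real (card ?Z) * (real C2 * real (n + 1) ^ E)"
      using finite_words_of_length[of n] ZW
      by (simp only: sum.distrib sum_constant sum.inter_restrict[symmetric] Int_absorb1)
    finally have 1: "(\<Sum>w\<in>?W. real (running_time machine w)) \<le>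
        real (card ?W) * (real C1 * real (n + 1)) + real (card ?Z) * (real C2 * real (n + 1) ^ E)" .
    have 2: "real (card ?Z) * (real C2 * real (n + 1) ^ E) \<le> real C2 * (\<bar>C\<bar> * real (card ?W) * real (n + 1))"
    proof -
      have "real (n + 1) ^ E * real (card ?Z) \<le> C * real (card ?W)"
        using C[of n] by (simp only: cardW of_nat_power)
      also have "\<dots> \<le> \<bar>C\<bar> * real (card ?W)" by (intro mult_right_mono) simp_all
      also have "\<dots> \<le> \<bar>C\<bar> * real (card ?W) * real (n + 1)"
        by (rule order_trans[OF _ mult_left_mono[of 1 "real (n + 1)"]]) simp_all
      finally have "real C2 * (real (n + 1) ^ E * real (card ?Z)) \<le> real C2 * (\<bar>C\<bar> * real (card ?W) * real (n + 1))"
        by (rule mult_left_mono) simp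
      then show ?thesis by (simp only: mult_ac)
    qed
    have "k * (a * b) + c * (e * k * b) = (a + c * e) * b * k" for a b c e k :: real
      by (simp add: algebra_simps)
    from this[of "real (card ?W)" "real C1" "real (n + 1)" "real C2" "\<bar>C\<bar>"]
    show ?thesis using 1 2 by linarith
  qed
  then show ?thesis by (rule linear_averageI[OF dec])
qed

end

section \<open>The abelian cases\<close>

lemma exponent_inv: "(if gen (inv_letter l) = x then sgn_letter (inv_letter l) else 0) =
    - (if gen l = x then sgn_letter l else 0)"
  by (cases l) (auto simp: sgn_letter_def)

lemma exponent_derived_term:
  assumes "v \<in> words S" "cls S v \<in> derived_term (free_group S) d" "d \<ge> 1"
  shows "exponent x v = 0"
  unfolding exponent_def
  by (rule sum_list_derived_term_1[where f = "\<lambda>l. if gen l = x then sgn_letter l else 0",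
      OF exponent_inv assms])

text \<open>At level 0 the Cayley graph has a single vertex, and its edges are the
  generators.\<close>

lemma flow_0_exponent:
  assumes "w \<in> words S" shows "flow S 0 w k (length w) = exponent (gen (w ! k)) w"
proof -
  have "exponent (gen (w ! k)) w = (\<Sum>l<length w. if gen (w ! l) = gen (w ! k) then sgn_letter (w ! l) else 0)"
    by (simp add: exponent_def sum_list_sum_nth atLeast0LessThan)
  then show ?thesis using same_prefix_0[OF assms] by (simp add: flow_def)
qed

lemma commutator_iff_exponents:
  assumes "v \<in> words {..<r}"
  shows "cls {..<r} v \<in> derived_term (free_group {..<r}) 1 \<longleftrightarrow> (\<forall>x<r. exponent x v = 0)"
proof
  assume "\<forall>x<r. exponent x v = 0"
  moreover have "gen (v ! k) < r" if "k < length v" for k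
  proof -
    have "v ! k \<in> letters {..<r}" using assms that by (simp add: in_lists_conv_set)
    then show ?thesis by (auto simp: letters_def)
  qed
  ultimately have "same_prefix {..<r} (Suc 0) v 0 (length v)"
    using same_prefix_Suc[OF assms, of 0 "length v" 0] flow_0_exponent[OF assms] by (simp add: flow_def)
  then show "cls {..<r} v \<in> derived_term (free_group {..<r}) 1"
    using same_prefix_full[OF assms, of 1] by simp
qed (use assms exponent_derived_term in auto)

text \<open>In rank one every word is the power of the generator given by its exponent sum; in rank
  zero the only word is empty.\<close>

lemma rank_one_trivial:
  assumes r: "r \<le> 1" and v: "v \<in> words {..<r}" and e: "\<forall>x<r. exponent x v = 0"
  shows "cls {..<r} v = \<one>\<^bsub>free_group {..<r}\<^esub>"
proof (cases "v = []")
  case False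
  interpret group "free_group {..<r}" by (rule group_free_group)
  let ?F = "free_group {..<r}" and ?x = "cls {..<r} [Gen 0]"
  have "r = 1" using False v r by (cases v; cases r) (auto simp: letters_def)
  then have x: "[Gen 0] \<in> words {..<r}" by (auto simp: letters_def)
  then have xc: "?x \<in> carrier ?F" by simp
  have "cls {..<r} w = ?x [^]\<^bsub>?F\<^esub> exponent 0 w" if "w \<in> words {..<r}" for w
    using that
  proof (induction w rule: list.induct)
    case (Cons l w)
    then have l: "l = Gen 0 \<or> l = InvGen 0" using \<open>r = 1\<close> by (auto simp: letters_def)
    have lw: "[l] \<in> words {..<r}" "w \<in> words {..<r}" using Cons.prems by simp_all
    have "cls {..<r} [l] = ?x [^]\<^bsub>?F\<^esub> sgn_letter l"
      using l
    proof
      assume "l = Gen 0"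
      then show ?thesis using int_pow_1[OF xc] by (simp only: sgn_letter_def positive.simps if_True)
    next
      assume l: "l = InvGen 0"
      have "cls {..<r} [InvGen 0] = inv\<^bsub>?F\<^esub> ?x" using cls_inv_word[OF x] by simp
      moreover have "?x [^]\<^bsub>?F\<^esub> (- 1 :: int) = inv\<^bsub>?F\<^esub> ?x"
        using int_pow_neg[OF xc, of 1] int_pow_1[OF xc] by simp
      ultimately show ?thesis unfolding l by (simp only: sgn_letter_def positive.simps if_False)
    qed
    then have "cls {..<r} ([l] @ w) = ?x [^]\<^bsub>?F\<^esub> (sgn_letter l + exponent 0 w)"
      using Cons.IH[OF lw(2)] xc by (simp only: cls_append[OF lw] int_pow_mult)
    moreover have "exponent 0 (l # w) = sgn_letter l + exponent 0 w"
      using l by (auto simp: exponent_def)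
    ultimately show ?case by simp
  qed (simp add: cls_Nil exponent_def)
  then show ?thesis using v e \<open>r = 1\<close> by simp
qed (simp add: cls_Nil)

theorem corollary1:
  fixes G :: "('g, 'm) monoid_scheme" and X :: "'g set"
  assumes "fg_free_solvable_group G"
    and "finite X" and "X \<subseteq> carrier G" and "generate G X = carrier G"
  shows "linear_average_case_word_problem G X"
proof -
  obtain r d \<phi> where "group G"
    and \<phi>: "\<phi> \<in> iso G (free_group {..<r::nat} Mod derived_term (free_group {..<r}) d)"
    using assms(1) by (auto simp: fg_free_solvable_group_def is_iso_def)
  then interpret presented G X r d \<phi> using assms by (intro presented.intro)
  \<comment> \<open>The trivial group needs no counter. For \<open>d = 1\<close> the quotient is the
    abelianization, and for \<open>r \<le> 1\<close> the free group is itself abelian; both use one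
    counter per generator.\<close>
  consider "d = 0" | "1 \<le> d" "d = 1 \<or> r \<le> 1" | "2 \<le> d" "2 \<le> r" by linarith
  then show ?thesis
  proof cases
    case 1
    then show ?thesis
      by (intro linear_if_counters[of 0]) (simp add: derived_term_def del: in_lists_conv_set)
  next
    case 2
    have "cls {..<r} v \<in> derived_term (free_group {..<r}) d \<longleftrightarrow> (\<forall>x<r. exponent x v = 0)"
      if v: "v \<in> words {..<r}" for v
    proof (cases "d = 1")
      case False
      then have "r \<le> 1" using 2 by simp
      then show ?thesis using rank_one_trivial[OF _ v] exponent_derived_term[OF v _ 2(1)] N.one_closed
        by auto
    qed (use commutator_iff_exponents[OF v] in simp)
    then show ?thesis by (rule linear_if_counters)
  next
    case 3
    then show ?thesis by (rule linear_if_nonabelian)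
  qed
qed

end
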